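(* Let $R$ be an associative ring with unity. The following are equivalent: (1) the class of locally injective left $R$-modules is $\lambda$-categorical in all cardinals $\lambda > \mathrm{card}(R)+\aleph_0$; (2) the class of locally injective left $R$-modules is $\lambda$-categorical in some cardinal $\lambda > 2^{\mathrm{card}(R)+\aleph_0}$; (3) $R$ is left noetherian and there is a unique indecomposable injective left $R$-module up to isomorphism.
   Context: All modules are left modules; $\mathrm{card}(R)$ is the cardinality of $R$. The size of a module is the cardinality of its underlying set. A class of modules is $\lambda$-categorical if it contains a module of size $\lambda$ and any two modules in the class of size $\lambda$ are isomorphic. A left module $M$ is locally injective (also called finitely injective) if every finite subset of $M$ is contained in an injective submodule of $M$. A module is indecomposable if it is nonzero and cannot be written as the direct sum of two nonzero submodules. In (3), "there is a unique" means existence and uniqueness up to isomorphism. *)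

theory Defs
  imports Main "HOL-Algebra.Module" "HOL-Algebra.Ideal"
begin

unbundle cardinal_syntax

text \<open>
  The library's locale \<open>module\<close> requires a commutative ring of scalars. The locale below has the
  same axioms over an arbitrary ring and uses the same record, whose fields \<open>mult\<close> and \<open>one\<close> play
  no role.
\<close>

locale left_module = R?: ring + M?: abelian_group M for M (structure) +
  assumes smult_closed [simp, intro]:
      "\<lbrakk>a \<in> carrier R; x \<in> carrier M\<rbrakk> \<Longrightarrow> a \<odot>\<^bsub>M\<^esub> x \<in> carrier M"
    and smult_l_distr:
      "\<lbrakk>a \<in> carrier R; b \<in> carrier R; x \<in> carrier M\<rbrakk> \<Longrightarrow>
      (a \<oplus> b) \<odot>\<^bsub>M\<^esub> x = a \<odot>\<^bsub>M\<^esub> x \<oplus>\<^bsub>M\<^esub> b \<odot>\<^bsub>M\<^esub> x"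
    and smult_r_distr:
      "\<lbrakk>a \<in> carrier R; x \<in> carrier M; y \<in> carrier M\<rbrakk> \<Longrightarrow>
      a \<odot>\<^bsub>M\<^esub> (x \<oplus>\<^bsub>M\<^esub> y) = a \<odot>\<^bsub>M\<^esub> x \<oplus>\<^bsub>M\<^esub> a \<odot>\<^bsub>M\<^esub> y"
    and smult_assoc1:
      "\<lbrakk>a \<in> carrier R; b \<in> carrier R; x \<in> carrier M\<rbrakk> \<Longrightarrow>
      (a \<otimes> b) \<odot>\<^bsub>M\<^esub> x = a \<odot>\<^bsub>M\<^esub> (b \<odot>\<^bsub>M\<^esub> x)"
    and smult_one [simp]:
      "x \<in> carrier M \<Longrightarrow> \<one> \<odot>\<^bsub>M\<^esub> x = x"

definition lmod_hom ::
  "('r, 'x) ring_scheme \<Rightarrow> ('r, 'a) module \<Rightarrow> ('r, 'b) module \<Rightarrow> ('a \<Rightarrow> 'b) set" where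
  "lmod_hom R M N =
    {h \<in> carrier M \<rightarrow> carrier N.
      (\<forall>x\<in>carrier M. \<forall>y\<in>carrier M. h (x \<oplus>\<^bsub>M\<^esub> y) = h x \<oplus>\<^bsub>N\<^esub> h y) \<and>
      (\<forall>a\<in>carrier R. \<forall>x\<in>carrier M. h (a \<odot>\<^bsub>M\<^esub> x) = a \<odot>\<^bsub>N\<^esub> h x)}"

definition lmod_iso ::
  "('r, 'x) ring_scheme \<Rightarrow> ('r, 'a) module \<Rightarrow> ('r, 'b) module \<Rightarrow> bool" where
  "lmod_iso R M N \<longleftrightarrow> (\<exists>h\<in>lmod_hom R M N. bij_betw h (carrier M) (carrier N))"

text \<open>
  The test modules \<open>A\<close>, \<open>B\<close> live on the same type as \<open>E\<close>, since a definition cannot quantify over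
  types. As soon as that type is at least as large as the ring, it carries copies of the ring and
  of all its left ideals, so that by Baer's criterion this is injectivity with respect to modules
  on all types. Only such types are used below.
\<close>

definition injective_module :: "('r, 'x) ring_scheme \<Rightarrow> ('r, 'm) module \<Rightarrow> bool" where
  "injective_module R E \<longleftrightarrow>
    left_module R E \<and>
    (\<forall>(A :: ('r, 'm) module) (B :: ('r, 'm) module).
      left_module R A \<longrightarrow> left_module R B \<longrightarrow>
      (\<forall>f\<in>lmod_hom R A B. inj_on f (carrier A) \<longrightarrow>
        (\<forall>g\<in>lmod_hom R A E. \<exists>h\<in>lmod_hom R B E. \<forall>x\<in>carrier A. h (f x) = g x)))"

definition locally_injective :: "('r, 'x) ring_scheme \<Rightarrow> ('r, 'm) module \<Rightarrow> bool" where
  "locally_injective R M \<longleftrightarrow>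
    left_module R M \<and>
    (\<forall>F. finite F \<and> F \<subseteq> carrier M \<longrightarrow>
      (\<exists>N. submodule N R M \<and> F \<subseteq> N \<and> injective_module R (M\<lparr>carrier := N\<rparr>)))"

definition indecomposable_module :: "('r, 'x) ring_scheme \<Rightarrow> ('r, 'm) module \<Rightarrow> bool" where
  "indecomposable_module R M \<longleftrightarrow>
    left_module R M \<and> carrier M \<noteq> {\<zero>\<^bsub>M\<^esub>} \<and>
    \<not> (\<exists>N K. submodule N R M \<and> submodule K R M \<and>
          N \<noteq> {\<zero>\<^bsub>M\<^esub>} \<and> K \<noteq> {\<zero>\<^bsub>M\<^esub>} \<and>
          N <+>\<^bsub>M\<^esub> K = carrier M \<and> N \<inter> K = {\<zero>\<^bsub>M\<^esub>})"

locale left_ideal = additive_subgroup I R + ring R for I and R (structure) +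
  assumes l_closed: "\<lbrakk>a \<in> I; x \<in> carrier R\<rbrakk> \<Longrightarrow> x \<otimes> a \<in> I"

definition left_noetherian :: "('r, 'x) ring_scheme \<Rightarrow> bool" where
  "left_noetherian R \<longleftrightarrow>
    (\<forall>I :: nat \<Rightarrow> 'r set. (\<forall>n. left_ideal (I n) R) \<and> (\<forall>n. I n \<subseteq> I (Suc n)) \<longrightarrow>
      (\<exists>n. \<forall>m\<ge>n. I m = I n))"

text \<open>
  Cardinals are the library's cardinal orders. A cardinal on a subset of \<open>'m\<close> ranges, up to
  equality of cardinals, over exactly the possible sizes of modules with elements in \<open>'m\<close>.

  Since a formula cannot quantify over types, the theorem states each of its three conditions for
  the modules with elements in a type of its own, which is arbitrary subject to having more than
  $2^{card(R)+aleph_0}$ elements. The three types are independent of each other: categoricity in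
  one cardinal of the second type yields categoricity in all cardinals of the first, however large
  that one is. Every indecomposable injective module has at most $2^{card(R)+aleph_0}$ elements
  and so has a copy on the third.
\<close>

definition categorical_in ::
  "('r, 'x) ring_scheme \<Rightarrow> 'm rel \<Rightarrow> ('r, 'm) module set \<Rightarrow> bool" where
  "categorical_in R l K \<longleftrightarrow>
    (\<exists>M\<in>K. |carrier M| =o l) \<and>
    (\<forall>M\<in>K. \<forall>N\<in>K. |carrier M| =o l \<and> |carrier N| =o l \<longrightarrow> lmod_iso R M N)"

end

theory Submission
  imports Complex_Main "HOL-Algebra.Free_Abelian_Groups" Defs
begin

text \<open>
  Write \<open>k\<close> for the cardinal of the ring \<open>R\<close> plus aleph-zero. By Baer's criterion, injectivity can be
  tested on left ideals, and this makes it independent of the type of the elements (\<open>baer\<close>,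
  \<open>injective_module_iff_baer\<close>).

  Let \<open>R\<close> be left noetherian. Since left ideals are finitely generated, locally injective modules are
  injective (\<open>locally_baer_imp_baer\<close>). Every nonzero submodule of an injective module contains a
  uniform submodule, whose injective hull is indecomposable, so if \<open>E\<close> is the only
  indecomposable injective module, then Zorn's lemma makes every injective module a direct sum of copies of \<open>E\<close>
  (\<open>baer_iso_direct_power\<close>). Moreover \<open>E\<close> has at most \<open>k\<close> elements (\<open>card_indecomposable_baer\<close>).
  Hence a locally injective module of size \<open>l > k\<close> is the direct sum of \<open>l\<close> copies of \<open>E\<close>, which
  is categoricity in all \<open>l > k\<close>.

  Conversely, suppose categoricity in one \<open>l > 2^k\<close>. The main point is that \<open>R\<close> is left noetherian. The
  character module \<open>C\<close>, formed by the homomorphisms from the additive group of \<open>R\<close> to the nonzero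
  complex numbers, is an injective cogenerator of size at most \<open>2^k\<close>. Two locally injective modules are
  compared. One is the direct sum of \<open>l\<close> copies of \<open>C\<close>. The other one is its product with an injective
  module \<open>N\<close>, the power of \<open>C\<close> over an index set whose size is the successor of \<open>2^k\<close>, restricted to
  the functions with support of size at most \<open>k\<close>. By Hausdorff's formula \<open>N\<close> has at most \<open>l\<close> elements,
  so both modules have size \<open>l\<close>, and an isomorphism embeds \<open>N\<close> into a direct sum of copies of \<open>C\<close>. If
  there were a strictly increasing sequence of left ideals, one could form in \<open>N\<close> an infinite sum \<open>x\<close> of
  elements that are killed by more and more of these ideals; multiplication by suitable elements of
  the ideals would then show that the image of \<open>x\<close> has infinitely many nonzero coordinates
  (\<open>embedding_imp_left_noetherian\<close>). The successor of \<open>2^k\<close> is needed for this, because the places of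
  the summands must be chosen among more than \<open>2^k\<close> many.

  Once \<open>R\<close> is left noetherian, \<open>C\<close> contains an indecomposable injective module. If \<open>E\<close> and \<open>E'\<close> are two of
  them, then the direct sums of \<open>l\<close> copies of each have size \<open>l\<close>, so they are isomorphic. As \<open>E\<close> is
  uniform, some coordinate of an embedding of \<open>E\<close> into a direct sum of copies of \<open>E'\<close> is injective, and
  its image is a direct summand of \<open>E'\<close>, hence all of \<open>E'\<close>
  (\<open>indecomposable_baer_embed_power_iso\<close>).
\<close>

section \<open>Left modules, submodules and homomorphisms\<close>

text \<open>Additive inverses come from the scalar \<open>-1\<close>: it is enough that \<open>0\<close> acts as zero.\<close>

lemma left_moduleI_smult_zero:
  fixes M :: "('r, 'm, 'z) module_scheme" and R :: "('r, 'x) ring_scheme"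
  assumes "ring R"
    and zero: "\<zero>\<^bsub>M\<^esub> \<in> carrier M"
    and add: "\<And>x y. x \<in> carrier M \<Longrightarrow> y \<in> carrier M \<Longrightarrow> x \<oplus>\<^bsub>M\<^esub> y \<in> carrier M"
    and smult: "\<And>a x. a \<in> carrier R \<Longrightarrow> x \<in> carrier M \<Longrightarrow> a \<odot>\<^bsub>M\<^esub> x \<in> carrier M"
    and assoc: "\<And>x y z. x \<in> carrier M \<Longrightarrow> y \<in> carrier M \<Longrightarrow> z \<in> carrier M \<Longrightarrow>
      (x \<oplus>\<^bsub>M\<^esub> y) \<oplus>\<^bsub>M\<^esub> z = x \<oplus>\<^bsub>M\<^esub> (y \<oplus>\<^bsub>M\<^esub> z)"
    and comm: "\<And>x y. x \<in> carrier M \<Longrightarrow> y \<in> carrier M \<Longrightarrow> x \<oplus>\<^bsub>M\<^esub> y = y \<oplus>\<^bsub>M\<^esub> x"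
    and l_zero: "\<And>x. x \<in> carrier M \<Longrightarrow> \<zero>\<^bsub>M\<^esub> \<oplus>\<^bsub>M\<^esub> x = x"
    and l_null: "\<And>x. x \<in> carrier M \<Longrightarrow> \<zero>\<^bsub>R\<^esub> \<odot>\<^bsub>M\<^esub> x = \<zero>\<^bsub>M\<^esub>"
    and l_distr: "\<And>a b x. a \<in> carrier R \<Longrightarrow> b \<in> carrier R \<Longrightarrow> x \<in> carrier M \<Longrightarrow>
      (a \<oplus>\<^bsub>R\<^esub> b) \<odot>\<^bsub>M\<^esub> x = a \<odot>\<^bsub>M\<^esub> x \<oplus>\<^bsub>M\<^esub> b \<odot>\<^bsub>M\<^esub> x"
    and r_distr: "\<And>a x y. a \<in> carrier R \<Longrightarrow> x \<in> carrier M \<Longrightarrow> y \<in> carrier M \<Longrightarrow>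
      a \<odot>\<^bsub>M\<^esub> (x \<oplus>\<^bsub>M\<^esub> y) = a \<odot>\<^bsub>M\<^esub> x \<oplus>\<^bsub>M\<^esub> a \<odot>\<^bsub>M\<^esub> y"
    and sassoc: "\<And>a b x. a \<in> carrier R \<Longrightarrow> b \<in> carrier R \<Longrightarrow> x \<in> carrier M \<Longrightarrow>
      (a \<otimes>\<^bsub>R\<^esub> b) \<odot>\<^bsub>M\<^esub> x = a \<odot>\<^bsub>M\<^esub> (b \<odot>\<^bsub>M\<^esub> x)"
    and one: "\<And>x. x \<in> carrier M \<Longrightarrow> \<one>\<^bsub>R\<^esub> \<odot>\<^bsub>M\<^esub> x = x"
  shows "left_module R M"
proof -
  interpret R: ring R by fact
  have "abelian_group M"
  proof (rule abelian_groupI)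
    fix x assume x: "x \<in> carrier M"
    have "((\<ominus>\<^bsub>R\<^esub> \<one>\<^bsub>R\<^esub>) \<odot>\<^bsub>M\<^esub> x) \<oplus>\<^bsub>M\<^esub> x = (\<ominus>\<^bsub>R\<^esub> \<one>\<^bsub>R\<^esub> \<oplus>\<^bsub>R\<^esub> \<one>\<^bsub>R\<^esub>) \<odot>\<^bsub>M\<^esub> x"
      using x by (simp add: l_distr one)
    also have "\<dots> = \<zero>\<^bsub>M\<^esub>" using x by (simp add: R.l_neg l_null)
    finally show "\<exists>y\<in>carrier M. y \<oplus>\<^bsub>M\<^esub> x = \<zero>\<^bsub>M\<^esub>"
      using smult[of "\<ominus>\<^bsub>R\<^esub> \<one>\<^bsub>R\<^esub>" x] x by auto
  qed (use assms in auto)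
  then show ?thesis
    by (intro left_module.intro left_module_axioms.intro assms) auto
qed

context left_module
begin

lemma l_null [simp]: "x \<in> carrier M \<Longrightarrow> \<zero>\<^bsub>R\<^esub> \<odot>\<^bsub>M\<^esub> x = \<zero>\<^bsub>M\<^esub>"
proof -
  assume x: "x \<in> carrier M"
  have "\<zero>\<^bsub>R\<^esub> \<odot>\<^bsub>M\<^esub> x \<oplus>\<^bsub>M\<^esub> \<zero>\<^bsub>R\<^esub> \<odot>\<^bsub>M\<^esub> x = \<zero>\<^bsub>R\<^esub> \<odot>\<^bsub>M\<^esub> x"
    using x smult_l_distr[of "\<zero>\<^bsub>R\<^esub>" "\<zero>\<^bsub>R\<^esub>" x] by simp
  then show ?thesis using x by (metis M.add.r_cancel_one R.zero_closed smult_closed)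
qed

lemma r_null [simp]: "a \<in> carrier R \<Longrightarrow> a \<odot>\<^bsub>M\<^esub> \<zero>\<^bsub>M\<^esub> = \<zero>\<^bsub>M\<^esub>"
  by (metis M.zero_closed R.r_null R.zero_closed l_null smult_assoc1)

lemma minus_one_smult: "x \<in> carrier M \<Longrightarrow> (\<ominus>\<^bsub>R\<^esub> \<one>\<^bsub>R\<^esub>) \<odot>\<^bsub>M\<^esub> x = \<ominus>\<^bsub>M\<^esub> x"
proof -
  assume x: "x \<in> carrier M"
  have "((\<ominus>\<^bsub>R\<^esub> \<one>\<^bsub>R\<^esub>) \<odot>\<^bsub>M\<^esub> x) \<oplus>\<^bsub>M\<^esub> x = (\<ominus>\<^bsub>R\<^esub> \<one>\<^bsub>R\<^esub> \<oplus>\<^bsub>R\<^esub> \<one>\<^bsub>R\<^esub>) \<odot>\<^bsub>M\<^esub> x"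
    using x by (simp add: smult_l_distr)
  also have "\<dots> = \<zero>\<^bsub>M\<^esub>" using x by (simp add: R.l_neg)
  finally show ?thesis using x by (metis M.minus_equality R.add.inv_closed R.one_closed smult_closed)
qed

lemma submodule_iff:
  "submodule N R M \<longleftrightarrow> N \<subseteq> carrier M \<and> \<zero>\<^bsub>M\<^esub> \<in> N \<and> (\<forall>x\<in>N. \<forall>y\<in>N. x \<oplus>\<^bsub>M\<^esub> y \<in> N) \<and>
    (\<forall>a\<in>carrier R. \<forall>x\<in>N. a \<odot>\<^bsub>M\<^esub> x \<in> N)" (is "_ \<longleftrightarrow> ?rhs")
proof
  assume "submodule N R M"
  then interpret submodule N R M .
  show ?rhs using subset m_closed one_closed by auto
next
  assume r: ?rhs
  show "submodule N R M"
  proof (intro submodule.intro subgroup.intro submodule_axioms.intro)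
    fix x assume x: "x \<in> N"
    have "(\<ominus>\<^bsub>R\<^esub> \<one>\<^bsub>R\<^esub>) \<odot>\<^bsub>M\<^esub> x \<in> N" using r x by auto
    moreover have "(\<ominus>\<^bsub>R\<^esub> \<one>\<^bsub>R\<^esub>) \<odot>\<^bsub>M\<^esub> x = \<ominus>\<^bsub>M\<^esub> x" using minus_one_smult r x by blast
    ultimately show "inv\<^bsub>add_monoid M\<^esub> x \<in> N" by (simp add: a_inv_def)
  qed (use r in auto)
qed

lemma
  assumes "submodule N R M"
  shows submodule_subset: "N \<subseteq> carrier M"
    and submodule_carrier: "\<And>x. x \<in> N \<Longrightarrow> x \<in> carrier M"
    and submodule_zero: "\<zero>\<^bsub>M\<^esub> \<in> N"
    and submodule_add: "\<And>x y. x \<in> N \<Longrightarrow> y \<in> N \<Longrightarrow> x \<oplus>\<^bsub>M\<^esub> y \<in> N"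
    and submodule_smult: "\<And>a x. a \<in> carrier R \<Longrightarrow> x \<in> N \<Longrightarrow> a \<odot>\<^bsub>M\<^esub> x \<in> N"
    and submodule_neg: "\<And>x. x \<in> N \<Longrightarrow> \<ominus>\<^bsub>M\<^esub> x \<in> N"
proof -
  note N = assms[unfolded submodule_iff]
  show "N \<subseteq> carrier M" "\<And>x. x \<in> N \<Longrightarrow> x \<in> carrier M" "\<zero>\<^bsub>M\<^esub> \<in> N"
    "\<And>x y. x \<in> N \<Longrightarrow> y \<in> N \<Longrightarrow> x \<oplus>\<^bsub>M\<^esub> y \<in> N"
    "\<And>a x. a \<in> carrier R \<Longrightarrow> x \<in> N \<Longrightarrow> a \<odot>\<^bsub>M\<^esub> x \<in> N"
    using N by auto
  show "\<ominus>\<^bsub>M\<^esub> x \<in> N" if "x \<in> N" for x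
  proof -
    have "(\<ominus>\<^bsub>R\<^esub> \<one>\<^bsub>R\<^esub>) \<odot>\<^bsub>M\<^esub> x \<in> N" using N that by auto
    moreover have "x \<in> carrier M" using N that by auto
    ultimately show ?thesis using minus_one_smult by simp
  qed
qed

lemma submodule_left_module:
  assumes "submodule N R M" shows "left_module R (M\<lparr>carrier := N\<rparr>)"
  using assms[unfolded submodule_iff] R.ring_axioms
  by (intro left_moduleI_smult_zero)
    (auto simp: subset_iff M.a_ac smult_l_distr smult_r_distr smult_assoc1)

lemma submodule_UNIV [simp]: "submodule (carrier M) R M"
  by (simp add: submodule_iff)

lemma submodule_zero_set [simp]: "submodule {\<zero>\<^bsub>M\<^esub>} R M"
  by (simp add: submodule_iff)

lemma submodule_of_submodule_iff:
  assumes "submodule N R M"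
  shows "submodule K R (M\<lparr>carrier := N\<rparr>) \<longleftrightarrow> submodule K R M \<and> K \<subseteq> N"
  unfolding left_module.submodule_iff[OF submodule_left_module[OF assms]] submodule_iff
  using submodule_subset[OF assms] by auto

lemma submodule_set_add:
  assumes "submodule N R M" "submodule K R M"
  shows "submodule (N <+>\<^bsub>M\<^esub> K) R M"
proof -
  note N = submodule_carrier[OF assms(1)] and K = submodule_carrier[OF assms(2)]
  have 1: "(x \<oplus>\<^bsub>M\<^esub> y) \<oplus>\<^bsub>M\<^esub> (x' \<oplus>\<^bsub>M\<^esub> y') = (x \<oplus>\<^bsub>M\<^esub> x') \<oplus>\<^bsub>M\<^esub> (y \<oplus>\<^bsub>M\<^esub> y')"
    if "x \<in> N" "x' \<in> N" "y \<in> K" "y' \<in> K" for x x' y y'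
    using that N K by (simp add: M.a_ac)
  show ?thesis
    unfolding submodule_iff
  proof (intro conjI ballI)
    show "N <+>\<^bsub>M\<^esub> K \<subseteq> carrier M" using N K by (auto simp: set_add_def')
    have "\<zero>\<^bsub>M\<^esub> \<oplus>\<^bsub>M\<^esub> \<zero>\<^bsub>M\<^esub> \<in> N <+>\<^bsub>M\<^esub> K"
      using submodule_zero assms unfolding set_add_def' by blast
    then show "\<zero>\<^bsub>M\<^esub> \<in> N <+>\<^bsub>M\<^esub> K" by simp
  next
    fix u v assume "u \<in> N <+>\<^bsub>M\<^esub> K" "v \<in> N <+>\<^bsub>M\<^esub> K"
    then obtain x y x' y' where *: "x \<in> N" "x' \<in> N" "y \<in> K" "y' \<in> K"
      "u = x \<oplus>\<^bsub>M\<^esub> y" "v = x' \<oplus>\<^bsub>M\<^esub> y'" unfolding set_add_def' by blast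
    show "u \<oplus>\<^bsub>M\<^esub> v \<in> N <+>\<^bsub>M\<^esub> K"
      unfolding *(5,6) 1[OF *(1-4)] using * submodule_add assms unfolding set_add_def' by blast
  next
    fix a u assume a: "a \<in> carrier R" and "u \<in> N <+>\<^bsub>M\<^esub> K"
    then obtain x y where *: "x \<in> N" "y \<in> K" "u = x \<oplus>\<^bsub>M\<^esub> y" unfolding set_add_def' by blast
    have "a \<odot>\<^bsub>M\<^esub> u = a \<odot>\<^bsub>M\<^esub> x \<oplus>\<^bsub>M\<^esub> a \<odot>\<^bsub>M\<^esub> y" using * N K a by (simp add: smult_r_distr)
    then show "a \<odot>\<^bsub>M\<^esub> u \<in> N <+>\<^bsub>M\<^esub> K"
      using * a submodule_smult assms unfolding set_add_def' by blast
  qed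
qed

lemma submodule_Int:
  assumes "submodule N R M" "submodule K R M"
  shows "submodule (N \<inter> K) R M"
  using assms by (auto simp: submodule_iff)

lemma subset_set_add:
  assumes "submodule N R M" "submodule K R M"
  shows "N \<subseteq> N <+>\<^bsub>M\<^esub> K" "K \<subseteq> N <+>\<^bsub>M\<^esub> K"
proof -
  note N = submodule_carrier[OF assms(1)] and K = submodule_carrier[OF assms(2)]
  show "N \<subseteq> N <+>\<^bsub>M\<^esub> K"
    unfolding set_add_def' using submodule_zero[OF assms(2)] N by (force simp: M.r_zero)
  show "K \<subseteq> N <+>\<^bsub>M\<^esub> K"
    unfolding set_add_def' using submodule_zero[OF assms(1)] K by (force simp: M.l_zero)
qed

lemma submodule_cyclic:
  assumes "x \<in> carrier M" shows "submodule ((\<lambda>a. a \<odot>\<^bsub>M\<^esub> x) ` carrier R) R M"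
  unfolding submodule_iff
  using assms apply safe
  apply simp
  apply (metis R.zero_closed image_eqI l_null)
  apply (metis R.add.m_closed image_eqI smult_l_distr)
  by (metis R.m_closed image_eqI smult_assoc1)

text \<open>The two differences lie in both submodules.\<close>

lemma independent_sum_eq:
  assumes "submodule N R M" "submodule K R M" "N \<inter> K \<subseteq> {\<zero>\<^bsub>M\<^esub>}"
    and "x \<in> N" "x' \<in> N" "y \<in> K" "y' \<in> K" "x \<oplus>\<^bsub>M\<^esub> y = x' \<oplus>\<^bsub>M\<^esub> y'"
  shows "x = x' \<and> y = y'"
proof -
  note N = submodule_carrier[OF assms(1)] and K = submodule_carrier[OF assms(2)]
  have c: "x \<in> carrier M" "x' \<in> carrier M" "y \<in> carrier M" "y' \<in> carrier M"
    using assms N K by auto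
  have sw: "(u \<oplus>\<^bsub>M\<^esub> v) \<oplus>\<^bsub>M\<^esub> (\<ominus>\<^bsub>M\<^esub> x' \<oplus>\<^bsub>M\<^esub> \<ominus>\<^bsub>M\<^esub> y) = (u \<oplus>\<^bsub>M\<^esub> \<ominus>\<^bsub>M\<^esub> x') \<oplus>\<^bsub>M\<^esub> (v \<oplus>\<^bsub>M\<^esub> \<ominus>\<^bsub>M\<^esub> y)"
    if "u \<in> carrier M" "v \<in> carrier M" for u v
    using c that by (simp add: M.a_ac)
  have "x \<oplus>\<^bsub>M\<^esub> \<ominus>\<^bsub>M\<^esub> x' = y' \<oplus>\<^bsub>M\<^esub> \<ominus>\<^bsub>M\<^esub> y"
    using sw[of x y] sw[of x' y'] c by (simp add: assms(8) M.r_neg)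
  moreover have "x \<oplus>\<^bsub>M\<^esub> \<ominus>\<^bsub>M\<^esub> x' \<in> N" "y' \<oplus>\<^bsub>M\<^esub> \<ominus>\<^bsub>M\<^esub> y \<in> K"
    using assms submodule_add submodule_neg by blast+
  ultimately have "x \<oplus>\<^bsub>M\<^esub> \<ominus>\<^bsub>M\<^esub> x' = \<zero>\<^bsub>M\<^esub>" "y' \<oplus>\<^bsub>M\<^esub> \<ominus>\<^bsub>M\<^esub> y = \<zero>\<^bsub>M\<^esub>"
    using assms(3) by auto
  then show ?thesis
    by (metis M.add.inv_closed M.minus_equality M.minus_minus c)
qed

end

lemma lmod_homI:
  assumes "\<And>x. x \<in> carrier M \<Longrightarrow> h x \<in> carrier N"
    and "\<And>x y. x \<in> carrier M \<Longrightarrow> y \<in> carrier M \<Longrightarrow> h (x \<oplus>\<^bsub>M\<^esub> y) = h x \<oplus>\<^bsub>N\<^esub> h y"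
    and "\<And>a x. a \<in> carrier R \<Longrightarrow> x \<in> carrier M \<Longrightarrow> h (a \<odot>\<^bsub>M\<^esub> x) = a \<odot>\<^bsub>N\<^esub> h x"
  shows "h \<in> lmod_hom R M N"
  using assms by (auto simp: lmod_hom_def)

lemma
  assumes "h \<in> lmod_hom R M N"
  shows lmod_hom_closed: "\<And>x. x \<in> carrier M \<Longrightarrow> h x \<in> carrier N"
    and lmod_hom_add: "\<And>x y. x \<in> carrier M \<Longrightarrow> y \<in> carrier M \<Longrightarrow> h (x \<oplus>\<^bsub>M\<^esub> y) = h x \<oplus>\<^bsub>N\<^esub> h y"
    and lmod_hom_smult: "\<And>a x. a \<in> carrier R \<Longrightarrow> x \<in> carrier M \<Longrightarrow> h (a \<odot>\<^bsub>M\<^esub> x) = a \<odot>\<^bsub>N\<^esub> h x"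
  using assms by (auto simp: lmod_hom_def)

lemma lmod_hom_comp:
  assumes "f \<in> lmod_hom R M N" "g \<in> lmod_hom R N P"
  shows "(\<lambda>x. g (f x)) \<in> lmod_hom R M P"
  using assms by (auto simp: lmod_hom_def Pi_iff)

locale lmodule_hom = M: left_module R M + N: left_module R N for R M N +
  fixes h assumes hom: "h \<in> lmod_hom R M N"
begin

lemmas closed = lmod_hom_closed[OF hom] and add = lmod_hom_add[OF hom]
  and smult = lmod_hom_smult[OF hom]

lemma zero: "h \<zero>\<^bsub>M\<^esub> = \<zero>\<^bsub>N\<^esub>"
  by (metis M.M.zero_closed M.R.zero_closed M.l_null N.l_null closed smult)

lemma neg: "x \<in> carrier M \<Longrightarrow> h (\<ominus>\<^bsub>M\<^esub> x) = \<ominus>\<^bsub>N\<^esub> h x"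
  by (metis M.R.add.inv_closed M.R.one_closed M.minus_one_smult N.minus_one_smult closed smult)

lemma inj_iff:
  "inj_on h (carrier M) \<longleftrightarrow> (\<forall>x\<in>carrier M. h x = \<zero>\<^bsub>N\<^esub> \<longrightarrow> x = \<zero>\<^bsub>M\<^esub>)"
proof
  assume "inj_on h (carrier M)"
  then show "\<forall>x\<in>carrier M. h x = \<zero>\<^bsub>N\<^esub> \<longrightarrow> x = \<zero>\<^bsub>M\<^esub>"
    using zero by (metis M.M.zero_closed inj_onD)
next
  assume k: "\<forall>x\<in>carrier M. h x = \<zero>\<^bsub>N\<^esub> \<longrightarrow> x = \<zero>\<^bsub>M\<^esub>"
  show "inj_on h (carrier M)"
  proof (rule inj_onI)
    fix x y assume xy: "x \<in> carrier M" "y \<in> carrier M" "h x = h y"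
    then have "h (x \<oplus>\<^bsub>M\<^esub> \<ominus>\<^bsub>M\<^esub> y) = \<zero>\<^bsub>N\<^esub>"
      by (simp add: add neg N.M.r_neg closed)
    then have "x \<oplus>\<^bsub>M\<^esub> \<ominus>\<^bsub>M\<^esub> y = \<zero>\<^bsub>M\<^esub>" using k xy by simp
    then show "x = y" using xy
      by (metis M.M.add.inv_closed M.M.minus_equality M.M.minus_minus)
  qed
qed

lemma submodule_image:
  assumes "submodule K R M" shows "submodule (h ` K) R N"
  unfolding N.submodule_iff
  apply safe
  using M.submodule_carrier[OF assms] closed apply blast
  using M.submodule_zero[OF assms] zero apply (metis image_eqI)
  using M.submodule_carrier[OF assms] M.submodule_add[OF assms] add apply (metis image_eqI)
  using M.submodule_carrier[OF assms] M.submodule_smult[OF assms] smult by (metis image_eqI)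

lemma submodule_vimage:
  assumes "submodule K R N" shows "submodule {x \<in> carrier M. h x \<in> K} R M"
  using assms by (auto simp: M.submodule_iff N.submodule_iff zero add smult)

lemma submodule_kernel: "submodule {x \<in> carrier M. h x = \<zero>\<^bsub>N\<^esub>} R M"
  using submodule_vimage[of "{\<zero>\<^bsub>N\<^esub>}"] by simp

end

lemma lmodule_homI:
  assumes "left_module R M" "left_module R N" "h \<in> lmod_hom R M N" shows "lmodule_hom R M N h"
  using assms by (simp add: lmodule_hom_def lmodule_hom_axioms_def)

lemma lmod_isoE:
  assumes "lmod_iso R M N"
  obtains h where "h \<in> lmod_hom R M N" "bij_betw h (carrier M) (carrier N)"
  using assms by (auto simp: lmod_iso_def)

lemma inv_into_lmod_hom:
  assumes "left_module R M" and h: "h \<in> lmod_hom R M N" "bij_betw h (carrier M) (carrier N)"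
  shows "inv_into (carrier M) h \<in> lmod_hom R N M"
proof -
  interpret M: left_module R M by fact
  let ?k = "inv_into (carrier M) h"
  have k: "?k y \<in> carrier M" "h (?k y) = y" if "y \<in> carrier N" for y
    using that h(2) by (auto simp: bij_betw_def inv_into_into f_inv_into_f)
  have i: "inj_on h (carrier M)" using h(2) by (simp add: bij_betw_def)
  have kk: "?k (h x) = x" if "x \<in> carrier M" for x using that i by simp
  note hc = lmod_hom_closed[OF h(1)] and ha = lmod_hom_add[OF h(1)] and hs = lmod_hom_smult[OF h(1)]
  show ?thesis
  proof (rule lmod_homI)
    fix x y assume "x \<in> carrier N" "y \<in> carrier N"
    then show "?k (x \<oplus>\<^bsub>N\<^esub> y) = ?k x \<oplus>\<^bsub>M\<^esub> ?k y"
      using kk[of "?k x \<oplus>\<^bsub>M\<^esub> ?k y"] ha[of "?k x" "?k y"] k by simp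
  next
    fix a x assume "a \<in> carrier R" "x \<in> carrier N"
    then show "?k (a \<odot>\<^bsub>N\<^esub> x) = a \<odot>\<^bsub>M\<^esub> ?k x"
      using kk[of "a \<odot>\<^bsub>M\<^esub> ?k x"] hs[of a "?k x"] k by simp
  qed (use k in auto)
qed

lemma lmod_iso_sym:
  assumes "left_module R M" "lmod_iso R M N" shows "lmod_iso R N M"
  using assms inv_into_lmod_hom bij_betw_inv_into unfolding lmod_iso_def by blast

lemma lmod_iso_trans:
  assumes "lmod_iso R M N" "lmod_iso R N P" shows "lmod_iso R M P"
proof -
  obtain f g where fg: "f \<in> lmod_hom R M N" "bij_betw f (carrier M) (carrier N)"
    "g \<in> lmod_hom R N P" "bij_betw g (carrier N) (carrier P)"
    using assms by (auto simp: lmod_iso_def)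
  have "(\<lambda>x. g (f x)) \<in> lmod_hom R M P" by (rule lmod_hom_comp[OF fg(1,3)])
  moreover have "bij_betw (\<lambda>x. g (f x)) (carrier M) (carrier P)"
    using bij_betw_trans[OF fg(2,4)] by (simp add: comp_def)
  ultimately show ?thesis unfolding lmod_iso_def by blast
qed

lemma lmod_iso_card: "lmod_iso R M N \<Longrightarrow> |carrier M| =o |carrier N|"
  by (auto simp: lmod_iso_def card_of_ordIso[symmetric])

lemma lmod_iso_image:
  assumes "h \<in> lmod_hom R M N" "inj_on h (carrier M)"
  shows "lmod_iso R M (N\<lparr>carrier := h ` carrier M\<rparr>)"
  using assms unfolding lmod_iso_def
  by (intro bexI[of _ h]) (auto simp: lmod_hom_def bij_betw_def)

text \<open>Through such copies, a hypothesis on the modules with elements in one type applies to modules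
  with elements in other types.\<close>

lemma lmod_iso_copy:
  fixes M :: "('r, 'm) module"
  assumes "left_module R M" "|carrier M| \<le>o |UNIV :: 'n set|"
  obtains N :: "('r, 'n) module" where "left_module R N" "lmod_iso R M N"
proof -
  interpret left_module R M by fact
  obtain f :: "'m \<Rightarrow> 'n" where f: "inj_on f (carrier M)"
    using assms(2) by (auto simp: card_of_ordLeq[symmetric])
  define g where "g = inv_into (carrier M) f"
  have g [simp]: "g (f x) = x" if "x \<in> carrier M" for x using f that by (simp add: g_def)
  define N :: "('r, 'n) module" where
    "N = \<lparr>carrier = f ` carrier M, mult = undefined, one = undefined, zero = f \<zero>\<^bsub>M\<^esub>,
      add = (\<lambda>x y. f (g x \<oplus>\<^bsub>M\<^esub> g y)), smult = (\<lambda>a x. f (a \<odot>\<^bsub>M\<^esub> g x))\<rparr>"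
  have "left_module R N"
    by (rule left_moduleI_smult_zero[OF R.ring_axioms])
      (auto simp: N_def M.a_ac smult_l_distr smult_r_distr smult_assoc1)
  moreover have "lmod_iso R M N"
    unfolding lmod_iso_def
    by (intro bexI[of _ f] lmod_homI) (use f in \<open>auto simp: N_def bij_betw_def\<close>)
  ultimately show ?thesis using that by blast
qed

section \<open>Baer's criterion\<close>

lemma left_ideal_iff:
  assumes "ring R"
  shows "left_ideal I R \<longleftrightarrow> I \<subseteq> carrier R \<and> \<zero>\<^bsub>R\<^esub> \<in> I \<and> (\<forall>x\<in>I. \<forall>y\<in>I. x \<oplus>\<^bsub>R\<^esub> y \<in> I) \<and>
    (\<forall>a\<in>carrier R. \<forall>x\<in>I. a \<otimes>\<^bsub>R\<^esub> x \<in> I)" (is "_ \<longleftrightarrow> ?rhs")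
proof
  assume "left_ideal I R"
  then interpret left_ideal I R .
  show ?rhs using a_subset l_closed by auto
next
  assume r: ?rhs
  interpret R: ring R by fact
  show "left_ideal I R"
  proof (intro left_ideal.intro left_ideal_axioms.intro additive_subgroup.intro subgroup.intro assms)
    fix x assume x: "x \<in> I"
    have "(\<ominus>\<^bsub>R\<^esub> \<one>\<^bsub>R\<^esub>) \<otimes>\<^bsub>R\<^esub> x \<in> I" using r x by auto
    moreover have "(\<ominus>\<^bsub>R\<^esub> \<one>\<^bsub>R\<^esub>) \<otimes>\<^bsub>R\<^esub> x = \<ominus>\<^bsub>R\<^esub> x" using r x R.l_minus[of "\<one>\<^bsub>R\<^esub>" x] by auto
    ultimately show "inv\<^bsub>add_monoid R\<^esub> x \<in> I" by (simp add: a_inv_def)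
  qed (use r in auto)
qed

definition ideal_module :: "('r, 'x) ring_scheme \<Rightarrow> 'r set \<Rightarrow> ('r, 'r) module" where
  "ideal_module R I = \<lparr>carrier = I, mult = mult R, one = one R, zero = zero R, add = add R,
    smult = mult R\<rparr>"

lemma ideal_module_simps [simp]:
  "carrier (ideal_module R I) = I" "zero (ideal_module R I) = zero R"
  "add (ideal_module R I) = add R" "smult (ideal_module R I) = mult R"
  by (simp_all add: ideal_module_def)

lemma left_module_ideal_module:
  assumes "ring R" "left_ideal I R" shows "left_module R (ideal_module R I)"
proof -
  interpret R: ring R by fact
  show ?thesis
    using assms(2)[unfolded left_ideal_iff[OF assms(1)]]
    by (intro left_moduleI_smult_zero assms)
      (auto simp: subset_iff R.a_ac R.m_assoc R.l_distr R.r_distr)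
qed

lemma left_ideal_carrier: "ring R \<Longrightarrow> left_ideal (carrier R) R"
  using left_ideal_iff[of R "carrier R"] ring.ring_simprules by (auto simp: ring.ring_simprules)

text \<open>Injectivity quantifies over test modules on the type of the module. Baer's condition mentions
  only the left ideals of the ring, so it has the same meaning on every type, and the whole argument
  is carried out with it.\<close>

definition baer :: "('r, 'x) ring_scheme \<Rightarrow> ('r, 'm) module \<Rightarrow> bool" where
  "baer R M \<longleftrightarrow> left_module R M \<and>
    (\<forall>I f. left_ideal I R \<and> f \<in> lmod_hom R (ideal_module R I) M \<longrightarrow>
      (\<exists>y\<in>carrier M. \<forall>a\<in>I. f a = a \<odot>\<^bsub>M\<^esub> y))"

lemma baerD:
  assumes "baer R M" "left_ideal I R" "f \<in> lmod_hom R (ideal_module R I) M"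
  obtains y where "y \<in> carrier M" "\<And>a. a \<in> I \<Longrightarrow> f a = a \<odot>\<^bsub>M\<^esub> y"
  using assms unfolding baer_def by blast

lemma baer_left_module: "baer R M \<Longrightarrow> left_module R M"
  by (simp add: baer_def)

text \<open>Zorn's lemma enters the theory of injective modules in this form: for graphs of partial
  homomorphisms, which avoid \<open>0 \<times> M\<close>, and for relative complements of submodules.\<close>

lemma (in left_module) submodule_maximal_avoiding:
  assumes T: "submodule T R M" and W: "T \<inter> W \<subseteq> {\<zero>\<^bsub>M\<^esub>}"
  obtains G where "submodule G R M" "T \<subseteq> G" "G \<inter> W \<subseteq> {\<zero>\<^bsub>M\<^esub>}"
    "\<And>G'. submodule G' R M \<Longrightarrow> G \<subseteq> G' \<Longrightarrow> G' \<inter> W \<subseteq> {\<zero>\<^bsub>M\<^esub>} \<Longrightarrow> G' = G"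
proof -
  let ?A = "{G. submodule G R M \<and> T \<subseteq> G \<and> G \<inter> W \<subseteq> {\<zero>\<^bsub>M\<^esub>}}"
  have "\<exists>G\<in>?A. \<forall>X\<in>?A. G \<subseteq> X \<longrightarrow> X = G"
  proof (rule subset_Zorn_nonempty)
    show "?A \<noteq> {}" using T W by blast
    fix C assume C: "C \<noteq> {}" "subset.chain ?A C"
    then have CA: "C \<subseteq> ?A" and lin: "\<And>X Y. X \<in> C \<Longrightarrow> Y \<in> C \<Longrightarrow> X \<subseteq> Y \<or> Y \<subseteq> X"
      unfolding subset.chain_def by blast+
    have "submodule (\<Union>C) R M"
      unfolding submodule_iff
    proof (intro conjI ballI)
      show "\<Union>C \<subseteq> carrier M" using CA submodule_subset by blast
      show "\<zero>\<^bsub>M\<^esub> \<in> \<Union>C" using C(1) CA submodule_zero by blast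
    next
      fix x y assume "x \<in> \<Union>C" "y \<in> \<Union>C"
      then obtain X where "X \<in> C" "x \<in> X" "y \<in> X" using lin by blast
      then show "x \<oplus>\<^bsub>M\<^esub> y \<in> \<Union>C" using CA submodule_add by blast
    next
      fix a x assume "a \<in> carrier R" "x \<in> \<Union>C"
      then show "a \<odot>\<^bsub>M\<^esub> x \<in> \<Union>C" using CA submodule_smult by blast
    qed
    then show "\<Union>C \<in> ?A" using CA C(1) by blast
  qed
  then show ?thesis using that by auto
qed

definition prod_module :: "('r, 'm) module \<Rightarrow> ('r, 'n) module \<Rightarrow> ('r, 'm \<times> 'n) module" where
  "prod_module M N = \<lparr>carrier = carrier M \<times> carrier N, mult = undefined, one = undefined,
    zero = (\<zero>\<^bsub>M\<^esub>, \<zero>\<^bsub>N\<^esub>), add = (\<lambda>x y. (fst x \<oplus>\<^bsub>M\<^esub> fst y, snd x \<oplus>\<^bsub>N\<^esub> snd y)),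
    smult = (\<lambda>a x. (a \<odot>\<^bsub>M\<^esub> fst x, a \<odot>\<^bsub>N\<^esub> snd x))\<rparr>"

lemma prod_module_simps [simp]:
  "carrier (prod_module M N) = carrier M \<times> carrier N"
  "\<zero>\<^bsub>prod_module M N\<^esub> = (\<zero>\<^bsub>M\<^esub>, \<zero>\<^bsub>N\<^esub>)"
  "x \<oplus>\<^bsub>prod_module M N\<^esub> y = (fst x \<oplus>\<^bsub>M\<^esub> fst y, snd x \<oplus>\<^bsub>N\<^esub> snd y)"
  "a \<odot>\<^bsub>prod_module M N\<^esub> x = (a \<odot>\<^bsub>M\<^esub> fst x, a \<odot>\<^bsub>N\<^esub> snd x)"
  by (simp_all add: prod_module_def)

lemma left_module_prod_module:
  assumes "left_module R M" "left_module R N" shows "left_module R (prod_module M N)"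
proof -
  interpret M: left_module R M by fact
  interpret N: left_module R N by fact
  show ?thesis
    by (rule left_moduleI_smult_zero[OF M.R.ring_axioms])
      (auto simp: M.M.a_ac N.M.a_ac M.smult_l_distr N.smult_l_distr M.smult_r_distr N.smult_r_distr
        M.smult_assoc1 N.smult_assoc1)
qed

text \<open>A homomorphism defined on a submodule of \<open>B\<close> is represented by its graph, a submodule of
  \<open>B \<times> M\<close> that meets \<open>0 \<times> M\<close> trivially. By Zorn it is contained in a maximal such
  graph; if the domain of that graph missed some \<open>b\<close>, the homomorphism \<open>a \<mapsto> a b\<close> followed
  by the graph would be defined on the left ideal of all \<open>a\<close> with \<open>a b\<close> in the domain, and a
  solution \<open>y\<close> of the corresponding equations would be a possible value at \<open>b\<close>.\<close>

lemma baer_extend_graph: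
  assumes M: "baer R M" and B: "left_module R B"
    and T: "submodule T R (prod_module B M)" and T0: "\<And>m. (\<zero>\<^bsub>B\<^esub>, m) \<in> T \<Longrightarrow> m = \<zero>\<^bsub>M\<^esub>"
  obtains h where "h \<in> lmod_hom R B M" "\<And>b m. (b, m) \<in> T \<Longrightarrow> h b = m"
proof -
  interpret M: left_module R M using M by (rule baer_left_module)
  interpret B: left_module R B by fact
  interpret P: left_module R "prod_module B M"
    by (intro left_module_prod_module M.left_module_axioms B)
  let ?W = "{\<zero>\<^bsub>B\<^esub>} \<times> carrier M"
  have "T \<inter> ?W \<subseteq> {\<zero>\<^bsub>prod_module B M\<^esub>}" using T0 by auto
  then obtain G where G: "submodule G R (prod_module B M)" "T \<subseteq> G"
      "G \<inter> ?W \<subseteq> {\<zero>\<^bsub>prod_module B M\<^esub>}"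
    and max: "\<And>G'. submodule G' R (prod_module B M) \<Longrightarrow> G \<subseteq> G' \<Longrightarrow>
      G' \<inter> ?W \<subseteq> {\<zero>\<^bsub>prod_module B M\<^esub>} \<Longrightarrow> G' = G"
    using P.submodule_maximal_avoiding[OF T] by metis
  have Gc: "b \<in> carrier B" "m \<in> carrier M" if "(b, m) \<in> G" for b m
    using P.submodule_carrier[OF G(1)] that by auto
  have Ga: "(b \<oplus>\<^bsub>B\<^esub> b', m \<oplus>\<^bsub>M\<^esub> m') \<in> G" if "(b, m) \<in> G" "(b', m') \<in> G" for b m b' m'
    using P.submodule_add[OF G(1) that] by simp
  have Gs: "(a \<odot>\<^bsub>B\<^esub> b, a \<odot>\<^bsub>M\<^esub> m) \<in> G" if "a \<in> carrier R" "(b, m) \<in> G" for a b m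
    using P.submodule_smult[OF G(1) that] by simp
  have G0: "m = \<zero>\<^bsub>M\<^esub>" if "(\<zero>\<^bsub>B\<^esub>, m) \<in> G" for m using G(3) Gc[OF that] that by auto
  have Gz: "(\<zero>\<^bsub>B\<^esub>, \<zero>\<^bsub>M\<^esub>) \<in> G" using P.submodule_zero[OF G(1)] by simp
  have Gu: "m = m'" if "(b, m) \<in> G" "(b, m') \<in> G" for b m m'
  proof -
    have "(b \<oplus>\<^bsub>B\<^esub> (\<ominus>\<^bsub>R\<^esub> \<one>\<^bsub>R\<^esub>) \<odot>\<^bsub>B\<^esub> b, m \<oplus>\<^bsub>M\<^esub> (\<ominus>\<^bsub>R\<^esub> \<one>\<^bsub>R\<^esub>) \<odot>\<^bsub>M\<^esub> m') \<in> G"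
      by (rule Ga[OF that(1) Gs[OF _ that(2)]]) simp
    then have "m \<oplus>\<^bsub>M\<^esub> \<ominus>\<^bsub>M\<^esub> m' = \<zero>\<^bsub>M\<^esub>"
      using Gc[OF that(1)] Gc[OF that(2)] G0
      by (simp add: B.minus_one_smult M.minus_one_smult B.M.r_neg)
    then show ?thesis using Gc[OF that(1)] Gc[OF that(2)]
      by (metis M.M.add.inv_closed M.M.minus_equality M.M.minus_minus)
  qed
  have total: "\<exists>m. (b, m) \<in> G" if b: "b \<in> carrier B" for b
  proof -
    define I where "I = {a \<in> carrier R. \<exists>m. (a \<odot>\<^bsub>B\<^esub> b, m) \<in> G}"
    define f where "f a = (THE m. (a \<odot>\<^bsub>B\<^esub> b, m) \<in> G)" for a
    have f: "(a \<odot>\<^bsub>B\<^esub> b, f a) \<in> G" if "a \<in> I" for a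
      using that Gu unfolding I_def f_def by (auto intro: theI2)
    have fI: "a \<in> I" "f a = m" if "a \<in> carrier R" "(a \<odot>\<^bsub>B\<^esub> b, m) \<in> G" for a m
    proof -
      show "a \<in> I" using that by (auto simp: I_def)
      then show "f a = m" using f Gu that by blast
    qed
    have IR: "a \<in> carrier R" if "a \<in> I" for a using that by (simp add: I_def)
    have add: "a \<oplus>\<^bsub>R\<^esub> a' \<in> I" "f (a \<oplus>\<^bsub>R\<^esub> a') = f a \<oplus>\<^bsub>M\<^esub> f a'" if "a \<in> I" "a' \<in> I" for a a'
      using fI[of "a \<oplus>\<^bsub>R\<^esub> a'"] Ga[OF f[OF that(1)] f[OF that(2)]] that b IR
      by (simp_all add: B.smult_l_distr)
    have mult: "r \<otimes>\<^bsub>R\<^esub> a \<in> I" "f (r \<otimes>\<^bsub>R\<^esub> a) = r \<odot>\<^bsub>M\<^esub> f a" if "r \<in> carrier R" "a \<in> I" for r a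
      using fI[of "r \<otimes>\<^bsub>R\<^esub> a"] Gs[OF that(1) f[OF that(2)]] that b IR
      by (simp_all add: B.smult_assoc1)
    have "left_ideal I R"
      unfolding left_ideal_iff[OF M.R.ring_axioms]
      using IR add mult fI(1)[of "\<zero>\<^bsub>R\<^esub>"] Gz b by auto
    moreover have "f \<in> lmod_hom R (ideal_module R I) M"
      by (rule lmod_homI) (use Gc(2)[OF f] add mult in auto)
    ultimately obtain y where y: "y \<in> carrier M" "\<And>a. a \<in> I \<Longrightarrow> f a = a \<odot>\<^bsub>M\<^esub> y"
      using baerD[OF M] by blast
    let ?Y = "(\<lambda>a. a \<odot>\<^bsub>prod_module B M\<^esub> (b, y)) ` carrier R"
    have Y: "submodule ?Y R (prod_module B M)"
      by (rule P.submodule_cyclic) (use b y in auto)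
    let ?G' = "G <+>\<^bsub>prod_module B M\<^esub> ?Y"
    have "?G' = G"
    proof (rule max)
      show "submodule ?G' R (prod_module B M)" by (rule P.submodule_set_add[OF G(1) Y])
      show "G \<subseteq> ?G'" by (rule P.subset_set_add[OF G(1) Y])
      show "?G' \<inter> ?W \<subseteq> {\<zero>\<^bsub>prod_module B M\<^esub>}"
      proof
        fix w assume w: "w \<in> ?G' \<inter> ?W"
        then obtain d n a where *: "(d, n) \<in> G" "a \<in> carrier R"
          "w = (d \<oplus>\<^bsub>B\<^esub> a \<odot>\<^bsub>B\<^esub> b, n \<oplus>\<^bsub>M\<^esub> a \<odot>\<^bsub>M\<^esub> y)" "d \<oplus>\<^bsub>B\<^esub> a \<odot>\<^bsub>B\<^esub> b = \<zero>\<^bsub>B\<^esub>"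
          by (auto simp: set_add_def')
        have d: "a \<odot>\<^bsub>B\<^esub> b = \<ominus>\<^bsub>B\<^esub> d"
          using *(2,4) Gc[OF *(1)] b by (metis B.M.a_comm B.M.minus_equality B.smult_closed)
        have "(a \<odot>\<^bsub>B\<^esub> b, \<ominus>\<^bsub>M\<^esub> n) \<in> G"
          using Gs[OF _ *(1), of "\<ominus>\<^bsub>R\<^esub> \<one>\<^bsub>R\<^esub>"] Gc[OF *(1)]
          by (simp add: B.minus_one_smult M.minus_one_smult d)
        then have "a \<odot>\<^bsub>M\<^esub> y = \<ominus>\<^bsub>M\<^esub> n" using fI[OF *(2)] y(2) by simp
        then show "w \<in> {\<zero>\<^bsub>prod_module B M\<^esub>}"
          using * Gc[OF *(1)] by (simp add: M.M.r_neg)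
      qed
    qed
    moreover have "(b, y) \<in> ?Y"
      by (rule image_eqI[of _ _ "\<one>\<^bsub>R\<^esub>"]) (use b y in auto)
    ultimately have "(b, y) \<in> G" using P.subset_set_add(2)[OF G(1) Y] by blast
    then show ?thesis ..
  qed
  define h where "h b = (THE m. (b, m) \<in> G)" for b
  have h: "(b, h b) \<in> G" if "b \<in> carrier B" for b
    using total[OF that] Gu unfolding h_def by (auto intro: theI2)
  show ?thesis
  proof (rule that)
    show "h b = m" if "(b, m) \<in> T" for b m
      using that G(2) h Gu Gc by blast
    show "h \<in> lmod_hom R B M"
      using h Gu Gc Ga Gs by (intro lmod_homI) (blast, (metis B.M.add.m_closed), metis B.smult_closed)
  qed
qed

text \<open>The pairs \<open>(f x, g x)\<close> form a graph because \<open>f\<close> is injective.\<close>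

lemma baer_extend:
  assumes M: "baer R M" and A: "left_module R A" and B: "left_module R B"
    and f: "f \<in> lmod_hom R A B" "inj_on f (carrier A)" and g: "g \<in> lmod_hom R A M"
  obtains h where "h \<in> lmod_hom R B M" "\<And>x. x \<in> carrier A \<Longrightarrow> h (f x) = g x"
proof -
  interpret M: left_module R M using M by (rule baer_left_module)
  interpret B: left_module R B by fact
  interpret A: left_module R A by fact
  interpret P: left_module R "prod_module B M"
    by (intro left_module_prod_module M.left_module_axioms B)
  interpret f: lmodule_hom R A B f by (rule lmodule_homI[OF A B f(1)])
  interpret g: lmodule_hom R A M g by (rule lmodule_homI[OF A M.left_module_axioms g])
  have "(\<lambda>x. (f x, g x)) \<in> lmod_hom R A (prod_module B M)"
    by (rule lmod_homI) (auto simp: f.closed g.closed f.add g.add f.smult g.smult)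
  then interpret fg: lmodule_hom R A "prod_module B M" "\<lambda>x. (f x, g x)"
    by (intro lmodule_homI A P.left_module_axioms)
  have "submodule ((\<lambda>x. (f x, g x)) ` carrier A) R (prod_module B M)"
    by (rule fg.submodule_image) simp
  moreover have "m = \<zero>\<^bsub>M\<^esub>" if "(\<zero>\<^bsub>B\<^esub>, m) \<in> (\<lambda>x. (f x, g x)) ` carrier A" for m
    using that f(2) unfolding f.inj_iff by (auto simp: g.zero)
  ultimately obtain h where h: "h \<in> lmod_hom R B M"
      "\<And>b m. (b, m) \<in> (\<lambda>x. (f x, g x)) ` carrier A \<Longrightarrow> h b = m"
    using baer_extend_graph[OF M B] by blast
  then show ?thesis using that by auto
qed

lemma baer_iso:
  assumes "baer R M" "left_module R N" "lmod_iso R M N"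
  shows "baer R N"
proof -
  interpret M: left_module R M using assms(1) by (rule baer_left_module)
  obtain h where h: "h \<in> lmod_hom R M N" "bij_betw h (carrier M) (carrier N)"
    using assms(3) by (rule lmod_isoE)
  let ?k = "inv_into (carrier M) h"
  have k: "?k \<in> lmod_hom R N M" by (rule inv_into_lmod_hom[OF M.left_module_axioms h])
  have hk: "h (?k y) = y" if "y \<in> carrier N" for y
    using that h(2) by (auto simp: bij_betw_def f_inv_into_f)
  show ?thesis
    unfolding baer_def
  proof (intro conjI assms(2) allI impI; elim conjE)
    fix I f assume I: "left_ideal I R" and f: "f \<in> lmod_hom R (ideal_module R I) N"
    obtain y where y: "y \<in> carrier M" "\<And>a. a \<in> I \<Longrightarrow> ?k (f a) = a \<odot>\<^bsub>M\<^esub> y"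
      using baerD[OF assms(1) I lmod_hom_comp[OF f k]] by blast
    have IR: "a \<in> carrier R" if "a \<in> I" for a
      using I that left_ideal_iff[OF M.R.ring_axioms] by auto
    show "\<exists>y\<in>carrier N. \<forall>a\<in>I. f a = a \<odot>\<^bsub>N\<^esub> y"
    proof (intro bexI ballI)
      show "h y \<in> carrier N" using lmod_hom_closed[OF h(1) y(1)] .
      show "f a = a \<odot>\<^bsub>N\<^esub> h y" if "a \<in> I" for a
        using y IR[OF that] that lmod_hom_smult[OF h(1) _ y(1)] hk lmod_hom_closed[OF f]
        by (metis ideal_module_simps(1))
    qed
  qed
qed

text \<open>One direction is \<open>baer_extend\<close>. Conversely, copies of the ring and of a left
  ideal are among the test modules if the type is large enough, and the value at \<open>1\<close> of an extension to the ring solves the equations.\<close>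

lemma injective_module_iff_baer:
  fixes M :: "('r, 'm) module" and R :: "('r, 'x) ring_scheme"
  assumes R: "ring R" "|carrier R| \<le>o |UNIV :: 'm set|"
  shows "injective_module R M \<longleftrightarrow> baer R M"
proof
  assume "baer R M"
  then show "injective_module R M"
    unfolding injective_module_def
    using baer_left_module by (intro conjI allI impI ballI) (auto, metis baer_extend)
next
  assume inj: "injective_module R M"
  then interpret M: left_module R M by (simp add: injective_module_def)
  interpret R: ring R by fact
  show "baer R M"
    unfolding baer_def
  proof (intro conjI allI impI; (elim conjE)?)
    show "left_module R M" ..
    fix I f assume I: "left_ideal I R" and f: "f \<in> lmod_hom R (ideal_module R I) M"
    have IR: "a \<in> carrier R" if "a \<in> I" for a
      using I that left_ideal_iff[OF M.R.ring_axioms] by auto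
    have lI: "left_module R (ideal_module R I)" by (rule left_module_ideal_module[OF R(1) I])
    have lR: "left_module R (ideal_module R (carrier R))"
      by (intro left_module_ideal_module left_ideal_carrier R)
    obtain A :: "('r, 'm) module" where A: "left_module R A" "lmod_iso R (ideal_module R I) A"
    proof (rule lmod_iso_copy[OF lI, where ?'n = 'm])
      show "|carrier (ideal_module R I)| \<le>o |UNIV :: 'm set|"
        using ordLeq_transitive[OF card_of_mono1[of I "carrier R"] R(2)] IR by auto
    qed
    obtain B :: "('r, 'm) module" where
      B: "left_module R B" "lmod_iso R (ideal_module R (carrier R)) B"
      using R(2) by (auto intro: lmod_iso_copy[OF lR, where ?'n = 'm])
    obtain u where u: "u \<in> lmod_hom R (ideal_module R I) A" "bij_betw u I (carrier A)"
      using A(2) by (auto elim: lmod_isoE)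
    obtain v where v: "v \<in> lmod_hom R (ideal_module R (carrier R)) B"
      "bij_betw v (carrier R) (carrier B)" using B(2) by (auto elim: lmod_isoE)
    let ?k = "inv_into I u"
    have k: "?k \<in> lmod_hom R A (ideal_module R I)"
      using inv_into_lmod_hom[OF lI u(1)] u(2) by simp
    have ku: "?k (u a) = a" if "a \<in> I" for a
      using u(2) that by (simp add: bij_betw_def)
    have "v \<in> lmod_hom R (ideal_module R I) B"
      using v(1) IR by (auto simp: lmod_hom_def)
    then have vk: "(\<lambda>x. v (?k x)) \<in> lmod_hom R A B" by (rule lmod_hom_comp[OF k])
    have i: "inj_on (\<lambda>x. v (?k x)) (carrier A)"
    proof (rule inj_onI)
      fix x y assume xy: "x \<in> carrier A" "y \<in> carrier A" "v (?k x) = v (?k y)"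
      then have "?k x = ?k y"
        using v(2) lmod_hom_closed[OF k] IR by (auto simp: bij_betw_def dest: inj_onD)
      then show "x = y"
        using u(2) xy by (metis bij_betw_def f_inv_into_f)
    qed
    have "(\<lambda>x. f (?k x)) \<in> lmod_hom R A M" by (rule lmod_hom_comp[OF k f])
    then obtain h where h: "h \<in> lmod_hom R B M"
        "\<And>x. x \<in> carrier A \<Longrightarrow> h (v (?k x)) = f (?k x)"
      using inj[unfolded injective_module_def, THEN conjunct2, rule_format, OF A(1) B(1) vk i] by blast
    let ?y = "h (v \<one>\<^bsub>R\<^esub>)"
    have v1: "v \<one>\<^bsub>R\<^esub> \<in> carrier B" using lmod_hom_closed[OF v(1)] by simp
    show "\<exists>y\<in>carrier M. \<forall>a\<in>I. f a = a \<odot>\<^bsub>M\<^esub> y"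
    proof (intro bexI ballI)
      show "?y \<in> carrier M" using lmod_hom_closed[OF h(1) v1] .
      fix a assume a: "a \<in> I"
      have "f a = h (v a)" using h(2)[of "u a"] ku[OF a] lmod_hom_closed[OF u(1)] a by simp
      also have "v a = a \<odot>\<^bsub>B\<^esub> v \<one>\<^bsub>R\<^esub>"
        using lmod_hom_smult[OF v(1), of a "\<one>\<^bsub>R\<^esub>"] IR[OF a] by simp
      also have "h \<dots> = a \<odot>\<^bsub>M\<^esub> ?y" using lmod_hom_smult[OF h(1) IR[OF a] v1] .
      finally show "f a = a \<odot>\<^bsub>M\<^esub> ?y" .
    qed
  qed
qed

section \<open>Direct summands and injective hulls\<close>

lemma baer_prod:
  assumes "baer R M" "baer R N" shows "baer R (prod_module M N)"
  unfolding baer_def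
proof (intro conjI allI impI; (elim conjE)?)
  show "left_module R (prod_module M N)"
    by (intro left_module_prod_module assms baer_left_module)
  fix I f assume I: "left_ideal I R" and f: "f \<in> lmod_hom R (ideal_module R I) (prod_module M N)"
  have "(\<lambda>a. fst (f a)) \<in> lmod_hom R (ideal_module R I) M"
    "(\<lambda>a. snd (f a)) \<in> lmod_hom R (ideal_module R I) N"
    using f by (auto simp: lmod_hom_def Pi_iff)
  with I obtain y z where "y \<in> carrier M" "\<And>a. a \<in> I \<Longrightarrow> fst (f a) = a \<odot>\<^bsub>M\<^esub> y"
    "z \<in> carrier N" "\<And>a. a \<in> I \<Longrightarrow> snd (f a) = a \<odot>\<^bsub>N\<^esub> z"
    using baerD[OF assms(1)] baerD[OF assms(2)] by metis
  then show "\<exists>y\<in>carrier (prod_module M N). \<forall>a\<in>I. f a = a \<odot>\<^bsub>prod_module M N\<^esub> y"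
    by (intro bexI[of _ "(y, z)"]) (auto simp: prod_eq_iff)
qed

locale lmodule = left_module R M for R (structure) and M :: "('r, 'm) module" (structure)

lemma lmoduleI: "left_module R M \<Longrightarrow> lmodule R M"
  by (simp add: lmodule_def)

context lmodule
begin

text \<open>Extend the identity of the submodule to the whole module.\<close>

lemma baer_submodule_retraction:
  assumes "submodule N R M" "baer R (M\<lparr>carrier := N\<rparr>)"
  obtains g where "g \<in> lmod_hom R M (M\<lparr>carrier := N\<rparr>)" "\<And>x. x \<in> N \<Longrightarrow> g x = x"
proof -
  have lN: "left_module R (M\<lparr>carrier := N\<rparr>)" by (rule submodule_left_module[OF assms(1)])
  have "(\<lambda>x. x) \<in> lmod_hom R (M\<lparr>carrier := N\<rparr>) M"
    using submodule_carrier[OF assms(1)] by (auto intro: lmod_homI)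
  moreover have "inj_on (\<lambda>x. x) (carrier (M\<lparr>carrier := N\<rparr>))" by simp
  moreover have "(\<lambda>x. x) \<in> lmod_hom R (M\<lparr>carrier := N\<rparr>) (M\<lparr>carrier := N\<rparr>)"
    by (auto intro: lmod_homI)
  ultimately obtain g where "g \<in> lmod_hom R M (M\<lparr>carrier := N\<rparr>)"
    "\<And>x. x \<in> carrier (M\<lparr>carrier := N\<rparr>) \<Longrightarrow> g x = x"
    using baer_extend[OF assms(2) lN left_module_axioms, of "\<lambda>x. x" "\<lambda>x. x"] by blast
  then show ?thesis using that by simp
qed

lemma retraction_complement:
  assumes N: "submodule N R M" and g: "g \<in> lmod_hom R M (M\<lparr>carrier := N\<rparr>)" "\<And>x. x \<in> N \<Longrightarrow> g x = x"
  defines "K \<equiv> {x \<in> carrier M. g x = \<zero>\<^bsub>M\<^esub>}"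
  shows "submodule K R M" "N \<inter> K = {\<zero>\<^bsub>M\<^esub>}" "N <+>\<^bsub>M\<^esub> K = carrier M"
proof -
  interpret g: lmodule_hom R M "M\<lparr>carrier := N\<rparr>" g
    by (intro lmodule_homI left_module_axioms submodule_left_module N g(1))
  have gN: "g x \<in> N" if "x \<in> carrier M" for x using g.closed[OF that] by simp
  note Nc = submodule_carrier[OF N]
  show K: "submodule K R M" using g.submodule_kernel by (simp add: K_def)
  show "N \<inter> K = {\<zero>\<^bsub>M\<^esub>}"
    using g(2) submodule_zero[OF N] submodule_zero[OF K] by (auto simp: K_def)
  show "N <+>\<^bsub>M\<^esub> K = carrier M"
  proof
    show "N <+>\<^bsub>M\<^esub> K \<subseteq> carrier M" by (rule submodule_subset[OF submodule_set_add[OF N K]])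
    show "carrier M \<subseteq> N <+>\<^bsub>M\<^esub> K"
    proof
      fix x assume x: "x \<in> carrier M"
      let ?k = "x \<oplus>\<^bsub>M\<^esub> \<ominus>\<^bsub>M\<^esub> g x"
      have gx: "g x \<in> carrier M" using gN[OF x] Nc by blast
      have "g ?k = g x \<oplus>\<^bsub>M\<^esub> g (\<ominus>\<^bsub>M\<^esub> g x)" using g.add[OF x, of "\<ominus>\<^bsub>M\<^esub> g x"] gx by simp
      also have "g (\<ominus>\<^bsub>M\<^esub> g x) = \<ominus>\<^bsub>M\<^esub> g x"
        by (rule g(2)) (rule submodule_neg[OF N gN[OF x]])
      finally have "?k \<in> K" using gx x by (simp add: K_def M.r_neg)
      moreover have "x = g x \<oplus>\<^bsub>M\<^esub> ?k" using x gx by (simp add: M.a_ac M.r_neg2 M.r_neg)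
      ultimately show "x \<in> N <+>\<^bsub>M\<^esub> K" using gN[OF x] unfolding set_add_def' by blast
    qed
  qed
qed

text \<open>Project a solution in the whole module.\<close>

lemma baer_retract:
  assumes M: "baer R M" and N: "submodule N R M"
    and g: "g \<in> lmod_hom R M (M\<lparr>carrier := N\<rparr>)" "\<And>x. x \<in> N \<Longrightarrow> g x = x"
  shows "baer R (M\<lparr>carrier := N\<rparr>)"
  unfolding baer_def
proof (intro conjI allI impI; (elim conjE)?)
  show "left_module R (M\<lparr>carrier := N\<rparr>)" by (rule submodule_left_module[OF N])
  fix I f assume I: "left_ideal I R" and f: "f \<in> lmod_hom R (ideal_module R I) (M\<lparr>carrier := N\<rparr>)"
  have IR: "a \<in> carrier R" if "a \<in> I" for a
    using I that left_ideal_iff[OF R.ring_axioms] by auto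
  have fN: "f a \<in> N" if "a \<in> I" for a using lmod_hom_closed[OF f] that by simp
  have "f \<in> lmod_hom R (ideal_module R I) M"
    using f submodule_carrier[OF N] by (auto simp: lmod_hom_def)
  then obtain y where y: "y \<in> carrier M" "\<And>a. a \<in> I \<Longrightarrow> f a = a \<odot>\<^bsub>M\<^esub> y"
    using baerD[OF M I] by blast
  have "f a = a \<odot>\<^bsub>M\<^esub> g y" if "a \<in> I" for a
    using g(2)[OF fN[OF that]] y that lmod_hom_smult[OF g(1) IR[OF that] y(1)] by simp
  then show "\<exists>y\<in>carrier (M\<lparr>carrier := N\<rparr>). \<forall>a\<in>I. f a = a \<odot>\<^bsub>M\<lparr>carrier := N\<rparr>\<^esub> y"
    using lmod_hom_closed[OF g(1) y(1)] by (intro bexI[of _ "g y"]) auto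
qed

text \<open>Every submodule \<open>T\<close> of an injective module has an injective hull \<open>B\<close> inside that module. By
  Zorn, let \<open>K\<close> be maximal among the submodules avoiding \<open>T\<close>, and \<open>B\<close> maximal among those containing
  \<open>T\<close> and avoiding \<open>K\<close>. The projection \<open>b + k \<mapsto> b\<close> extends to an endomorphism \<open>g\<close> of the module,
  whose image is \<open>B\<close> by maximality.\<close>

lemma baer_hull:
  assumes M: "baer R M" and T: "submodule T R M"
  obtains B where "submodule B R M" "T \<subseteq> B" "baer R (M\<lparr>carrier := B\<rparr>)"
    "\<And>Y. submodule Y R M \<Longrightarrow> Y \<subseteq> B \<Longrightarrow> Y \<inter> T \<subseteq> {\<zero>\<^bsub>M\<^esub>} \<Longrightarrow> Y = {\<zero>\<^bsub>M\<^esub>}"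
proof -
  note Tc = submodule_carrier[OF T]
  obtain K where K: "submodule K R M" "K \<inter> T \<subseteq> {\<zero>\<^bsub>M\<^esub>}"
    and Kmax: "\<And>G. submodule G R M \<Longrightarrow> K \<subseteq> G \<Longrightarrow> G \<inter> T \<subseteq> {\<zero>\<^bsub>M\<^esub>} \<Longrightarrow> G = K"
    using submodule_maximal_avoiding[OF submodule_zero_set, of T] by (metis Int_lower1)
  obtain B where B: "submodule B R M" "T \<subseteq> B" "B \<inter> K \<subseteq> {\<zero>\<^bsub>M\<^esub>}"
    and Bmax: "\<And>G. submodule G R M \<Longrightarrow> B \<subseteq> G \<Longrightarrow> G \<inter> K \<subseteq> {\<zero>\<^bsub>M\<^esub>} \<Longrightarrow> G = B"
    using submodule_maximal_avoiding[OF T, of K] K(2) by (metis Int_commute)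
  note Kc = submodule_carrier[OF K(1)] and Bc = submodule_carrier[OF B(1)]
  note K0 = submodule_zero[OF K(1)] and B0 = submodule_zero[OF B(1)]
  interpret P: left_module R "prod_module M M"
    by (intro left_module_prod_module left_module_axioms)
  let ?S = "{(b \<oplus>\<^bsub>M\<^esub> k, b) | b k. b \<in> B \<and> k \<in> K}"
  have "submodule ?S R (prod_module M M)"
    unfolding P.submodule_iff
  proof (intro conjI ballI)
    show "?S \<subseteq> carrier (prod_module M M)" using Bc Kc by auto
    show "\<zero>\<^bsub>prod_module M M\<^esub> \<in> ?S" using B0 K0 by force
  next
    fix u v assume "u \<in> ?S" "v \<in> ?S"
    then obtain b k b' k' where *: "b \<in> B" "k \<in> K" "b' \<in> B" "k' \<in> K"
      "u = (b \<oplus>\<^bsub>M\<^esub> k, b)" "v = (b' \<oplus>\<^bsub>M\<^esub> k', b')" by blast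
    have "u \<oplus>\<^bsub>prod_module M M\<^esub> v = ((b \<oplus>\<^bsub>M\<^esub> b') \<oplus>\<^bsub>M\<^esub> (k \<oplus>\<^bsub>M\<^esub> k'), b \<oplus>\<^bsub>M\<^esub> b')"
      using * Bc Kc by (simp add: M.a_ac)
    then show "u \<oplus>\<^bsub>prod_module M M\<^esub> v \<in> ?S"
      using * submodule_add[OF B(1)] submodule_add[OF K(1)] by blast
  next
    fix a u assume a: "a \<in> carrier R" and "u \<in> ?S"
    then obtain b k where *: "b \<in> B" "k \<in> K" "u = (b \<oplus>\<^bsub>M\<^esub> k, b)" by blast
    have "a \<odot>\<^bsub>prod_module M M\<^esub> u = (a \<odot>\<^bsub>M\<^esub> b \<oplus>\<^bsub>M\<^esub> a \<odot>\<^bsub>M\<^esub> k, a \<odot>\<^bsub>M\<^esub> b)"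
      using * Bc Kc a by (simp add: smult_r_distr)
    then show "a \<odot>\<^bsub>prod_module M M\<^esub> u \<in> ?S"
      using * submodule_smult[OF B(1) a] submodule_smult[OF K(1) a] by blast
  qed
  moreover have "b = \<zero>\<^bsub>M\<^esub>" if "(\<zero>\<^bsub>M\<^esub>, b) \<in> ?S" for b
    using that independent_sum_eq[OF B(1) K(1) B(3) _ B0 _ K0] by auto
  ultimately obtain g where g: "g \<in> lmod_hom R M M" "\<And>x b. (x, b) \<in> ?S \<Longrightarrow> g x = b"
    using baer_extend_graph[OF M left_module_axioms] by blast
  interpret g: lmodule_hom R M M g by (intro lmodule_homI left_module_axioms g)
  have gK: "g k = \<zero>\<^bsub>M\<^esub>" if "k \<in> K" for k
    using g(2)[of k "\<zero>\<^bsub>M\<^esub>"] Kc[OF that] that B0 by force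
  have gB: "g b = b" if "b \<in> B" for b
    using g(2)[of b b] Bc[OF that] that K0 by force
  \<comment> \<open>This preimage avoids \<open>T\<close> since \<open>g\<close> fixes \<open>T\<close>, so it cannot exceed \<open>K\<close>.\<close>
  have pre: "{x \<in> carrier M. g x \<in> K} = K"
  proof (rule Kmax)
    show "submodule {x \<in> carrier M. g x \<in> K} R M" by (rule g.submodule_vimage[OF K(1)])
    show "K \<subseteq> {x \<in> carrier M. g x \<in> K}" using Kc gK K0 by auto
    show "{x \<in> carrier M. g x \<in> K} \<inter> T \<subseteq> {\<zero>\<^bsub>M\<^esub>}"
    proof
      fix x assume x: "x \<in> {x \<in> carrier M. g x \<in> K} \<inter> T"
      then have "g x = x" using B(2) gB by blast
      then show "x \<in> {\<zero>\<^bsub>M\<^esub>}" using x K(2) by auto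
    qed
  qed
  have im: "g ` carrier M = B"
  proof (rule Bmax)
    show "submodule (g ` carrier M) R M" by (rule g.submodule_image) simp
    show "B \<subseteq> g ` carrier M" using gB Bc by force
    show "g ` carrier M \<inter> K \<subseteq> {\<zero>\<^bsub>M\<^esub>}" using pre gK by blast
  qed
  have "g \<in> lmod_hom R M (M\<lparr>carrier := B\<rparr>)"
    by (rule lmod_homI) (use im g.add g.smult in auto)
  then have Bb: "baer R (M\<lparr>carrier := B\<rparr>)" by (rule baer_retract[OF M B(1) _ gB])
  \<comment> \<open>If \<open>Y\<close> avoids \<open>T\<close>, then so does \<open>K + Y\<close>, which contradicts the maximality of \<open>K\<close> unless \<open>Y = 0\<close>.\<close>
  have "Y = {\<zero>\<^bsub>M\<^esub>}" if Y: "submodule Y R M" "Y \<subseteq> B" "Y \<inter> T \<subseteq> {\<zero>\<^bsub>M\<^esub>}" for Y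
  proof -
    have "K <+>\<^bsub>M\<^esub> Y = K"
    proof (rule Kmax)
      show "submodule (K <+>\<^bsub>M\<^esub> Y) R M" by (rule submodule_set_add[OF K(1) Y(1)])
      show "K \<subseteq> K <+>\<^bsub>M\<^esub> Y" by (rule subset_set_add[OF K(1) Y(1)])
      show "(K <+>\<^bsub>M\<^esub> Y) \<inter> T \<subseteq> {\<zero>\<^bsub>M\<^esub>}"
      proof
        fix t assume "t \<in> (K <+>\<^bsub>M\<^esub> Y) \<inter> T"
        then obtain k y where *: "k \<in> K" "y \<in> Y" "t = k \<oplus>\<^bsub>M\<^esub> y" "t \<in> T"
          unfolding set_add_def' by blast
        have "t \<oplus>\<^bsub>M\<^esub> \<zero>\<^bsub>M\<^esub> = y \<oplus>\<^bsub>M\<^esub> k"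
          using * Kc Bc Y(2) Tc by (auto simp: M.a_comm)
        then have "t = y" using independent_sum_eq[OF B(1) K(1) B(3) _ _ K0] * B(2) Y(2) by blast
        then show "t \<in> {\<zero>\<^bsub>M\<^esub>}" using * Y(3) by blast
      qed
    qed
    then have "Y \<subseteq> K" using subset_set_add[OF K(1) Y(1)] by simp
    then show ?thesis using Y(2) B(3) submodule_zero[OF Y(1)] by auto
  qed
  then show ?thesis using that B Bb by blast
qed

definition uniform_submodule :: "'m set \<Rightarrow> bool" where
  "uniform_submodule T \<longleftrightarrow> submodule T R M \<and> T \<noteq> {\<zero>\<^bsub>M\<^esub>} \<and>
    (\<forall>A B. submodule A R M \<and> submodule B R M \<and> A \<subseteq> T \<and> B \<subseteq> T \<and> A \<inter> B \<subseteq> {\<zero>\<^bsub>M\<^esub>} \<longrightarrow>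
      A = {\<zero>\<^bsub>M\<^esub>} \<or> B = {\<zero>\<^bsub>M\<^esub>})"

text \<open>An injective submodule splits off.\<close>

lemma indecomposable_baer_submodule_eq:
  assumes "indecomposable_module R M" "submodule N R M" "baer R (M\<lparr>carrier := N\<rparr>)"
    "N \<noteq> {\<zero>\<^bsub>M\<^esub>}"
  shows "N = carrier M"
proof -
  obtain g where g: "g \<in> lmod_hom R M (M\<lparr>carrier := N\<rparr>)" "\<And>x. x \<in> N \<Longrightarrow> g x = x"
    using baer_submodule_retraction[OF assms(2,3)] by blast
  note c = retraction_complement[OF assms(2) g]
  have K0: "{x \<in> carrier M. g x = \<zero>\<^bsub>M\<^esub>} = {\<zero>\<^bsub>M\<^esub>}"
    using assms(1,2,4) c unfolding indecomposable_module_def by blast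
  show ?thesis
    using c(3) submodule_carrier[OF assms(2)] unfolding K0 set_add_def' by force
qed

text \<open>An injective hull of a nonzero submodule splits off, so it is the whole module; hence every
  nonzero submodule is essential.\<close>

lemma indecomposable_baer_uniform:
  assumes "baer R M" "indecomposable_module R M"
  shows "uniform_submodule (carrier M)"
  unfolding uniform_submodule_def
proof (intro conjI allI impI; (elim conjE)?)
  show "carrier M \<noteq> {\<zero>\<^bsub>M\<^esub>}" using assms(2) by (simp add: indecomposable_module_def)
  fix A A' assume A: "submodule A R M" "submodule A' R M" "A \<inter> A' \<subseteq> {\<zero>\<^bsub>M\<^esub>}"
  show "A = {\<zero>\<^bsub>M\<^esub>} \<or> A' = {\<zero>\<^bsub>M\<^esub>}"
  proof (rule disjCI)
    assume A': "A' \<noteq> {\<zero>\<^bsub>M\<^esub>}"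
    obtain B where B: "submodule B R M" "A' \<subseteq> B" "baer R (M\<lparr>carrier := B\<rparr>)"
      and ess: "\<And>Y. submodule Y R M \<Longrightarrow> Y \<subseteq> B \<Longrightarrow> Y \<inter> A' \<subseteq> {\<zero>\<^bsub>M\<^esub>} \<Longrightarrow> Y = {\<zero>\<^bsub>M\<^esub>}"
      using baer_hull[OF assms(1) A(2)] by metis
    have "B \<noteq> {\<zero>\<^bsub>M\<^esub>}" using B(2) A' submodule_zero[OF A(2)] by blast
    then have "B = carrier M" by (rule indecomposable_baer_submodule_eq[OF assms(2) B(1,3)])
    then show "A = {\<zero>\<^bsub>M\<^esub>}" using ess A submodule_subset by blast
  qed
qed simp

text \<open>Two nonzero summands of the injective hull of \<open>T\<close> would meet \<open>T\<close> in nonzero submodules that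
  avoid each other.\<close>

lemma uniform_hull_indecomposable:
  assumes "baer R M" "uniform_submodule T"
  obtains B where "submodule B R M" "T \<subseteq> B" "baer R (M\<lparr>carrier := B\<rparr>)"
    "indecomposable_module R (M\<lparr>carrier := B\<rparr>)"
    "\<And>Y. submodule Y R M \<Longrightarrow> Y \<subseteq> B \<Longrightarrow> Y \<inter> T \<subseteq> {\<zero>\<^bsub>M\<^esub>} \<Longrightarrow> Y = {\<zero>\<^bsub>M\<^esub>}"
proof -
  have T: "submodule T R M" "T \<noteq> {\<zero>\<^bsub>M\<^esub>}"
    and Tu: "\<And>A B. submodule A R M \<Longrightarrow> submodule B R M \<Longrightarrow> A \<subseteq> T \<Longrightarrow> B \<subseteq> T \<Longrightarrow>
      A \<inter> B \<subseteq> {\<zero>\<^bsub>M\<^esub>} \<Longrightarrow> A = {\<zero>\<^bsub>M\<^esub>} \<or> B = {\<zero>\<^bsub>M\<^esub>}"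
    using assms(2) unfolding uniform_submodule_def by blast+
  obtain B where B: "submodule B R M" "T \<subseteq> B" "baer R (M\<lparr>carrier := B\<rparr>)"
    and ess: "\<And>Y. submodule Y R M \<Longrightarrow> Y \<subseteq> B \<Longrightarrow> Y \<inter> T \<subseteq> {\<zero>\<^bsub>M\<^esub>} \<Longrightarrow> Y = {\<zero>\<^bsub>M\<^esub>}"
    using baer_hull[OF assms(1) T(1)] by metis
  have "B \<noteq> {\<zero>\<^bsub>M\<^esub>}" using B(2) T submodule_zero[OF T(1)] by blast
  moreover have False
    if NL: "submodule N R M" "N \<subseteq> B" "submodule L R M" "L \<subseteq> B" "N \<noteq> {\<zero>\<^bsub>M\<^esub>}" "L \<noteq> {\<zero>\<^bsub>M\<^esub>}"
      "N \<inter> L = {\<zero>\<^bsub>M\<^esub>}" for N L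
  proof -
    have "N \<inter> T = {\<zero>\<^bsub>M\<^esub>} \<or> L \<inter> T = {\<zero>\<^bsub>M\<^esub>}"
      by (rule Tu) (use NL submodule_Int[OF _ T(1)] in auto)
    then show False using ess[OF NL(1,2)] ess[OF NL(3,4)] NL(5,6) by auto
  qed
  ultimately have "indecomposable_module R (M\<lparr>carrier := B\<rparr>)"
    unfolding indecomposable_module_def submodule_of_submodule_iff[OF B(1)]
    using submodule_left_module[OF B(1)] by (auto simp del: not_ex)
  then show ?thesis using that B ess by blast
qed

end

lemma indecomposable_iso:
  assumes M: "indecomposable_module R M" and N: "left_module R N" and iso: "lmod_iso R N M"
  shows "indecomposable_module R N"
proof -
  obtain h where h: "h \<in> lmod_hom R N M" "bij_betw h (carrier N) (carrier M)"
    using iso by (rule lmod_isoE)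
  interpret M: left_module R M using M by (simp add: indecomposable_module_def)
  interpret h: lmodule_hom R N M h by (intro lmodule_homI N M.left_module_axioms h)
  have inj: "inj_on h (carrier N)" and im: "h ` carrier N = carrier M"
    using h(2) by (auto simp: bij_betw_def)
  have nz: "h ` A \<noteq> {\<zero>\<^bsub>M\<^esub>}" if "submodule A R N" "A \<noteq> {\<zero>\<^bsub>N\<^esub>}" for A
  proof
    assume "h ` A = {\<zero>\<^bsub>M\<^esub>}"
    then have "A \<subseteq> {\<zero>\<^bsub>N\<^esub>}"
      using inj h.M.submodule_carrier[OF that(1)] unfolding h.inj_iff by blast
    then show False using that h.M.submodule_zero[OF that(1)] by auto
  qed
  have False
    if AB: "submodule A R N" "submodule B R N" "A \<noteq> {\<zero>\<^bsub>N\<^esub>}" "B \<noteq> {\<zero>\<^bsub>N\<^esub>}"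
      "A <+>\<^bsub>N\<^esub> B = carrier N" "A \<inter> B = {\<zero>\<^bsub>N\<^esub>}" for A B
  proof -
    note Ac = h.M.submodule_carrier[OF AB(1)] and Bc = h.M.submodule_carrier[OF AB(2)]
    have "h ` A <+>\<^bsub>M\<^esub> h ` B = h ` (A <+>\<^bsub>N\<^esub> B)"
      unfolding set_add_def' using h.add Ac Bc by (auto simp: image_iff; metis)
    moreover have "h ` A \<inter> h ` B = h ` (A \<inter> B)"
      using inj_on_image_Int[OF inj, of A B] Ac Bc by auto
    ultimately show False
      using AB(5,6) im h.zero nz[OF AB(1,3)] nz[OF AB(2,4)] h.submodule_image[OF AB(1)]
        h.submodule_image[OF AB(2)] M unfolding indecomposable_module_def by (metis image_empty image_insert)
  qed
  moreover have "carrier N \<noteq> {\<zero>\<^bsub>N\<^esub>}"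
    using M im h.zero by (auto simp: indecomposable_module_def)
  ultimately show ?thesis using N unfolding indecomposable_module_def by blast
qed

text \<open>The form of local injectivity that does not depend on the type.\<close>

definition locally_baer :: "('r, 'x) ring_scheme \<Rightarrow> ('r, 'm) module \<Rightarrow> bool" where
  "locally_baer R M \<longleftrightarrow> left_module R M \<and>
    (\<forall>F. finite F \<and> F \<subseteq> carrier M \<longrightarrow>
      (\<exists>N. submodule N R M \<and> F \<subseteq> N \<and> baer R (M\<lparr>carrier := N\<rparr>)))"

lemma locally_injective_iff_locally_baer:
  fixes M :: "('r, 'm) module" and R :: "('r, 'x) ring_scheme"
  assumes "ring R" "|carrier R| \<le>o |UNIV :: 'm set|"
  shows "locally_injective R M \<longleftrightarrow> locally_baer R M"
  unfolding locally_injective_def locally_baer_def injective_module_iff_baer[OF assms] ..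

lemma locally_baer_iso:
  assumes M: "locally_baer R M" and N: "left_module R N" and iso: "lmod_iso R M N"
  shows "locally_baer R N"
  unfolding locally_baer_def
proof (intro conjI N allI impI; elim conjE)
  fix F assume F: "finite F" "F \<subseteq> carrier N"
  interpret M: left_module R M using M by (simp add: locally_baer_def)
  obtain h where h: "h \<in> lmod_hom R M N" "bij_betw h (carrier M) (carrier N)"
    using iso by (rule lmod_isoE)
  interpret h: lmodule_hom R M N h by (intro lmodule_homI N M.left_module_axioms h)
  have inj: "inj_on h (carrier M)" and im: "h ` carrier M = carrier N"
    using h(2) by (auto simp: bij_betw_def)
  obtain G where G: "finite G" "G \<subseteq> carrier M" "F = h ` G"
    using finite_subset_image[OF F(1)] F(2) im by metis
  obtain B where B: "submodule B R M" "G \<subseteq> B" "baer R (M\<lparr>carrier := B\<rparr>)"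
    using M G unfolding locally_baer_def by blast
  note Bc = M.submodule_carrier[OF B(1)]
  have hB: "submodule (h ` B) R N" by (rule h.submodule_image[OF B(1)])
  have "baer R (N\<lparr>carrier := h ` B\<rparr>)"
  proof (rule baer_iso[OF B(3) h.N.submodule_left_module[OF hB]])
    show "lmod_iso R (M\<lparr>carrier := B\<rparr>) (N\<lparr>carrier := h ` B\<rparr>)"
      unfolding lmod_iso_def
      by (intro bexI[of _ h] lmod_homI)
        (use Bc h.add h.smult inj in \<open>auto simp: bij_betw_def intro: inj_on_subset\<close>)
  qed
  then show "\<exists>K. submodule K R N \<and> F \<subseteq> K \<and> baer R (N\<lparr>carrier := K\<rparr>)"
    using hB G B by blast
qed

section \<open>Powers with restricted supports\<close>

text \<open>These closure properties make the functions with support in \<open>\<F>\<close> a submodule of the full power.\<close>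

definition set_ideal :: "'i set set \<Rightarrow> bool" where
  "set_ideal \<F> \<longleftrightarrow> {} \<in> \<F> \<and> (\<forall>A\<in>\<F>. \<forall>B\<in>\<F>. A \<union> B \<in> \<F>) \<and> (\<forall>A\<in>\<F>. \<forall>B. B \<subseteq> A \<longrightarrow> B \<in> \<F>)"

lemma set_ideal_Pow [simp]: "set_ideal (Pow S)"
  by (auto simp: set_ideal_def)

lemma set_ideal_Fpow [simp]: "set_ideal (Fpow S)"
  by (auto simp: set_ideal_def Fpow_def finite_subset)

definition supp :: "('r, 'e) module \<Rightarrow> ('i \<Rightarrow> 'e) \<Rightarrow> 'i set" where
  "supp E x = {i. x i \<noteq> \<zero>\<^bsub>E\<^esub>}"

text \<open>One construction covers direct sums of copies of \<open>E\<close>, where the supports are finite, and the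
  powers with supports of bounded cardinality, which are injective in cases where the direct sum is
  not.\<close>

definition supported_module :: "'i set set \<Rightarrow> ('r, 'e) module \<Rightarrow> ('r, 'i \<Rightarrow> 'e) module" where
  "supported_module \<F> E = \<lparr>carrier = {x. (\<forall>i. x i \<in> carrier E) \<and> supp E x \<in> \<F>},
    mult = undefined, one = undefined, zero = (\<lambda>i. \<zero>\<^bsub>E\<^esub>),
    add = (\<lambda>x y i. x i \<oplus>\<^bsub>E\<^esub> y i), smult = (\<lambda>a x i. a \<odot>\<^bsub>E\<^esub> x i)\<rparr>"

abbreviation direct_power :: "'i set \<Rightarrow> ('r, 'e) module \<Rightarrow> ('r, 'i \<Rightarrow> 'e) module" where
  "direct_power X E \<equiv> supported_module (Fpow X) E"

lemma supported_module_simps [simp]: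
  "\<zero>\<^bsub>supported_module \<F> E\<^esub> = (\<lambda>i. \<zero>\<^bsub>E\<^esub>)"
  "x \<oplus>\<^bsub>supported_module \<F> E\<^esub> y = (\<lambda>i. x i \<oplus>\<^bsub>E\<^esub> y i)"
  "a \<odot>\<^bsub>supported_module \<F> E\<^esub> x = (\<lambda>i. a \<odot>\<^bsub>E\<^esub> x i)"
  by (simp_all add: supported_module_def)

lemma supported_module_carrier:
  "x \<in> carrier (supported_module \<F> E) \<longleftrightarrow> (\<forall>i. x i \<in> carrier E) \<and> supp E x \<in> \<F>"
  by (simp add: supported_module_def)

lemma direct_power_carrier:
  "x \<in> carrier (direct_power X E) \<longleftrightarrow>
    (\<forall>i. x i \<in> carrier E) \<and> finite (supp E x) \<and> supp E x \<subseteq> X"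
  by (auto simp: supported_module_carrier Fpow_def)

lemma (in lmodule) supp_add: "supp M (\<lambda>i. x i \<oplus>\<^bsub>M\<^esub> y i) \<subseteq> supp M x \<union> supp M y"
  by (auto simp: supp_def)

lemma (in lmodule) supp_smult: "a \<in> carrier R \<Longrightarrow> supp M (\<lambda>i. a \<odot>\<^bsub>M\<^esub> x i) \<subseteq> supp M x"
  by (auto simp: supp_def)

lemma (in lmodule) left_module_supported:
  assumes "set_ideal \<F>" shows "left_module R (supported_module \<F> M)"
proof -
  have F: "{} \<in> \<F>" "\<And>A B. A \<in> \<F> \<Longrightarrow> B \<in> \<F> \<Longrightarrow> A \<union> B \<in> \<F>" "\<And>A B. A \<in> \<F> \<Longrightarrow> B \<subseteq> A \<Longrightarrow> B \<in> \<F>"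
    using assms by (auto simp: set_ideal_def)
  have "supp M (\<lambda>i. \<zero>\<^bsub>M\<^esub>) \<in> \<F>" using F(1) by (simp add: supp_def)
  then show ?thesis
    by (intro left_moduleI_smult_zero R.ring_axioms)
      (auto simp: supported_module_carrier M.a_ac smult_l_distr smult_r_distr smult_assoc1
        intro: F(3)[OF F(2) supp_add] F(3)[OF _ supp_smult])
qed

text \<open>A function with values in an injective module is solved for coordinatewise, and the solution
  may be taken to be zero outside every set that contains the supports of all given values.\<close>

lemma baer_supported:
  assumes E: "baer R E" and \<F>: "set_ideal \<F>"
    and S: "\<And>I f. left_ideal I R \<Longrightarrow> f \<in> lmod_hom R (ideal_module R I) (supported_module \<F> E) \<Longrightarrow>
      \<exists>S\<in>\<F>. \<forall>a\<in>I. supp E (f a) \<subseteq> S"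
  shows "baer R (supported_module \<F> E)"
  unfolding baer_def
proof (intro conjI allI impI; (elim conjE)?)
  interpret E: lmodule R E using E by (intro lmoduleI baer_left_module)
  show "left_module R (supported_module \<F> E)" by (rule E.left_module_supported[OF \<F>])
  fix I f assume I: "left_ideal I R" and f: "f \<in> lmod_hom R (ideal_module R I) (supported_module \<F> E)"
  obtain S where S: "S \<in> \<F>" "\<And>a. a \<in> I \<Longrightarrow> supp E (f a) \<subseteq> S" using S[OF I f] by blast
  have IR: "a \<in> carrier R" if "a \<in> I" for a
    using I that left_ideal_iff[OF E.R.ring_axioms] by auto
  have "\<exists>y\<in>carrier E. \<forall>a\<in>I. f a i = a \<odot>\<^bsub>E\<^esub> y" for i
  proof -
    have "(\<lambda>a. f a i) \<in> lmod_hom R (ideal_module R I) E"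
      using lmod_hom_closed[OF f] lmod_hom_add[OF f] lmod_hom_smult[OF f]
      by (intro lmod_homI) (auto simp: supported_module_carrier)
    from baerD[OF E I this] obtain y where "y \<in> carrier E" "\<And>a. a \<in> I \<Longrightarrow> f a i = a \<odot>\<^bsub>E\<^esub> y" by blast
    then show ?thesis by blast
  qed
  then obtain y where y: "\<And>i. y i \<in> carrier E" "\<And>i a. a \<in> I \<Longrightarrow> f a i = a \<odot>\<^bsub>E\<^esub> y i"
    by metis
  define z where "z i = (if i \<in> S then y i else \<zero>\<^bsub>E\<^esub>)" for i
  have "supp E z \<subseteq> S" by (auto simp: supp_def z_def)
  then have "supp E z \<in> \<F>" using S(1) \<F> by (auto simp: set_ideal_def)
  then have "z \<in> carrier (supported_module \<F> E)"
    using y by (auto simp: supported_module_carrier z_def)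
  moreover have "f a = (\<lambda>i. a \<odot>\<^bsub>E\<^esub> z i)" if "a \<in> I" for a
  proof
    fix i show "f a i = a \<odot>\<^bsub>E\<^esub> z i"
      using S(2)[OF that] y(2)[OF that] IR[OF that] by (cases "i \<in> S") (auto simp: z_def supp_def)
  qed
  ultimately show "\<exists>y\<in>carrier (supported_module \<F> E). \<forall>a\<in>I. f a = a \<odot>\<^bsub>supported_module \<F> E\<^esub> y"
    by auto
qed

text \<open>Finitely many functions have their supports in one finite set, and the functions supported
  there form a finite power.\<close>

lemma locally_baer_direct_power:
  assumes E: "baer R E" shows "locally_baer R (direct_power X E)"
  unfolding locally_baer_def
proof (intro conjI allI impI; (elim conjE)?)
  interpret E: lmodule R E using E by (intro lmoduleI baer_left_module)
  show l: "left_module R (direct_power X E)" by (rule E.left_module_supported) simp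
  interpret P: left_module R "direct_power X E" by fact
  fix F assume F: "finite F" "F \<subseteq> carrier (direct_power X E)"
  define S where "S = (\<Union>x\<in>F. supp E x)"
  have S: "finite S" "S \<subseteq> X" using F by (auto simp: S_def direct_power_carrier subset_iff)
  define N where "N = {x. (\<forall>i. x i \<in> carrier E) \<and> supp E x \<in> Pow S}"
  have "(direct_power X E)\<lparr>carrier := N\<rparr> = supported_module (Pow S) E"
    by (simp add: supported_module_def N_def)
  moreover have "baer R (supported_module (Pow S) E)"
  proof (rule baer_supported[OF E set_ideal_Pow])
    fix I f assume f: "f \<in> lmod_hom R (ideal_module R I) (supported_module (Pow S) E)"
    have "supp E (f a) \<subseteq> S" if "a \<in> I" for a
      using lmod_hom_closed[OF f, of a] that by (simp add: supported_module_carrier)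
    then show "\<exists>T\<in>Pow S. \<forall>a\<in>I. supp E (f a) \<subseteq> T" by blast
  qed
  moreover have "submodule N R (direct_power X E)"
  proof -
    interpret Q: left_module R "supported_module (Pow S) E" by (rule E.left_module_supported) simp
    have N: "N = carrier (supported_module (Pow S) E)" by (simp add: supported_module_def N_def)
    have "N \<subseteq> carrier (direct_power X E)"
      using S finite_subset[OF _ S(1)] by (auto simp: N_def direct_power_carrier)
    then show ?thesis
      unfolding P.submodule_iff N
      using Q.M.zero_closed Q.M.add.m_closed Q.smult_closed unfolding supported_module_simps by blast
  qed
  moreover have "F \<subseteq> N" using F by (auto simp: N_def S_def direct_power_carrier subset_iff)
  ultimately show "\<exists>N. submodule N R (direct_power X E) \<and> F \<subseteq> N \<and>
      baer R ((direct_power X E)\<lparr>carrier := N\<rparr>)" by auto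
qed

lemma locally_baer_prod:
  assumes N: "baer R N" and M: "locally_baer R M" shows "locally_baer R (prod_module N M)"
  unfolding locally_baer_def
proof (intro conjI allI impI; (elim conjE)?)
  interpret M: left_module R M using M by (simp add: locally_baer_def)
  interpret N: left_module R N using N by (rule baer_left_module)
  show "left_module R (prod_module N M)"
    by (intro left_module_prod_module N.left_module_axioms M.left_module_axioms)
  then interpret P: left_module R "prod_module N M" .
  fix F assume F: "finite F" "F \<subseteq> carrier (prod_module N M)"
  then have "finite (snd ` F)" "snd ` F \<subseteq> carrier M" by auto
  then obtain K where K: "submodule K R M" "snd ` F \<subseteq> K" "baer R (M\<lparr>carrier := K\<rparr>)"
    using M unfolding locally_baer_def by blast
  have "(prod_module N M)\<lparr>carrier := carrier N \<times> K\<rparr> = prod_module N (M\<lparr>carrier := K\<rparr>)"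
    by (simp add: prod_module_def)
  moreover have "submodule (carrier N \<times> K) R (prod_module N M)"
    using K(1) unfolding P.submodule_iff M.submodule_iff by auto
  moreover have "F \<subseteq> carrier N \<times> K" using F K(2) by force
  ultimately show "\<exists>K. submodule K R (prod_module N M) \<and> F \<subseteq> K \<and>
      baer R ((prod_module N M)\<lparr>carrier := K\<rparr>)"
    using baer_prod[OF N K(3)] by metis
qed

definition pull_back :: "('r, 'e) module \<Rightarrow> 'i set \<Rightarrow> ('i \<Rightarrow> 'j) \<Rightarrow> ('j \<Rightarrow> 'e) \<Rightarrow> 'i \<Rightarrow> 'e" where
  "pull_back E X f x = (\<lambda>j. if j \<in> X then x (f j) else \<zero>\<^bsub>E\<^esub>)"

lemma direct_power_reindex:
  assumes "left_module R E" and f: "bij_betw f X Y"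
  shows "lmod_iso R (direct_power X E) (direct_power Y E)"
proof -
  interpret E: lmodule R E using assms(1) by (rule lmoduleI)
  define k where "k = inv_into X f"
  have k: "k j \<in> X" "f (k j) = j" if "j \<in> Y" for j
    using that f by (auto simp: k_def bij_betw_def inv_into_into f_inv_into_f)
  have kf: "k (f i) = i" "f i \<in> Y" if "i \<in> X" for i
    using that f by (auto simp: k_def bij_betw_def)
  have sk: "supp E (pull_back E Y k x) \<subseteq> Y \<inter> f ` supp E x" for x
  proof
    fix i assume "i \<in> supp E (pull_back E Y k x)"
    then have i: "i \<in> Y" "k i \<in> supp E x" by (auto simp: pull_back_def supp_def split: if_splits)
    then show "i \<in> Y \<inter> f ` supp E x" using k(2)[OF i(1)] by (metis IntI image_eqI)
  qed
  have sf: "supp E (pull_back E X f x) \<subseteq> X \<inter> k ` supp E x" for x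
  proof
    fix i assume "i \<in> supp E (pull_back E X f x)"
    then have i: "i \<in> X" "f i \<in> supp E x" by (auto simp: pull_back_def supp_def split: if_splits)
    then show "i \<in> X \<inter> k ` supp E x" using kf(1)[OF i(1)] by (metis IntI image_eqI)
  qed
  have c: "pull_back E Y k x \<in> carrier (direct_power Y E)" if "x \<in> carrier (direct_power X E)" for x
    using that sk[of x] finite_subset[OF sk] unfolding direct_power_carrier by (auto simp: pull_back_def)
  have c': "pull_back E X f x \<in> carrier (direct_power X E)" if "x \<in> carrier (direct_power Y E)" for x
    using that sf[of x] finite_subset[OF sf] unfolding direct_power_carrier by (auto simp: pull_back_def)
  have i: "pull_back E X f (pull_back E Y k x) = x" if "x \<in> carrier (direct_power X E)" for x
    using that kf by (force simp: pull_back_def direct_power_carrier supp_def fun_eq_iff)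
  have i': "pull_back E Y k (pull_back E X f x) = x" if "x \<in> carrier (direct_power Y E)" for x
    using that k by (force simp: pull_back_def direct_power_carrier supp_def fun_eq_iff)
  have "bij_betw (pull_back E Y k) (carrier (direct_power X E)) (carrier (direct_power Y E))"
    by (rule bij_betw_byWitness[of _ "pull_back E X f"]) (use c c' i i' in auto)
  moreover have "pull_back E Y k \<in> lmod_hom R (direct_power X E) (direct_power Y E)"
    by (rule lmod_homI[OF c]) (auto simp: pull_back_def fun_eq_iff)
  ultimately show ?thesis unfolding lmod_iso_def by blast
qed

section \<open>Noetherian rings\<close>

lemma left_noetherian_maximal:
  assumes "left_noetherian R" "\<S> \<noteq> {}" "\<And>I. I \<in> \<S> \<Longrightarrow> left_ideal I R"
  shows "\<exists>I\<in>\<S>. \<forall>J\<in>\<S>. I \<subseteq> J \<longrightarrow> J = I"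
proof (rule ccontr)
  assume "\<not> ?thesis"
  then have *: "\<exists>J\<in>\<S>. I \<subset> J" if "I \<in> \<S>" for I using that by blast
  define f where "f = rec_nat (SOME I. I \<in> \<S>) (\<lambda>n I. SOME J. J \<in> \<S> \<and> I \<subset> J)"
  have f: "f n \<in> \<S>" for n
  proof (induction n)
    case 0
    then show ?case using assms(2) by (auto simp: f_def some_in_eq)
  next
    case (Suc n)
    then show ?case using someI_ex[of "\<lambda>J. J \<in> \<S> \<and> f n \<subset> J"] *[OF Suc] by (auto simp: f_def)
  qed
  have f': "f n \<subset> f (Suc n)" for n
    using someI_ex[of "\<lambda>J. J \<in> \<S> \<and> f n \<subset> J"] *[OF f[of n]] by (auto simp: f_def)
  then have "\<forall>n. f n \<subseteq> f (Suc n)" by blast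
  then obtain n where n: "\<forall>m\<ge>n. f m = f n"
    using assms(1) assms(3)[OF f] unfolding left_noetherian_def by blast
  have "f (Suc n) = f n" using n by (rule allE[of _ "Suc n"]) simp
  then show False using f'[of n] by simp
qed

text \<open>Among the left ideals generated by finite subsets of \<open>I\<close> there is a maximal one, and it
  contains every element of \<open>I\<close>. That \<open>A\<close> generates \<open>I\<close> is expressed by the minimality of \<open>I\<close> among
  the left ideals containing \<open>A\<close>.\<close>

lemma left_noetherian_finitely_generated:
  assumes "ring R" "left_noetherian R" "left_ideal I R"
  obtains A where "finite A" "A \<subseteq> I" "\<And>J. left_ideal J R \<Longrightarrow> A \<subseteq> J \<Longrightarrow> I \<subseteq> J"
proof -
  define G where "G A = \<Inter>{J. left_ideal J R \<and> A \<subseteq> J}" for A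
  have GI: "G A \<subseteq> I" if "A \<subseteq> I" for A using that assms(3) by (auto simp: G_def)
  have Gl: "left_ideal (G A) R" if "A \<subseteq> I" for A
    unfolding left_ideal_iff[OF assms(1)]
  proof (intro conjI ballI)
    have "I \<subseteq> carrier R" using left_ideal_iff[OF assms(1), of I] assms(3) by simp
    then show "G A \<subseteq> carrier R" using GI[OF that] by blast
  qed (auto simp: G_def left_ideal_iff[OF assms(1)])
  let ?S = "G ` {A. finite A \<and> A \<subseteq> I}"
  have ne: "?S \<noteq> {}" by blast
  have li: "J \<in> ?S \<Longrightarrow> left_ideal J R" for J using Gl by blast
  have "\<exists>K\<in>?S. \<forall>J\<in>?S. K \<subseteq> J \<longrightarrow> J = K"
    by (rule left_noetherian_maximal[OF assms(2) ne li])
  then obtain A where A: "finite A" "A \<subseteq> I"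
    and K: "\<And>B. finite B \<Longrightarrow> B \<subseteq> I \<Longrightarrow> G A \<subseteq> G B \<Longrightarrow> G B = G A" by auto
  have "I \<subseteq> G A"
  proof
    fix a assume a: "a \<in> I"
    have "G A \<subseteq> G (insert a A)" by (auto simp: G_def)
    then have "G (insert a A) = G A" using K[of "insert a A"] A a by auto
    moreover have "a \<in> G (insert a A)" by (auto simp: G_def)
    ultimately show "a \<in> G A" by simp
  qed
  then show ?thesis using that[OF A(1,2)] by (auto simp: G_def)
qed

text \<open>A homomorphism from a left ideal maps a finite generating set into some injective submodule,
  and therefore the whole ideal.\<close>

lemma locally_baer_imp_baer:
  assumes noeth: "left_noetherian R" and M: "locally_baer R M"
  shows "baer R M"
  unfolding baer_def
proof (intro conjI allI impI; (elim conjE)?)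
  show l: "left_module R M" using M by (simp add: locally_baer_def)
  interpret M: left_module R M by fact
  fix I f assume I: "left_ideal I R" and f: "f \<in> lmod_hom R (ideal_module R I) M"
  note I' = I[unfolded left_ideal_iff[OF M.R.ring_axioms]]
  have fc: "f a \<in> carrier M" if "a \<in> I" for a using lmod_hom_closed[OF f] that by simp
  obtain A where A: "finite A" "A \<subseteq> I" "\<And>J. left_ideal J R \<Longrightarrow> A \<subseteq> J \<Longrightarrow> I \<subseteq> J"
    using left_noetherian_finitely_generated[OF M.R.ring_axioms noeth I] by metis
  then have "finite (f ` A)" "f ` A \<subseteq> carrier M" using fc by auto
  then obtain N where N: "submodule N R M" "f ` A \<subseteq> N" "baer R (M\<lparr>carrier := N\<rparr>)"
    using M unfolding locally_baer_def by blast
  interpret I: left_module R "ideal_module R I" by (rule left_module_ideal_module[OF M.R.ring_axioms I])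
  interpret f: lmodule_hom R "ideal_module R I" M f
    by (intro lmodule_homI f I.left_module_axioms M.left_module_axioms)
  have "left_ideal {a \<in> I. f a \<in> N} R"
    using f.submodule_vimage[OF N(1)] I'
    unfolding left_ideal_iff[OF M.R.ring_axioms] I.submodule_iff by auto
  then have "I \<subseteq> {a \<in> I. f a \<in> N}" by (rule A(3)) (use A N in auto)
  then have "f \<in> lmod_hom R (ideal_module R I) (M\<lparr>carrier := N\<rparr>)"
    using f by (auto simp: lmod_hom_def)
  then obtain y where "y \<in> N" "\<And>a. a \<in> I \<Longrightarrow> f a = a \<odot>\<^bsub>M\<^esub> y"
    using baerD[OF N(3) I] by auto
  then show "\<exists>y\<in>carrier M. \<forall>a\<in>I. f a = a \<odot>\<^bsub>M\<^esub> y"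
    using M.submodule_carrier[OF N(1)] by blast
qed

lemma baer_direct_power:
  "left_noetherian R \<Longrightarrow> baer R E \<Longrightarrow> baer R (direct_power X E)"
  by (rule locally_baer_imp_baer[OF _ locally_baer_direct_power])

text \<open>Consider the submodules \<open>A\<close> that avoid some nonzero submodule \<open>T\<close> of a cyclic module \<open>R x\<close>.
  If the left ideal of all \<open>r\<close> with \<open>r x \<in> A\<close> is maximal, then \<open>T\<close> is uniform: if \<open>T\<close> contained two
  nonzero submodules avoiding each other, one of them could be added to \<open>A\<close>.\<close>

lemma (in lmodule) exists_uniform_submodule:
  assumes noeth: "left_noetherian R" and K: "submodule K R M" "K \<noteq> {\<zero>\<^bsub>M\<^esub>}"
  obtains T where "uniform_submodule T" "T \<subseteq> K"
proof -
  obtain x where xK: "x \<in> K" "x \<noteq> \<zero>\<^bsub>M\<^esub>" using K submodule_zero[OF K(1)] by blast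
  then have x: "x \<in> carrier M" "x \<noteq> \<zero>\<^bsub>M\<^esub>" using submodule_carrier[OF K(1)] by auto
  define C where "C = (\<lambda>a. a \<odot>\<^bsub>M\<^esub> x) ` carrier R"
  have C: "submodule C R M" unfolding C_def by (rule submodule_cyclic[OF x(1)])
  have xC: "x \<in> C" unfolding C_def by (rule image_eqI[of _ _ "\<one>\<^bsub>R\<^esub>"]) (use x in auto)
  define J where "J A = {r \<in> carrier R. r \<odot>\<^bsub>M\<^esub> x \<in> A}" for A
  define P where "P A T \<longleftrightarrow> submodule A R M \<and> submodule T R M \<and> T \<noteq> {\<zero>\<^bsub>M\<^esub>} \<and> T \<subseteq> C \<and>
    A \<inter> T \<subseteq> {\<zero>\<^bsub>M\<^esub>}" for A T
  have Jl: "left_ideal (J A) R" if "submodule A R M" for A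
    using that x unfolding left_ideal_iff[OF R.ring_axioms] submodule_iff
    by (auto simp: J_def smult_l_distr smult_assoc1)
  have "P {\<zero>\<^bsub>M\<^esub>} C" using C xC x by (auto simp: P_def)
  then have "{J A | A. \<exists>T. P A T} \<noteq> {}" by blast
  moreover have "left_ideal I R" if "I \<in> {J A | A. \<exists>T. P A T}" for I
    using that Jl by (auto simp: P_def)
  ultimately have "\<exists>I\<in>{J A | A. \<exists>T. P A T}. \<forall>K\<in>{J A | A. \<exists>T. P A T}. I \<subseteq> K \<longrightarrow> K = I"
    by (rule left_noetherian_maximal[OF noeth])
  then obtain A T where AT: "P A T"
    and max': "\<forall>K\<in>{J A | A. \<exists>T. P A T}. J A \<subseteq> K \<longrightarrow> K = J A" by blast
  have max: "J A' = J A" if "P A' T'" "J A \<subseteq> J A'" for A' T'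
    by (rule max'[rule_format]) (use that in blast)+
  have "T1 = {\<zero>\<^bsub>M\<^esub>} \<or> T2 = {\<zero>\<^bsub>M\<^esub>}"
    if T12: "submodule T1 R M" "submodule T2 R M" "T1 \<subseteq> T" "T2 \<subseteq> T" "T1 \<inter> T2 \<subseteq> {\<zero>\<^bsub>M\<^esub>}" for T1 T2
  proof (rule disjCI)
    assume nz2: "T2 \<noteq> {\<zero>\<^bsub>M\<^esub>}"
    have A: "submodule A R M" and T: "submodule T R M" "A \<inter> T \<subseteq> {\<zero>\<^bsub>M\<^esub>}" "T \<subseteq> C"
      using AT by (auto simp: P_def)
    have "(A <+>\<^bsub>M\<^esub> T1) \<inter> T2 \<subseteq> {\<zero>\<^bsub>M\<^esub>}"
    proof
      fix t assume "t \<in> (A <+>\<^bsub>M\<^esub> T1) \<inter> T2"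
      then obtain a u where *: "a \<in> A" "u \<in> T1" "t = a \<oplus>\<^bsub>M\<^esub> u" "t \<in> T2"
        unfolding set_add_def' by blast
      have "a \<oplus>\<^bsub>M\<^esub> u = \<zero>\<^bsub>M\<^esub> \<oplus>\<^bsub>M\<^esub> t" using * submodule_carrier[OF T12(2)] by auto
      then have "u = t"
        using independent_sum_eq[OF A T(1,2) *(1) submodule_zero[OF A]] * T12 by blast
      then show "t \<in> {\<zero>\<^bsub>M\<^esub>}" using * T12(5) by blast
    qed
    then have "P (A <+>\<^bsub>M\<^esub> T1) T2"
      using A T T12 nz2 submodule_set_add unfolding P_def by auto
    moreover have "J A \<subseteq> J (A <+>\<^bsub>M\<^esub> T1)"
      using subset_set_add[OF A T12(1)] by (auto simp: J_def)
    ultimately have eq: "J (A <+>\<^bsub>M\<^esub> T1) = J A" by (rule max)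
    have "T1 \<subseteq> A"
    proof
      fix t assume t: "t \<in> T1"
      then obtain r where r: "r \<in> carrier R" "t = r \<odot>\<^bsub>M\<^esub> x" using T12(3) T(3) by (auto simp: C_def)
      then have "r \<in> J (A <+>\<^bsub>M\<^esub> T1)" using t subset_set_add(2)[OF A T12(1)] by (auto simp: J_def)
      then show "t \<in> A" using r by (simp add: eq) (simp add: J_def)
    qed
    then show "T1 = {\<zero>\<^bsub>M\<^esub>}" using T12(3) T(2) submodule_zero[OF T12(1)] by blast
  qed
  then have "uniform_submodule T" using AT unfolding uniform_submodule_def P_def by blast
  moreover have "T \<subseteq> K" using AT submodule_smult[OF K(1) _ xK(1)] by (auto simp: P_def C_def)
  ultimately show ?thesis by (rule that)
qed

section \<open>Injective modules as powers of one indecomposable module\<close>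

text \<open>The homomorphism from the direct power that has the components \<open>\<phi> i\<close>.\<close>

definition copower_map :: "('r, 'e) module \<Rightarrow> ('r, 'm) module \<Rightarrow> ('i \<Rightarrow> 'e \<Rightarrow> 'm) \<Rightarrow> ('i \<Rightarrow> 'e) \<Rightarrow> 'm" where
  "copower_map E M \<phi> v = (\<Oplus>\<^bsub>M\<^esub>i\<in>supp E v. \<phi> i (v i))"

text \<open>Sums over supports are compared on a common finite set of indices.\<close>

lemma copower_map_eq:
  assumes E: "left_module R E" and M: "left_module R M"
    and \<phi>: "\<And>i. i \<in> X \<Longrightarrow> \<phi> i \<in> lmod_hom R E M"
    and v: "v \<in> carrier (direct_power X E)" and F: "finite F" "supp E v \<subseteq> F" "F \<subseteq> X"
  shows "copower_map E M \<phi> v = (\<Oplus>\<^bsub>M\<^esub>i\<in>F. \<phi> i (v i))"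
proof -
  interpret M: left_module R M by fact
  interpret E: left_module R E by fact
  have z: "\<phi> i \<zero>\<^bsub>E\<^esub> = \<zero>\<^bsub>M\<^esub>" if "i \<in> X" for i
    using lmodule_hom.zero[OF lmodule_homI[OF E M \<phi>[OF that]]] .
  have c: "\<phi> i (v i) \<in> carrier M" if "i \<in> X" for i
    by (rule lmod_hom_closed[OF \<phi>[OF that]]) (use v in \<open>simp add: direct_power_carrier\<close>)
  show ?thesis
    unfolding copower_map_def
    using F z c by (intro M.M.add.finprod_mono_neutral_cong_left) (auto simp: supp_def)
qed

lemma copower_map_hom:
  assumes E: "left_module R E" and M: "left_module R M"
    and \<phi>: "\<And>i. i \<in> X \<Longrightarrow> \<phi> i \<in> lmod_hom R E M"
  shows "copower_map E M \<phi> \<in> lmod_hom R (direct_power X E) M"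
proof (rule lmod_homI)
  interpret M: left_module R M by fact
  interpret E: lmodule R E using E by (rule lmoduleI)
  interpret P: left_module R "direct_power X E" by (rule E.left_module_supported) simp
  note eq = copower_map_eq[where \<phi> = \<phi> and X = X, OF E M \<phi>]
  have Xc: "\<phi> i (v i) \<in> carrier M" if "v \<in> carrier (direct_power X E)" "i \<in> X" for v i
    by (rule lmod_hom_closed[OF \<phi>[OF that(2)]]) (use that(1) in \<open>simp add: direct_power_carrier\<close>)
  fix v assume v: "v \<in> carrier (direct_power X E)"
  then have vs: "finite (supp E v)" "supp E v \<subseteq> X" by (auto simp: direct_power_carrier)
  show "copower_map E M \<phi> v \<in> carrier M"
    unfolding copower_map_def using vs Xc[OF v] by (intro M.M.finsum_closed) auto
  show "copower_map E M \<phi> (a \<odot>\<^bsub>direct_power X E\<^esub> v) = a \<odot>\<^bsub>M\<^esub> copower_map E M \<phi> v"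
    if a: "a \<in> carrier R" for a
  proof -
    have *: "a \<odot>\<^bsub>M\<^esub> (\<Oplus>\<^bsub>M\<^esub>i\<in>F. \<phi> i (v i)) = (\<Oplus>\<^bsub>M\<^esub>i\<in>F. a \<odot>\<^bsub>M\<^esub> \<phi> i (v i))"
      if "finite F" "F \<subseteq> X" for F
      using that
    proof (induction F)
      case (insert i F)
      then have "(\<lambda>i. \<phi> i (v i)) \<in> F \<rightarrow> carrier M" "\<phi> i (v i) \<in> carrier M"
        "(\<lambda>i. a \<odot>\<^bsub>M\<^esub> \<phi> i (v i)) \<in> F \<rightarrow> carrier M" using a Xc[OF v] by auto
      then show ?case using insert a by (simp add: M.smult_r_distr)
    qed (use a in simp)
    have "copower_map E M \<phi> (a \<odot>\<^bsub>direct_power X E\<^esub> v) = (\<Oplus>\<^bsub>M\<^esub>i\<in>supp E v. \<phi> i (a \<odot>\<^bsub>E\<^esub> v i))"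
      using eq[OF _ P.smult_closed[OF a v] vs(1) _ vs(2)] E.supp_smult[OF a, of v] by simp
    also have "\<dots> = (\<Oplus>\<^bsub>M\<^esub>i\<in>supp E v. a \<odot>\<^bsub>M\<^esub> \<phi> i (v i))"
      using vs Xc[OF v] a v
      by (intro M.M.finsum_cong') (auto simp: direct_power_carrier intro!: lmod_hom_smult[OF \<phi>])
    also have "\<dots> = a \<odot>\<^bsub>M\<^esub> copower_map E M \<phi> v"
      unfolding copower_map_def by (rule *[OF vs, symmetric])
    finally show ?thesis .
  qed
  fix w assume w: "w \<in> carrier (direct_power X E)"
  define F where "F = supp E v \<union> supp E w"
  have F: "finite F" "F \<subseteq> X" using v w by (auto simp: F_def direct_power_carrier)
  have "copower_map E M \<phi> (v \<oplus>\<^bsub>direct_power X E\<^esub> w) = (\<Oplus>\<^bsub>M\<^esub>i\<in>F. \<phi> i (v i \<oplus>\<^bsub>E\<^esub> w i))"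
    using eq[OF _ P.M.add.m_closed[OF v w] F(1) _ F(2)] E.supp_add[of v w] by (simp add: F_def)
  also have "\<dots> = (\<Oplus>\<^bsub>M\<^esub>i\<in>F. \<phi> i (v i) \<oplus>\<^bsub>M\<^esub> \<phi> i (w i))"
    using F Xc[OF v] Xc[OF w] v w
    by (intro M.M.finsum_cong') (auto simp: direct_power_carrier intro!: lmod_hom_add[OF \<phi>])
  also have "\<dots> = (\<Oplus>\<^bsub>M\<^esub>i\<in>F. \<phi> i (v i)) \<oplus>\<^bsub>M\<^esub> (\<Oplus>\<^bsub>M\<^esub>i\<in>F. \<phi> i (w i))"
    using F Xc[OF v] Xc[OF w] by (intro M.M.finsum_addf) auto
  also have "\<dots> = copower_map E M \<phi> v \<oplus>\<^bsub>M\<^esub> copower_map E M \<phi> w"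
    using eq[OF _ v F(1) _ F(2)] eq[OF _ w F(1) _ F(2)] by (simp add: F_def)
  finally show "copower_map E M \<phi> (v \<oplus>\<^bsub>direct_power X E\<^esub> w) =
    copower_map E M \<phi> v \<oplus>\<^bsub>M\<^esub> copower_map E M \<phi> w" .
qed

text \<open>By Zorn there is a maximal set of embeddings \<open>E \<rightarrow> M\<close> whose images form a direct sum; each
  embedding is its own index. That direct sum is injective because the ring is noetherian, so it
  has a complement, and a nonzero complement would contain a further copy of \<open>E\<close>.\<close>

lemma baer_iso_direct_power:
  fixes E :: "('r, 'e) module" and M :: "('r, 'm) module"
  assumes noeth: "left_noetherian R" and M: "baer R M" and E: "baer R E" "indecomposable_module R E"
    and uniq: "\<And>B. submodule B R M \<Longrightarrow> baer R (M\<lparr>carrier := B\<rparr>) \<Longrightarrow>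
      indecomposable_module R (M\<lparr>carrier := B\<rparr>) \<Longrightarrow> lmod_iso R (M\<lparr>carrier := B\<rparr>) E"
  obtains X :: "('e \<Rightarrow> 'm) set" where "lmod_iso R (direct_power X E) M"
proof -
  interpret M: lmodule R M using M by (intro lmoduleI baer_left_module)
  interpret E: lmodule R E using E by (intro lmoduleI baer_left_module)
  note lM = M.left_module_axioms and lE = E.left_module_axioms
  let ?P = "\<lambda>X :: ('e \<Rightarrow> 'm) set. direct_power X E"
  let ?s = "copower_map E M (\<lambda>h. h)"
  have lP: "left_module R (?P X)" for X by (rule E.left_module_supported) simp
  let ?A = "{X. X \<subseteq> lmod_hom R E M \<and> inj_on ?s (carrier (?P X))}"
  have shom: "?s \<in> lmod_hom R (?P X) M" if "X \<subseteq> lmod_hom R E M" for X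
    by (rule copower_map_hom[OF lE lM]) (use that in auto)
  have inj_iff: "inj_on ?s (carrier (?P X)) \<longleftrightarrow> (\<forall>v\<in>carrier (?P X). ?s v = \<zero>\<^bsub>M\<^esub> \<longrightarrow> supp E v = {})"
    if "X \<subseteq> lmod_hom R E M" for X
    unfolding lmodule_hom.inj_iff[OF lmodule_homI[OF lP lM shom[OF that]]]
    by (auto simp: supp_def fun_eq_iff)
  have "\<exists>X\<in>?A. \<forall>Y\<in>?A. X \<subseteq> Y \<longrightarrow> Y = X"
  proof (rule subset_Zorn_nonempty)
    have "{} \<in> ?A" using inj_iff[of "{}"] by (auto simp: direct_power_carrier)
    then show "?A \<noteq> {}" by blast
    fix C assume C: "C \<noteq> {}" "subset.chain ?A C"
    then have CA: "C \<subseteq> ?A" unfolding subset.chain_def by blast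
    have h: "\<Union>C \<subseteq> lmod_hom R E M" using CA by blast
    have "supp E v = {}" if v: "v \<in> carrier (?P (\<Union>C))" "?s v = \<zero>\<^bsub>M\<^esub>" for v
    proof -
      have "finite (supp E v)" "supp E v \<subseteq> \<Union>C" using v by (auto simp: direct_power_carrier)
      then obtain X where X: "X \<in> C" "supp E v \<subseteq> X"
        using finite_subset_Union_chain[OF _ _ C] by metis
      then have "v \<in> carrier (?P X)" using v by (auto simp: direct_power_carrier)
      then show ?thesis using X CA inj_iff[of X] v(2) by auto
    qed
    then show "\<Union>C \<in> ?A" using h inj_iff[OF h] by blast
  qed
  then obtain X where X': "X \<in> ?A" and max': "\<forall>Y\<in>?A. X \<subseteq> Y \<longrightarrow> Y = X" by (rule bexE)
  have X: "X \<subseteq> lmod_hom R E M" "inj_on ?s (carrier (?P X))" using X' by simp_all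
  have max: "Y = X" if "Y \<subseteq> lmod_hom R E M" "inj_on ?s (carrier (?P Y))" "X \<subseteq> Y" for Y
    using max' that by simp
  interpret s: lmodule_hom R "?P X" M ?s by (rule lmodule_homI[OF lP lM shom[OF X(1)]])
  define S where "S = ?s ` carrier (?P X)"
  have S: "submodule S R M" unfolding S_def by (rule s.submodule_image) simp
  have "lmod_iso R (?P X) (M\<lparr>carrier := S\<rparr>)"
    unfolding S_def by (rule lmod_iso_image[OF shom[OF X(1)] X(2)])
  then have "baer R (M\<lparr>carrier := S\<rparr>)"
    by (rule baer_iso[OF baer_direct_power[OF noeth E(1)] M.submodule_left_module[OF S]])
  then obtain g where g: "g \<in> lmod_hom R M (M\<lparr>carrier := S\<rparr>)" "\<And>x. x \<in> S \<Longrightarrow> g x = x"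
    using M.baer_submodule_retraction[OF S] by metis
  define K where "K = {x \<in> carrier M. g x = \<zero>\<^bsub>M\<^esub>}"
  have K: "submodule K R M" "S \<inter> K = {\<zero>\<^bsub>M\<^esub>}" "S <+>\<^bsub>M\<^esub> K = carrier M"
    using M.retraction_complement[OF S g] by (auto simp: K_def)
  have "K = {\<zero>\<^bsub>M\<^esub>}"
  proof (rule ccontr)
    assume nz: "K \<noteq> {\<zero>\<^bsub>M\<^esub>}"
    obtain T where T: "M.uniform_submodule T" "T \<subseteq> K"
      using M.exists_uniform_submodule[OF noeth K(1) nz] by blast
    obtain B where BM: "submodule B R M" and B: "baer R (M\<lparr>carrier := B\<rparr>)"
        "indecomposable_module R (M\<lparr>carrier := B\<rparr>)"
      and ess: "\<And>Y. submodule Y R M \<Longrightarrow> Y \<subseteq> B \<Longrightarrow> Y \<inter> T \<subseteq> {\<zero>\<^bsub>M\<^esub>} \<Longrightarrow> Y = {\<zero>\<^bsub>M\<^esub>}"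
      using M.uniform_hull_indecomposable[OF M T(1)] by metis
    have BS: "B \<inter> S = {\<zero>\<^bsub>M\<^esub>}"
      by (rule ess[OF M.submodule_Int[OF BM S]]) (use T(2) K(2) in blast)+
    have "lmod_iso R E (M\<lparr>carrier := B\<rparr>)"
      using lmod_iso_sym[OF _ uniq[OF BM B]] M.submodule_left_module[OF BM] by blast
    then obtain \<phi> where \<phi>: "\<phi> \<in> lmod_hom R E (M\<lparr>carrier := B\<rparr>)" "bij_betw \<phi> (carrier E) B"
      by (auto elim: lmod_isoE)
    have \<phi>B: "\<phi> e \<in> B" if "e \<in> carrier E" for e using lmod_hom_closed[OF \<phi>(1) that] by simp
    have \<phi>M: "\<phi> \<in> lmod_hom R E M"
      using lmod_hom_add[OF \<phi>(1)] lmod_hom_smult[OF \<phi>(1)] \<phi>B M.submodule_carrier[OF BM]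
      by (intro lmod_homI) auto
    interpret \<phi>: lmodule_hom R E M \<phi> by (intro lmodule_homI lE lM \<phi>M)
    have inj\<phi>: "e = \<zero>\<^bsub>E\<^esub>" if "e \<in> carrier E" "\<phi> e = \<zero>\<^bsub>M\<^esub>" for e
      using \<phi>(2) that \<phi>.inj_iff by (auto simp: bij_betw_def)
    obtain e where e: "e \<in> carrier E" "e \<noteq> \<zero>\<^bsub>E\<^esub>"
      using E(2) E.M.zero_closed unfolding indecomposable_module_def by blast
    have \<phi>X: "\<phi> \<notin> X"
    proof
      assume "\<phi> \<in> X"
      define v where "v = (\<lambda>h. if h = \<phi> then e else \<zero>\<^bsub>E\<^esub>)"
      have sv: "supp E v = {\<phi>}" using e by (auto simp: v_def supp_def)
      then have "v \<in> carrier (?P X)" using e \<open>\<phi> \<in> X\<close> by (auto simp: direct_power_carrier v_def)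
      moreover have "?s v = \<phi> e"
        unfolding copower_map_def sv using \<phi>.closed[OF e(1)] by (simp add: v_def)
      ultimately have "\<phi> e \<in> S" unfolding S_def by force
      then have "\<phi> e = \<zero>\<^bsub>M\<^esub>" using \<phi>B[OF e(1)] BS by blast
      then show False using inj\<phi> e by blast
    qed
    have h: "insert \<phi> X \<subseteq> lmod_hom R E M" using X(1) \<phi>M by simp
    have "supp E v = {}" if v: "v \<in> carrier (?P (insert \<phi> X))" "?s v = \<zero>\<^bsub>M\<^esub>" for v
    proof -
      define w where "w = v(\<phi> := \<zero>\<^bsub>E\<^esub>)"
      have vs: "finite (supp E v)" "supp E v \<subseteq> insert \<phi> X" "\<And>i. v i \<in> carrier E"
        using v by (auto simp: direct_power_carrier)
      have sw: "supp E w = supp E v - {\<phi>}" by (auto simp: supp_def w_def)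
      have wc: "w \<in> carrier (?P X)" using vs sw by (auto simp: direct_power_carrier w_def)
      have hc: "\<psi> (v \<psi>) \<in> carrier M" if "\<psi> \<in> insert \<phi> X" for \<psi>
        by (rule lmod_hom_closed[OF subsetD[OF h that] vs(3)])
      have "?s v = (\<Oplus>\<^bsub>M\<^esub>h\<in>insert \<phi> (supp E w). h (v h))"
        by (rule copower_map_eq[OF lE lM _ v(1)]) (use h vs sw in auto)
      also have "\<dots> = \<phi> (v \<phi>) \<oplus>\<^bsub>M\<^esub> (\<Oplus>\<^bsub>M\<^esub>h\<in>supp E w. h (v h))"
        by (rule M.M.finsum_insert) (use vs hc in \<open>auto simp: sw\<close>)
      also have "(\<Oplus>\<^bsub>M\<^esub>h\<in>supp E w. h (v h)) = ?s w"
        unfolding copower_map_def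
      proof (rule M.M.finsum_cong')
        have "\<psi> \<in> X \<and> w \<psi> = v \<psi>" if "\<psi> \<in> supp E w" for \<psi>
          using that vs unfolding sw by (auto simp: w_def)
        then show "(\<lambda>h. h (w h)) \<in> supp E w \<rightarrow> carrier M"
          "\<And>\<psi>. \<psi> \<in> supp E w \<Longrightarrow> \<psi> (v \<psi>) = \<psi> (w \<psi>)" using hc by fastforce+
      qed simp
      finally have "\<phi> (v \<phi>) \<oplus>\<^bsub>M\<^esub> ?s w = \<zero>\<^bsub>M\<^esub>" unfolding v(2) by (rule sym)
      then have eq: "\<phi> (v \<phi>) \<oplus>\<^bsub>M\<^esub> ?s w = \<zero>\<^bsub>M\<^esub> \<oplus>\<^bsub>M\<^esub> \<zero>\<^bsub>M\<^esub>" by simp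
      have in_BS: "\<phi> (v \<phi>) \<in> B" "?s w \<in> S" using \<phi>B[OF vs(3)] wc by (auto simp: S_def)
      have "\<phi> (v \<phi>) = \<zero>\<^bsub>M\<^esub> \<and> ?s w = \<zero>\<^bsub>M\<^esub>"
        by (rule M.independent_sum_eq[OF BM S _ in_BS(1) _ in_BS(2) _ eq])
          (use BS M.submodule_zero[OF BM] M.submodule_zero[OF S] in auto)
      then have "v \<phi> = \<zero>\<^bsub>E\<^esub>" "supp E w = {}" using inj\<phi>[OF vs(3)] inj_iff[OF X(1)] X(2) wc by auto
      then show ?thesis using sw by (auto simp: supp_def)
    qed
    then have "inj_on ?s (carrier (?P (insert \<phi> X)))" unfolding inj_iff[OF h] by blast
    then show False using max[OF h] \<phi>X by blast
  qed
  then have "S = carrier M"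
    using K(3) M.submodule_carrier[OF S] unfolding set_add_def' by force
  then have "bij_betw ?s (carrier (?P X)) (carrier M)" using X(2) by (simp add: S_def bij_betw_def)
  then show ?thesis using that shom[OF X(1)] unfolding lmod_iso_def by blast
qed

text \<open>Uniformity replaces the Krull-Schmidt theorem here: if no coordinate of an embedding
  \<open>E \<rightarrow> E' \<oplus> E' \<oplus> \<dots>\<close> were injective, then finitely many nonzero kernels would meet a
  cyclic submodule of \<open>E\<close> in a nonzero element, which the embedding would kill.\<close>

lemma indecomposable_baer_embed_power_iso:
  assumes E: "baer R E" "indecomposable_module R E" and E': "baer R E'" "indecomposable_module R E'"
    and h: "h \<in> lmod_hom R E (direct_power X E')" "inj_on h (carrier E)"
  shows "lmod_iso R E E'"
proof -
  interpret E: lmodule R E using E by (intro lmoduleI baer_left_module)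
  interpret E': lmodule R E' using E' by (intro lmoduleI baer_left_module)
  interpret P: left_module R "direct_power X E'" by (rule E'.left_module_supported) simp
  interpret h: lmodule_hom R E "direct_power X E'" h
    by (intro lmodule_homI E.left_module_axioms P.left_module_axioms h)
  have p: "(\<lambda>x. h x i) \<in> lmod_hom R E E'" for i
    using h.closed h.add h.smult by (intro lmod_homI) (auto simp: direct_power_carrier)
  define K where "K i = {x \<in> carrier E. h x i = \<zero>\<^bsub>E'\<^esub>}" for i
  have p': "lmodule_hom R E E' (\<lambda>x. h x i)" for i
    by (rule lmodule_homI[OF E.left_module_axioms E'.left_module_axioms p])
  have K: "submodule (K i) R E" for i unfolding K_def by (rule lmodule_hom.submodule_kernel[OF p'])
  obtain x where x: "x \<in> carrier E" "x \<noteq> \<zero>\<^bsub>E\<^esub>"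
    using E(2) E.M.zero_closed unfolding indecomposable_module_def by blast
  define C where "C = (\<lambda>a. a \<odot>\<^bsub>E\<^esub> x) ` carrier R"
  have C: "submodule C R E" unfolding C_def by (rule E.submodule_cyclic[OF x(1)])
  have "x \<in> C" unfolding C_def by (rule image_eqI[of _ _ "\<one>\<^bsub>R\<^esub>"]) (use x in auto)
  then have Cn: "C \<noteq> {\<zero>\<^bsub>E\<^esub>}" using x by blast
  have uni: "A \<inter> B \<noteq> {\<zero>\<^bsub>E\<^esub>}"
    if "submodule A R E" "submodule B R E" "A \<noteq> {\<zero>\<^bsub>E\<^esub>}" "B \<noteq> {\<zero>\<^bsub>E\<^esub>}" for A B
  proof
    assume "A \<inter> B = {\<zero>\<^bsub>E\<^esub>}"
    then have "A = {\<zero>\<^bsub>E\<^esub>} \<or> B = {\<zero>\<^bsub>E\<^esub>}"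
      using E.indecomposable_baer_uniform[OF E, unfolded E.uniform_submodule_def,
          THEN conjunct2, THEN conjunct2, rule_format, of A B]
        that(1,2) E.submodule_subset[OF that(1)] E.submodule_subset[OF that(2)] by simp
    then show False using that by blast
  qed
  have hx: "h x \<in> carrier (direct_power X E')" using h.closed[OF x(1)] .
  have "\<exists>i. K i = {\<zero>\<^bsub>E\<^esub>}"
  proof (rule ccontr)
    assume nz: "\<nexists>i. K i = {\<zero>\<^bsub>E\<^esub>}"
    have "submodule (C \<inter> (\<Inter>i\<in>F. K i)) R E \<and> C \<inter> (\<Inter>i\<in>F. K i) \<noteq> {\<zero>\<^bsub>E\<^esub>}" if "finite F" for F
      using that
    proof (induction F)
      case empty
      then show ?case using C Cn by simp
    next
      case (insert i F)
      have "C \<inter> (\<Inter>i\<in>insert i F. K i) = (C \<inter> (\<Inter>i\<in>F. K i)) \<inter> K i" by blast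
      then show ?case
        using uni[OF _ K, of "C \<inter> (\<Inter>i\<in>F. K i)" i] insert.IH nz E.submodule_Int[OF _ K] by auto
    qed
    moreover have "finite (supp E' (h x))" using hx by (simp add: direct_power_carrier)
    ultimately have D: "submodule (C \<inter> (\<Inter>i\<in>supp E' (h x). K i)) R E"
      "C \<inter> (\<Inter>i\<in>supp E' (h x). K i) \<noteq> {\<zero>\<^bsub>E\<^esub>}" by blast+
    then obtain y where y': "y \<in> C \<inter> (\<Inter>i\<in>supp E' (h x). K i)" "y \<noteq> \<zero>\<^bsub>E\<^esub>"
      using E.submodule_zero[OF D(1)] by (metis insertI1 singletonI subsetI subset_singletonD empty_iff)
    then have y: "y \<in> C" "\<And>i. i \<in> supp E' (h x) \<Longrightarrow> y \<in> K i" "y \<noteq> \<zero>\<^bsub>E\<^esub>" by auto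
    then obtain a where a: "a \<in> carrier R" "y = a \<odot>\<^bsub>E\<^esub> x" by (auto simp: C_def)
    have "h y i = \<zero>\<^bsub>E'\<^esub>" for i
    proof (cases "i \<in> supp E' (h x)")
      case True
      then show ?thesis using y(2) by (simp add: K_def)
    next
      case False
      then show ?thesis using h.smult[OF a(1) x(1)] a by (simp add: supp_def)
    qed
    then have "h y = \<zero>\<^bsub>direct_power X E'\<^esub>" by auto
    then show False using h(2) y(3) a x(1) h.inj_iff by auto
  qed
  then obtain i where i: "K i = {\<zero>\<^bsub>E\<^esub>}" by blast
  let ?p = "\<lambda>x. h x i"
  have inj: "inj_on ?p (carrier E)"
    unfolding lmodule_hom.inj_iff[OF p'] using i by (auto simp: K_def)
  have sub: "submodule (?p ` carrier E) R E'" by (rule lmodule_hom.submodule_image[OF p']) simp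
  have "baer R (E'\<lparr>carrier := ?p ` carrier E\<rparr>)"
    by (rule baer_iso[OF E(1) E'.submodule_left_module[OF sub] lmod_iso_image[OF p inj]])
  moreover have "?p ` carrier E \<noteq> {\<zero>\<^bsub>E'\<^esub>}"
    using x inj lmodule_hom.inj_iff[OF p'] by blast
  ultimately have "?p ` carrier E = carrier E'"
    using E'.indecomposable_baer_submodule_eq[OF E'(2) sub] by blast
  then show ?thesis using inj p unfolding lmod_iso_def bij_betw_def by blast
qed

section \<open>The character module of a ring\<close>

text \<open>Baer's criterion over the integers yields the extension of characters of abelian groups.\<close>

definition integer_ring :: "int ring" where
  "integer_ring = \<lparr>carrier = UNIV, mult = (*), one = 1, zero = 0, add = (+)\<rparr>"

lemma integer_ring_simps [simp]:
  "carrier integer_ring = UNIV" "x \<otimes>\<^bsub>integer_ring\<^esub> y = x * y" "\<one>\<^bsub>integer_ring\<^esub> = 1"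
  "\<zero>\<^bsub>integer_ring\<^esub> = 0" "x \<oplus>\<^bsub>integer_ring\<^esub> y = x + y"
  by (simp_all add: integer_ring_def)

definition int_module :: "('r, 'x) ring_scheme \<Rightarrow> (int, 'r) module" where
  "int_module R = \<lparr>carrier = carrier R, mult = undefined, one = undefined, zero = zero R, add = add R,
    smult = add_pow R\<rparr>"

lemma int_module_simps [simp]:
  "carrier (int_module R) = carrier R" "zero (int_module R) = zero R"
  "add (int_module R) = add R" "smult (int_module R) = add_pow R"
  by (simp_all add: int_module_def)

lemma ring_int: "ring integer_ring"
  by (intro ringI abelian_groupI monoidI) (auto simp: algebra_simps intro: exI[of _ "- x" for x] left_minus)

lemma add_pow_int_zero [simp]: "[(0::int)] \<cdot>\<^bsub>R\<^esub> x = \<zero>\<^bsub>R\<^esub>"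
  by (simp add: add_pow_def)

lemma left_module_int_module:
  assumes "ring R" shows "left_module integer_ring (int_module R)"
proof -
  interpret R: ring R by fact
  show ?thesis
    by (rule left_moduleI_smult_zero[OF ring_int])
      (auto simp: R.a_ac R.add.int_pow_mult R.add.int_pow_distrib R.add.int_pow_pow mult.commute)
qed

definition nonzero_complex :: "(int, complex) module" where
  "nonzero_complex = \<lparr>carrier = - {0}, mult = undefined, one = undefined, zero = 1, add = (*),
    smult = (\<lambda>n z. z powi n)\<rparr>"

lemma nonzero_complex_simps [simp]:
  "carrier nonzero_complex = - {0}" "\<zero>\<^bsub>nonzero_complex\<^esub> = 1"
  "x \<oplus>\<^bsub>nonzero_complex\<^esub> y = x * y" "n \<odot>\<^bsub>nonzero_complex\<^esub> x = x powi n"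
  by (simp_all add: nonzero_complex_def)

lemma left_module_nonzero_complex: "left_module integer_ring nonzero_complex"
  by (rule left_moduleI_smult_zero[OF ring_int])
    (auto simp: power_int_add power_int_mult_distrib power_int_mult[symmetric] mult.commute)

lemma left_ideal_int_principal:
  assumes "left_ideal I integer_ring"
  obtains d :: nat where "I = {n. int d dvd n}"
proof -
  have I: "0 \<in> I" "\<And>x y. x \<in> I \<Longrightarrow> y \<in> I \<Longrightarrow> x + y \<in> I" "\<And>a x. x \<in> I \<Longrightarrow> a * x \<in> I"
    using assms unfolding left_ideal_iff[OF ring_int] by auto
  show ?thesis
  proof (cases "\<exists>d::nat. 0 < d \<and> int d \<in> I")
    case False
    have "n = 0" if "n \<in> I" for n
    proof (rule ccontr)
      assume "n \<noteq> 0"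
      moreover have "sgn n * n = \<bar>n\<bar>" by (simp add: sgn_if abs_if)
      then have "\<bar>n\<bar> \<in> I" using I(3)[OF that, of "sgn n"] by simp
      ultimately show False using False by (auto dest: spec[of _ "nat \<bar>n\<bar>"])
    qed
    then have "I = {n. int 0 dvd n}" using I(1) by auto
    then show ?thesis by (rule that)
  next
    case True
    define d where "d = (LEAST d. 0 < d \<and> int d \<in> I)"
    have d: "0 < d" "int d \<in> I" using LeastI_ex[OF True] by (auto simp: d_def)
    have least: "d \<le> e" if "0 < e" "int e \<in> I" for e
      unfolding d_def using that by (intro Least_le) auto
    have "int d dvd n" if "n \<in> I" for n
    proof -
      have "n mod int d = n + (- (n div int d)) * int d" by (simp add: minus_div_mult_eq_mod)
      then have "n mod int d \<in> I" using I(2)[OF that I(3)[OF d(2)]] by metis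
      moreover have "0 \<le> n mod int d" "n mod int d < int d" using d(1) by auto
      ultimately have "n mod int d = 0" using least[of "nat (n mod int d)"] by (cases "n mod int d = 0") auto
      then show ?thesis by auto
    qed
    then have "I = {n. int d dvd n}" using I(3)[OF d(2)] by (auto simp: dvd_def mult.commute)
    then show ?thesis by (rule that)
  qed
qed

lemma complex_nth_root_exists:
  fixes z :: complex assumes "0 < n" obtains w where "w ^ n = z"
proof
  show "rcis (root n (norm z)) (Arg z / n) ^ n = z"
    using assms by (simp add: DeMoivre2 rcis_cmod_Arg real_root_pow_pos2)
qed

text \<open>Ideals of the integers are principal, so the equations reduce to the extraction of one root.\<close>

lemma baer_nonzero_complex: "baer integer_ring nonzero_complex"
  unfolding baer_def
proof (intro conjI left_module_nonzero_complex allI impI; elim conjE)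
  fix I :: "int set" and f
  assume I: "left_ideal I integer_ring" and f: "f \<in> lmod_hom integer_ring (ideal_module integer_ring I) nonzero_complex"
  obtain d where d: "I = {n. int d dvd n}" using left_ideal_int_principal[OF I] .
  have fd: "f (int d) \<noteq> 0" using lmod_hom_closed[OF f, of "int d"] by (simp add: d)
  have fm: "f (k * int d) = f (int d) powi k" for k
    using lmod_hom_smult[OF f, of k "int d"] by (simp add: d)
  obtain w where w: "w \<noteq> 0" "w ^ d = f (int d)"
  proof (cases "d = 0")
    case True
    then have "f (int d) = 1" using fm[of 0] by simp
    then show ?thesis using that[of 1] True by simp
  next
    case False
    then obtain w where w: "w ^ d = f (int d)" using complex_nth_root_exists[of d] by blast
    then show ?thesis using that[of w] False fd by (metis gr0I power_0_left)
  qed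
  have "f n = w powi n" if n: "n \<in> I" for n
  proof -
    obtain k where k: "n = k * int d" using n by (auto simp: d dvd_def mult.commute)
    show ?thesis using w fm[of k] by (simp add: k power_int_mult mult.commute[of k])
  qed
  then show "\<exists>y\<in>carrier nonzero_complex. \<forall>a\<in>I. f a = a \<odot>\<^bsub>nonzero_complex\<^esub> y"
    using w by auto
qed

text \<open>The characters of the additive group of the ring, with values in the nonzero complex numbers.
  That group is divisible and has roots of unity of every order, so it can replace the rationals
  modulo the integers. Characters are normalised to \<open>1\<close> outside the carrier, so that the elements of
  the module are equal when they agree on the carrier.\<close>

definition character_module :: "('r, 'x) ring_scheme \<Rightarrow> ('r, 'r \<Rightarrow> complex) module" where
  "character_module R = \<lparr>carrier = {\<chi>. (\<forall>x\<in>carrier R. \<chi> x \<noteq> 0) \<and>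
      (\<forall>x\<in>carrier R. \<forall>y\<in>carrier R. \<chi> (x \<oplus>\<^bsub>R\<^esub> y) = \<chi> x * \<chi> y) \<and> (\<forall>x. x \<notin> carrier R \<longrightarrow> \<chi> x = 1)},
    mult = undefined, one = undefined, zero = (\<lambda>x. 1), add = (\<lambda>\<chi> \<psi> x. \<chi> x * \<psi> x),
    smult = (\<lambda>r \<chi> x. if x \<in> carrier R then \<chi> (x \<otimes>\<^bsub>R\<^esub> r) else 1)\<rparr>"

lemma character_module_simps [simp]:
  "\<chi> \<in> carrier (character_module R) \<longleftrightarrow> (\<forall>x\<in>carrier R. \<chi> x \<noteq> 0) \<and>
    (\<forall>x\<in>carrier R. \<forall>y\<in>carrier R. \<chi> (x \<oplus>\<^bsub>R\<^esub> y) = \<chi> x * \<chi> y) \<and> (\<forall>x. x \<notin> carrier R \<longrightarrow> \<chi> x = 1)"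
  "\<zero>\<^bsub>character_module R\<^esub> = (\<lambda>x. 1)"
  "\<chi> \<oplus>\<^bsub>character_module R\<^esub> \<psi> = (\<lambda>x. \<chi> x * \<psi> x)"
  "r \<odot>\<^bsub>character_module R\<^esub> \<chi> = (\<lambda>x. if x \<in> carrier R then \<chi> (x \<otimes>\<^bsub>R\<^esub> r) else 1)"
  by (simp_all add: character_module_def)

lemma left_module_character_module:
  assumes "ring R" shows "left_module R (character_module R)"
proof -
  interpret R: ring R by fact
  have z: "\<chi> \<zero>\<^bsub>R\<^esub> = 1" if "\<chi> \<in> carrier (character_module R)" for \<chi>
  proof -
    have "\<chi> (\<zero>\<^bsub>R\<^esub> \<oplus>\<^bsub>R\<^esub> \<zero>\<^bsub>R\<^esub>) = \<chi> \<zero>\<^bsub>R\<^esub> * \<chi> \<zero>\<^bsub>R\<^esub>" "\<chi> \<zero>\<^bsub>R\<^esub> \<noteq> 0"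
      using that unfolding character_module_simps(1) by blast+
    then show ?thesis by simp
  qed
  show ?thesis
  proof (rule left_moduleI_smult_zero[OF R.ring_axioms])
    fix \<chi> assume \<chi>: "\<chi> \<in> carrier (character_module R)"
    show "\<zero>\<^bsub>R\<^esub> \<odot>\<^bsub>character_module R\<^esub> \<chi> = \<zero>\<^bsub>character_module R\<^esub>"
      using z[OF \<chi>] by (auto simp: fun_eq_iff)
  qed (auto simp: fun_eq_iff R.l_distr R.r_distr R.m_assoc ac_simps)
qed

lemma additive_int_hom:
  assumes "ring R" and h: "h \<in> lmod_hom integer_ring (int_module R) nonzero_complex"
  shows "(\<lambda>x. if x \<in> carrier R then h x else 1) \<in> carrier (character_module R)"
proof -
  interpret R: ring R by fact
  show ?thesis using lmod_hom_closed[OF h] lmod_hom_add[OF h] by auto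
qed

text \<open>A homomorphism \<open>f\<close> from a left ideal into the character module amounts to the character
  \<open>a \<mapsto> f a 1\<close> of that ideal, and a solution of the equations amounts to an extension of this
  character to the ring.\<close>

lemma baer_character_module:
  assumes R: "ring R" shows "baer R (character_module R)"
  unfolding baer_def
proof (intro conjI left_module_character_module R allI impI; elim conjE)
  interpret R: ring R by fact
  let ?D = "nonzero_complex" and ?C = "character_module R"
  interpret D: left_module integer_ring ?D by (rule left_module_nonzero_complex)
  interpret Z: left_module integer_ring "int_module R" by (rule left_module_int_module[OF R])
  interpret P: left_module integer_ring "prod_module (int_module R) ?D"
    by (intro left_module_prod_module D.left_module_axioms Z.left_module_axioms)
  fix I f assume I: "left_ideal I R" and f: "f \<in> lmod_hom R (ideal_module R I) ?C"
  have I': "I \<subseteq> carrier R" "\<zero>\<^bsub>R\<^esub> \<in> I" "\<And>x y. x \<in> I \<Longrightarrow> y \<in> I \<Longrightarrow> x \<oplus>\<^bsub>R\<^esub> y \<in> I"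
    "\<And>a x. a \<in> carrier R \<Longrightarrow> x \<in> I \<Longrightarrow> a \<otimes>\<^bsub>R\<^esub> x \<in> I"
    using I unfolding left_ideal_iff[OF R] by auto
  interpret li: left_ideal I R by fact
  define \<phi> where "\<phi> a = f a \<one>\<^bsub>R\<^esub>" for a
  have f_app: "f a x = \<phi> (x \<otimes>\<^bsub>R\<^esub> a)" if "a \<in> I" "x \<in> carrier R" for a x
    using lmod_hom_smult[OF f, of x a] that I'(1) by (auto simp: \<phi>_def)
  have \<phi>_add: "\<phi> (a \<oplus>\<^bsub>R\<^esub> b) = \<phi> a * \<phi> b" if "a \<in> I" "b \<in> I" for a b
    using lmod_hom_add[OF f, of a b] that by (simp add: \<phi>_def)
  have \<phi>_nz: "\<phi> a \<noteq> 0" if "a \<in> I" for a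
    using lmod_hom_closed[OF f, of a] that by (simp add: \<phi>_def)
  have \<phi>0: "\<phi> \<zero>\<^bsub>R\<^esub> = 1" using \<phi>_add[OF I'(2) I'(2)] \<phi>_nz[OF I'(2)] by simp
  have \<phi>_nat: "[n] \<cdot>\<^bsub>R\<^esub> a \<in> I \<and> \<phi> ([n] \<cdot>\<^bsub>R\<^esub> a) = \<phi> a ^ n" if a: "a \<in> I" for a and n :: nat
    by (induction n) (use a I' \<phi>0 in \<open>auto simp: \<phi>_add\<close>)
  have \<phi>_neg: "\<phi> (\<ominus>\<^bsub>R\<^esub> a) = inverse (\<phi> a)" if "a \<in> I" for a
    using \<phi>_add[of a "\<ominus>\<^bsub>R\<^esub> a"] that I'(1) li.a_inv_closed[OF that] \<phi>0 \<phi>_nz[OF that]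
    by (auto simp: R.r_neg subsetD field_simps)
  have \<phi>_int: "[n] \<cdot>\<^bsub>R\<^esub> a \<in> I \<and> \<phi> ([n] \<cdot>\<^bsub>R\<^esub> a) = \<phi> a powi n" if a: "a \<in> I" for a and n :: int
  proof (cases "n \<ge> 0")
    case True
    then show ?thesis using \<phi>_nat[OF a] by (simp add: add_pow_int_ge power_int_def)
  next
    case False
    then show ?thesis using \<phi>_nat[OF a] \<phi>_neg[of "[nat (- n)] \<cdot>\<^bsub>R\<^esub> a"] li.a_inv_closed
      by (simp add: add_pow_int_lt power_int_def power_inverse)
  qed
  have "submodule ((\<lambda>a. (a, \<phi> a)) ` I) integer_ring (prod_module (int_module R) ?D)"
    unfolding P.submodule_iff
    using I' \<phi>_nz \<phi>0 \<phi>_add \<phi>_int by (auto simp: image_iff)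
  moreover have "m = \<zero>\<^bsub>?D\<^esub>" if "(\<zero>\<^bsub>int_module R\<^esub>, m) \<in> (\<lambda>a. (a, \<phi> a)) ` I" for m
    using that \<phi>0 by auto
  ultimately obtain h where h: "h \<in> lmod_hom integer_ring (int_module R) ?D"
      "\<And>b m. (b, m) \<in> (\<lambda>a. (a, \<phi> a)) ` I \<Longrightarrow> h b = m"
    using baer_extend_graph[OF baer_nonzero_complex Z.left_module_axioms] by blast
  let ?y = "\<lambda>x. if x \<in> carrier R then h x else 1"
  have "?y \<in> carrier ?C" by (rule additive_int_hom[OF R h(1)])
  moreover have "f a = a \<odot>\<^bsub>?C\<^esub> ?y" if a: "a \<in> I" for a
  proof
    fix x
    have "h (x \<otimes>\<^bsub>R\<^esub> a) = \<phi> (x \<otimes>\<^bsub>R\<^esub> a)" if "x \<in> carrier R"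
      using h(2) I'(4)[OF that a] by blast
    then show "f a x = (a \<odot>\<^bsub>?C\<^esub> ?y) x"
      using f_app[OF a] a I'(1) lmod_hom_closed[OF f, of a] by auto
  qed
  ultimately show "\<exists>y\<in>carrier ?C. \<forall>a\<in>I. f a = a \<odot>\<^bsub>?C\<^esub> y" by blast
qed

text \<open>The character module is a cogenerator. A character that is trivial on \<open>I\<close> and maps \<open>a\<close> to
  \<open>z\<close> exists on the group generated by \<open>I\<close> and \<open>a\<close> as soon as the order of \<open>z\<close> divides that of \<open>a\<close>
  modulo \<open>I\<close>; if the latter is infinite, every \<open>z\<close> will do.\<close>

lemma character_separates:
  assumes R: "ring R" and I: "left_ideal I R" and a: "a \<in> carrier R" "a \<notin> I"
  obtains \<chi> where "\<chi> \<in> carrier (character_module R)"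
    "\<And>r. r \<in> I \<Longrightarrow> r \<odot>\<^bsub>character_module R\<^esub> \<chi> = \<zero>\<^bsub>character_module R\<^esub>"
    "a \<odot>\<^bsub>character_module R\<^esub> \<chi> \<noteq> \<zero>\<^bsub>character_module R\<^esub>"
proof -
  interpret R: ring R by fact
  interpret li: left_ideal I R by fact
  let ?D = "nonzero_complex" and ?C = "character_module R"
  interpret D: left_module integer_ring ?D by (rule left_module_nonzero_complex)
  interpret Z: left_module integer_ring "int_module R" by (rule left_module_int_module[OF R])
  interpret P: left_module integer_ring "prod_module (int_module R) ?D"
    by (intro left_module_prod_module D.left_module_axioms Z.left_module_axioms)
  have I': "\<And>i. i \<in> I \<Longrightarrow> i \<in> carrier R" "\<zero>\<^bsub>R\<^esub> \<in> I" "\<And>x y. x \<in> I \<Longrightarrow> y \<in> I \<Longrightarrow> x \<oplus>\<^bsub>R\<^esub> y \<in> I"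
    "\<And>a x. a \<in> carrier R \<Longrightarrow> x \<in> I \<Longrightarrow> a \<otimes>\<^bsub>R\<^esub> x \<in> I"
    using I unfolding left_ideal_iff[OF R] by auto
  have I_int: "[n] \<cdot>\<^bsub>R\<^esub> i \<in> I" if "i \<in> I" for i and n :: int
  proof -
    have "[n] \<cdot>\<^bsub>R\<^esub> i = ([n] \<cdot>\<^bsub>R\<^esub> \<one>\<^bsub>R\<^esub>) \<otimes>\<^bsub>R\<^esub> i"
      using I'(1)[OF that] by (simp add: R.add_pow_ldistr_int)
    then show ?thesis using I'(4)[OF _ that] by simp
  qed
  have "left_ideal {n. [n] \<cdot>\<^bsub>R\<^esub> a \<in> I} integer_ring"
    unfolding left_ideal_iff[OF ring_int]
  proof (intro conjI ballI)
    fix k n :: int assume "n \<in> {n. [n] \<cdot>\<^bsub>R\<^esub> a \<in> I}"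
    then have "[k] \<cdot>\<^bsub>R\<^esub> ([n] \<cdot>\<^bsub>R\<^esub> a) \<in> I" using I_int by simp
    then show "k \<otimes>\<^bsub>integer_ring\<^esub> n \<in> {n. [n] \<cdot>\<^bsub>R\<^esub> a \<in> I}"
      using a(1) by (simp add: R.add.int_pow_pow mult.commute)
  qed (use I'(2,3) a(1) in \<open>auto simp: R.add.int_pow_mult\<close>)
  then obtain d where d: "{n. [n] \<cdot>\<^bsub>R\<^esub> a \<in> I} = {n. int d dvd n}" using left_ideal_int_principal by blast
  have d1: "d \<noteq> 1"
  proof
    assume "d = 1"
    then have "[(1::int)] \<cdot>\<^bsub>R\<^esub> a \<in> I" using d by auto
    then show False using a by simp
  qed
  obtain z :: complex where z: "z \<noteq> 0" "z \<noteq> 1" "z ^ d = 1"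
  proof (cases "d = 0")
    case True
    then show ?thesis using that[of 2] by simp
  next
    case False
    then have d2: "2 \<le> d" using d1 by simp
    have "cos (2 * pi / d) < 1"
      using d2 cos_monotone_0_pi[of 0 "2 * pi / d"] by (simp add: field_simps)
    then have "cis (2 * pi / d) \<noteq> 1" by (metis cis.sel(1) one_complex.sel(1) less_irrefl)
    moreover have "cis (2 * pi / d) ^ d = 1" using False by (simp add: DeMoivre)
    ultimately show ?thesis using that[of "cis (2 * pi / d)"] by simp
  qed
  have zI: "z powi n = 1" if "[n] \<cdot>\<^bsub>R\<^esub> a \<in> I" for n :: int
  proof -
    have "int d dvd n" using d that by auto
    then obtain k where "n = int d * k" by (auto simp: dvd_def)
    then show ?thesis using z by (simp add: power_int_mult)
  qed
  \<comment> \<open>By \<open>zI\<close> this is the graph of a homomorphism that is \<open>1\<close> on \<open>I\<close> and \<open>z\<close> at \<open>a\<close>.\<close>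
  let ?T = "{(i \<oplus>\<^bsub>R\<^esub> [n] \<cdot>\<^bsub>R\<^esub> a, z powi n) | i (n :: int). i \<in> I}"
  have "submodule ?T integer_ring (prod_module (int_module R) ?D)"
    unfolding P.submodule_iff
  proof (intro conjI ballI)
    show "?T \<subseteq> carrier (prod_module (int_module R) ?D)" using a(1) z(1) I'(1) by auto
    have "(\<zero>\<^bsub>R\<^esub> \<oplus>\<^bsub>R\<^esub> [(0::int)] \<cdot>\<^bsub>R\<^esub> a, z powi 0) \<in> ?T" using I'(2) by blast
    then show "\<zero>\<^bsub>prod_module (int_module R) ?D\<^esub> \<in> ?T" by simp
  next
    fix u v assume "u \<in> ?T" "v \<in> ?T"
    then obtain i n j m where *: "i \<in> I" "j \<in> I" "u = (i \<oplus>\<^bsub>R\<^esub> [(n::int)] \<cdot>\<^bsub>R\<^esub> a, z powi n)"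
      "v = (j \<oplus>\<^bsub>R\<^esub> [(m::int)] \<cdot>\<^bsub>R\<^esub> a, z powi m)" by blast
    have "u \<oplus>\<^bsub>prod_module (int_module R) ?D\<^esub> v = ((i \<oplus>\<^bsub>R\<^esub> j) \<oplus>\<^bsub>R\<^esub> [(n + m)] \<cdot>\<^bsub>R\<^esub> a, z powi (n + m))"
      using * a(1) z(1) I'(1) by (simp add: R.add.int_pow_mult R.a_ac power_int_add)
    then show "u \<oplus>\<^bsub>prod_module (int_module R) ?D\<^esub> v \<in> ?T" using * I'(3) by blast
  next
    fix k u assume "k \<in> carrier integer_ring" "u \<in> ?T"
    then obtain i n where *: "i \<in> I" "u = (i \<oplus>\<^bsub>R\<^esub> [(n::int)] \<cdot>\<^bsub>R\<^esub> a, z powi n)" by blast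
    have "k \<odot>\<^bsub>prod_module (int_module R) ?D\<^esub> u = ([k] \<cdot>\<^bsub>R\<^esub> i \<oplus>\<^bsub>R\<^esub> [(n * k)] \<cdot>\<^bsub>R\<^esub> a, z powi (n * k))"
      using * a(1) I'(1)
      by (simp add: R.add.int_pow_distrib R.add.int_pow_pow power_int_mult)
    then show "k \<odot>\<^bsub>prod_module (int_module R) ?D\<^esub> u \<in> ?T" using * I_int by blast
  qed
  moreover have "m = \<zero>\<^bsub>?D\<^esub>" if m: "(\<zero>\<^bsub>int_module R\<^esub>, m) \<in> ?T" for m
  proof -
    obtain i n where *: "i \<in> I" "\<zero>\<^bsub>R\<^esub> = i \<oplus>\<^bsub>R\<^esub> [(n::int)] \<cdot>\<^bsub>R\<^esub> a" "m = z powi n" using m by auto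
    have "[n] \<cdot>\<^bsub>R\<^esub> a = \<ominus>\<^bsub>R\<^esub> i"
      using * a(1) I'(1) R.a_comm R.minus_equality[of "[n] \<cdot>\<^bsub>R\<^esub> a" i] by simp
    then show ?thesis using zI *(1,3) by simp
  qed
  ultimately obtain h where h: "h \<in> lmod_hom integer_ring (int_module R) ?D" "\<And>b m. (b, m) \<in> ?T \<Longrightarrow> h b = m"
    using baer_extend_graph[OF baer_nonzero_complex Z.left_module_axioms, of ?T] by blast
  have hI: "h i = 1" if "i \<in> I" for i
  proof -
    have "i = i \<oplus>\<^bsub>R\<^esub> [(0::int)] \<cdot>\<^bsub>R\<^esub> a" "1 = z powi 0" using that I'(1) by auto
    then show ?thesis using h(2)[of i 1] that by blast
  qed
  have ha: "h a = z"
  proof -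
    have "a = \<zero>\<^bsub>R\<^esub> \<oplus>\<^bsub>R\<^esub> [(1::int)] \<cdot>\<^bsub>R\<^esub> a" "z = z powi 1" using a by auto
    then show ?thesis using h(2)[of a z] I'(2) by blast
  qed
  let ?y = "\<lambda>x. if x \<in> carrier R then h x else 1"
  show ?thesis
  proof (rule that)
    show "?y \<in> carrier ?C" by (rule additive_int_hom[OF R h(1)])
    show "r \<odot>\<^bsub>?C\<^esub> ?y = \<zero>\<^bsub>?C\<^esub>" if "r \<in> I" for r
      using I'(1,4) that hI by auto
    have "(a \<odot>\<^bsub>?C\<^esub> ?y) \<one>\<^bsub>R\<^esub> = z" using a ha by simp
    then show "a \<odot>\<^bsub>?C\<^esub> ?y \<noteq> \<zero>\<^bsub>?C\<^esub>" using z(2) unfolding character_module_simps(2) by metis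
  qed
qed

declare character_module_simps [simp del]

section \<open>Cardinalities\<close>

lemma card_of_image_le: "|A| \<le>o r \<Longrightarrow> |f ` A| \<le>o r"
  using card_of_image ordLeq_transitive by blast

lemma card_of_subset_le: "A \<subseteq> B \<Longrightarrow> |B| \<le>o r \<Longrightarrow> |A| \<le>o r"
  using card_of_mono1 ordLeq_transitive by blast

lemma card_of_inj_le: "inj_on f A \<Longrightarrow> f ` A \<subseteq> B \<Longrightarrow> |B| \<le>o r \<Longrightarrow> |A| \<le>o r"
  using card_of_ordLeq[of A B] ordLeq_transitive by blast

lemma Times_Cinfinite_bound: "|A| \<le>o r \<Longrightarrow> |B| \<le>o r \<Longrightarrow> Cinfinite r \<Longrightarrow> |A \<times> B| \<le>o r"
  using card_of_Times_ordLeq_infinite_Field by (auto simp: cinfinite_def)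

lemma countable_Cinfinite_bound: "countable (A :: 'a set) \<Longrightarrow> Cinfinite r \<Longrightarrow> |A| \<le>o r"
proof -
  assume "countable A" "Cinfinite r"
  then obtain f :: "'a \<Rightarrow> nat" where f: "inj_on f A" by (auto simp: countable_def)
  have "|UNIV :: nat set| \<le>o r"
    using ordIso_ordLeq_trans[OF card_of_nat natLeq_ordLeq_cinfinite[OF \<open>Cinfinite r\<close>]] .
  then show "|A| \<le>o r" using card_of_inj_le[OF f] by blast
qed

lemma finite_Cinfinite_bound: "finite A \<Longrightarrow> Cinfinite r \<Longrightarrow> |A| \<le>o r"
  by (simp add: countable_Cinfinite_bound countable_finite)

lemma lists_Cinfinite_bound:
  assumes "|A| \<le>o r" "Cinfinite r" shows "|lists A| \<le>o r"
proof (cases "finite A")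
  case True
  then show ?thesis by (intro countable_Cinfinite_bound assms countable_lists countable_finite)
next
  case False
  then show ?thesis using card_of_lists_infinite assms(1) ordIso_ordLeq_trans by blast
qed

lemma Fpow_Cinfinite_bound:
  assumes "|A| \<le>o r" "Cinfinite r" shows "|Fpow A| \<le>o r"
  using card_of_Fpow_lists lists_Cinfinite_bound[OF assms] ordLeq_transitive by blast

lemma card_of_Field_eq: "Card_order r \<Longrightarrow> |Field r| =o r"
  by (rule card_of_Field_ordIso)

lemma le_Field_iff: "Card_order r \<Longrightarrow> |A| \<le>o |Field r| \<longleftrightarrow> |A| \<le>o r"
  using card_of_Field_ordIso ordLeq_ordIso_trans ordIso_symmetric by blast

lemma Cinfinite_ctwo_cexp: "Cinfinite k \<Longrightarrow> Cinfinite (ctwo ^c k)"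
  by (rule conjI[OF cinfinite_cexp[OF ordLeq_refl[OF Card_order_ctwo]] Card_order_cexp])

text \<open>The graph of an element over its support is a finite subset of \<open>X \<times> E\<close>.\<close>

lemma card_direct_power_le:
  assumes "|X| \<le>o r" "|carrier E| \<le>o r" "Cinfinite r"
  shows "|carrier (direct_power X E)| \<le>o r"
proof (rule card_of_inj_le)
  let ?g = "\<lambda>v. (\<lambda>i. (i, v i)) ` supp E v"
  show "inj_on ?g (carrier (direct_power X E))"
  proof (rule inj_onI, rule ext)
    fix v w i assume "?g v = ?g w"
    then have "(i, u) \<in> ?g v \<longleftrightarrow> (i, u) \<in> ?g w" for u by simp
    then have "v i \<noteq> \<zero>\<^bsub>E\<^esub> \<and> u = v i \<longleftrightarrow> w i \<noteq> \<zero>\<^bsub>E\<^esub> \<and> u = w i" for u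
      by (auto simp: supp_def image_iff)
    then show "v i = w i" by metis
  qed
  show "?g ` carrier (direct_power X E) \<subseteq> Fpow (X \<times> carrier E)"
    by (rule image_subsetI) (simp add: direct_power_carrier, auto simp: Fpow_def)
  show "|Fpow (X \<times> carrier E)| \<le>o r"
    by (intro Fpow_Cinfinite_bound Times_Cinfinite_bound assms)
qed

lemma (in lmodule) single_direct_power:
  assumes "e \<in> carrier M" "i \<in> X"
  shows "(\<lambda>j. if j = i then e else \<zero>\<^bsub>M\<^esub>) \<in> carrier (direct_power X M)"
proof -
  have "supp M (\<lambda>j. if j = i then e else \<zero>\<^bsub>M\<^esub>) \<subseteq> {i}" by (auto simp: supp_def)
  then show ?thesis using assms finite_subset by (fastforce simp: direct_power_carrier)
qed

lemma card_direct_power_ge: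
  assumes E: "left_module R E" and nz: "carrier E \<noteq> {\<zero>\<^bsub>E\<^esub>}"
  shows "|X| \<le>o |carrier (direct_power X E)|"
proof -
  interpret E: lmodule R E using E by (rule lmoduleI)
  obtain e where e: "e \<in> carrier E" "e \<noteq> \<zero>\<^bsub>E\<^esub>" using nz E.M.zero_closed by blast
  let ?f = "\<lambda>i j. if j = i then e else \<zero>\<^bsub>E\<^esub>"
  have "inj_on ?f X"
  proof (rule inj_onI)
    fix i i' assume "?f i = ?f i'"
    from fun_cong[OF this, of i] show "i = i'" using e(2) by (simp split: if_splits)
  qed
  moreover have "?f ` X \<subseteq> carrier (direct_power X E)" by (rule image_subsetI) (rule E.single_direct_power[OF e(1)])
  ultimately show ?thesis by (rule card_of_inj_le) (rule ordIso_imp_ordLeq[OF card_of_refl])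
qed

lemma card_direct_power:
  assumes "left_module R E" "carrier E \<noteq> {\<zero>\<^bsub>E\<^esub>}" "|X| =o r" "|carrier E| \<le>o r" "Cinfinite r"
  shows "|carrier (direct_power X E)| =o r"
  using card_direct_power_le[OF ordIso_imp_ordLeq[OF assms(3)] assms(4,5)]
    card_direct_power_ge[OF assms(1,2), of X] assms(3)
  by (meson ordIso_iff_ordLeq ordIso_ordLeq_trans ordIso_symmetric)

text \<open>An index set of size at most \<open>k\<close> would make the power too small, and a larger index set
  has the same size as the power.\<close>

lemma card_index_of_direct_power:
  assumes E: "left_module R E" "carrier E \<noteq> {\<zero>\<^bsub>E\<^esub>}" "|carrier E| \<le>o k" "Cinfinite k"
    and r: "|carrier (direct_power X E)| =o r" "k <o r" "Card_order r"
  shows "|X| =o r"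
proof -
  have "\<not> |X| \<le>o k"
  proof
    assume "|X| \<le>o k"
    then have "|carrier (direct_power X E)| \<le>o k" by (rule card_direct_power_le[OF _ E(3,4)])
    then have "r \<le>o k" using r(1) ordIso_ordLeq_trans ordIso_symmetric by blast
    then show False using r(2) not_ordLess_ordLeq by blast
  qed
  then have k: "k \<le>o |X|"
    using E(4) card_of_Well_order by (metis ordLeq_total card_order_on_well_order_on)
  then have "Cinfinite |X|" using E(4) cinfinite_mono card_of_Card_order by blast
  then have "|carrier (direct_power X E)| \<le>o |X|"
    using card_direct_power_le[of X "|X|" E] ordLeq_transitive[OF E(3) k] card_of_refl
      ordIso_imp_ordLeq by blast
  then have "|X| =o |carrier (direct_power X E)|"
    using card_direct_power_ge[OF E(1,2), of X] by (simp add: ordIso_iff_ordLeq)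
  then show ?thesis using r(1) ordIso_transitive by blast
qed

text \<open>A character is determined by the rational numbers below the real and imaginary parts of its
  values.\<close>

lemma card_character_module:
  assumes "|carrier R| \<le>o k" "Cinfinite k"
  shows "|carrier (character_module R)| \<le>o ctwo ^c k"
proof -
  have "|carrier R \<times> (UNIV :: (bool \<times> rat) set)| \<le>o |Field k|"
    unfolding le_Field_iff[OF conjunct2[OF assms(2)]]
    by (intro Times_Cinfinite_bound assms countable_Cinfinite_bound) simp
  then obtain p where p: "inj_on p (carrier R \<times> (UNIV :: (bool \<times> rat) set))"
    "p ` (carrier R \<times> (UNIV :: (bool \<times> rat) set)) \<subseteq> Field k"
    unfolding card_of_ordLeq[symmetric] by blast
  define G where "G \<chi> = {(x, re, q). x \<in> carrier R \<and>
    real_of_rat q < (if re then Re (\<chi> x) else Im (\<chi> x))}" for \<chi>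
  have real_eq: "a = b" if "\<And>q. real_of_rat q < a \<longleftrightarrow> real_of_rat q < b" for a b
  proof (rule antisym)
    show "a \<le> b" using that of_rat_dense[of b a] by (meson less_asym not_le)
    show "b \<le> a" using that of_rat_dense[of a b] by (meson less_asym not_le)
  qed
  have "|Pow (Field k)| =o ctwo ^c k"
    using card_of_Pow_Func[of "Field k"] by (simp add: cexp_def ctwo_def Field_card_of)
  moreover have "inj_on (\<lambda>\<chi>. p ` G \<chi>) (carrier (character_module R))"
  proof (rule inj_onI)
    fix \<chi> \<psi> assume c: "\<chi> \<in> carrier (character_module R)" "\<psi> \<in> carrier (character_module R)"
      "p ` G \<chi> = p ` G \<psi>"
    have "G \<chi> \<subseteq> carrier R \<times> UNIV" "G \<psi> \<subseteq> carrier R \<times> UNIV" by (auto simp: G_def)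
    then have "G \<chi> = G \<psi>" using inj_on_image_eq_iff[OF p(1)] c(3) by blast
    then have G: "(x, re, q) \<in> G \<chi> \<longleftrightarrow> (x, re, q) \<in> G \<psi>" for x re q by simp
    have "\<chi> x = \<psi> x" if "x \<in> carrier R" for x
      using that G[of x True] G[of x False] by (intro complex_eqI real_eq) (simp_all add: G_def)
    moreover have "\<chi> x = \<psi> x" if "x \<notin> carrier R" for x
      using c(1,2) that by (simp add: character_module_simps)
    ultimately show "\<chi> = \<psi>" by blast
  qed
  moreover have "(\<lambda>\<chi>. p ` G \<chi>) ` carrier (character_module R) \<subseteq> Pow (Field k)"
    using p(2) by (auto simp: G_def)
  ultimately show ?thesis using card_of_inj_le[OF _ _ ordIso_imp_ordLeq] by blast
qed

text \<open>Hausdorff's formula for the exponent \<open>k\<close> and the successor of \<open>2^k\<close>: by regularity every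
  function from \<open>k\<close> into that successor is bounded.\<close>

lemma card_Func_cardSuc:
  assumes k: "Cinfinite k" and B: "|B| \<le>o cardSuc (ctwo ^c k)"
  shows "|Func (Field k) B| \<le>o cardSuc (ctwo ^c k)"
proof -
  let ?t = "ctwo ^c k" and ?m = "cardSuc (ctwo ^c k)"
  have t: "Cinfinite ?t"
    by (rule Cinfinite_ctwo_cexp[OF k])
  have m: "Cinfinite ?m" by (rule Cinfinite_cardSuc[OF t])
  have tm: "?t \<le>o ?m" using t by (simp add: cardSuc_ordLeq)
  have kt: "k \<le>o ?t" by (rule ordLess_imp_ordLeq[OF ordLess_ctwo_cexp[OF conjunct2[OF k]]])
  have wm: "wo_rel ?m" using m by (simp add: wo_rel_def card_order_on_well_order_on)
  have sub: "Func (Field k) (Field ?m) \<subseteq> (\<Union>\<alpha>\<in>Field ?m. Func (Field k) (under ?m \<alpha>))"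
  proof
    fix f assume f: "f \<in> Func (Field k) (Field ?m)"
    have "trans ?m" using wo_rel.TRANS[OF wm] .
    then have "relChain ?m (under ?m)" by (auto simp: relChain_def under_def dest: transD)
    moreover have "f ` Field k \<subseteq> (\<Union>\<alpha>\<in>Field ?m. under ?m \<alpha>)"
    proof
      fix y assume "y \<in> f ` Field k"
      then have "y \<in> Field ?m" using f by (auto simp: Func_def)
      then show "y \<in> (\<Union>\<alpha>\<in>Field ?m. under ?m \<alpha>)"
        using wo_rel.REFL[OF wm] Refl_under_in by fastforce
    qed
    moreover have "|f ` Field k| \<le>o ?t"
      by (rule card_of_image_le) (rule ordIso_ordLeq_trans[OF card_of_Field_eq[OF conjunct2[OF k]] kt])
    ultimately obtain \<alpha> where "\<alpha> \<in> Field ?m" "f ` Field k \<subseteq> under ?m \<alpha>"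
      using cardSuc_UNION[of ?t "under ?m" "f ` Field k"] t unfolding cinfinite_def by blast
    then show "f \<in> (\<Union>\<alpha>\<in>Field ?m. Func (Field k) (under ?m \<alpha>))"
      using f by (auto simp: Func_def)
  qed
  have "|Func (Field k) (under ?m \<alpha>)| \<le>o ?m" if \<alpha>: "\<alpha> \<in> Field ?m" for \<alpha>
  proof -
    have "|underS ?m \<alpha>| <o ?m" by (rule card_of_underS[OF conjunct2[OF m] \<alpha>])
    then have "|underS ?m \<alpha>| \<le>o ?t"
      by (rule cardSuc_ordLeq_ordLess[OF conjunct2[OF t] card_of_Card_order, THEN iffD1])
    then have un: "|underS ?m \<alpha> \<union> {\<alpha>}| \<le>o ?t"
      by (rule Un_Cinfinite_bound[OF _ finite_Cinfinite_bound[OF _ t] t]) simp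
    have u: "|under ?m \<alpha>| \<le>o ?t"
      by (rule card_of_subset_le[OF _ un]) (auto simp: under_def underS_def)
    have "|under ?m \<alpha>| ^c k \<le>o ?t ^c k" by (rule cexp_mono1[OF u]) (use k in blast)
    also have "?t ^c k =o ?t"
      by (rule cexp_cprod_ordLeq[OF Card_order_ctwo k Cinfinite_Cnotzero[OF k] ordLeq_refl[OF conjunct2[OF k]]])
    also have "?t \<le>o ?m" by (rule tm)
    finally show ?thesis by (simp add: cexp_def Field_card_of)
  qed
  then have "|\<Union>\<alpha>\<in>Field ?m. Func (Field k) (under ?m \<alpha>)| \<le>o ?m"
    by (intro UNION_Cinfinite_bound[OF ordIso_imp_ordLeq[OF card_of_Field_eq[OF conjunct2[OF m]]] _ m] ballI)
  then have F: "|Func (Field k) (Field ?m)| \<le>o ?m" by (rule card_of_subset_le[OF sub])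
  have "|B| ^c k \<le>o ?m ^c k" by (rule cexp_mono1[OF B]) (use k in blast)
  then have "|Func (Field k) B| \<le>o |Func (Field k) (Field ?m)|" by (simp add: cexp_def Field_card_of)
  then show ?thesis using F by (rule ordLeq_transitive)
qed

definition small_subsets :: "'k rel \<Rightarrow> 'i set \<Rightarrow> 'i set set" where
  "small_subsets k X = {A. A \<subseteq> X \<and> |A| \<le>o k}"

lemma set_ideal_small_subsets:
  assumes "Cinfinite k" shows "set_ideal (small_subsets k X)"
  unfolding set_ideal_def
proof (intro conjI ballI allI impI)
  show "{} \<in> small_subsets k X"
    using finite_Cinfinite_bound[of "{}" k] assms by (simp add: small_subsets_def)
  show "A \<union> B \<in> small_subsets k X" if "A \<in> small_subsets k X" "B \<in> small_subsets k X" for A B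
    using that Un_Cinfinite_bound[of A k B] assms by (auto simp: small_subsets_def)
  show "B \<in> small_subsets k X" if "A \<in> small_subsets k X" "B \<subseteq> A" for A B
    using that card_of_subset_le[of B A k] by (auto simp: small_subsets_def)
qed

text \<open>A nonzero element is determined by an enumeration, indexed by \<open>k\<close>, of its graph over its
  support.\<close>

lemma card_small_support_power:
  fixes k :: "'k rel" and X :: "'i set" and E :: "('r, 'e) module"
  assumes k: "Cinfinite k" and X: "|X| \<le>o cardSuc (ctwo ^c k)"
    and E: "|carrier E| \<le>o cardSuc (ctwo ^c k)"
  shows "|carrier (supported_module (small_subsets k X) E)| \<le>o cardSuc (ctwo ^c k)"
proof -
  let ?m = "cardSuc (ctwo ^c k)"
  have m: "Cinfinite ?m"
    by (rule Cinfinite_cardSuc[OF Cinfinite_ctwo_cexp[OF k]])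
  \<comment> \<open>\<open>D\<close> decodes an enumeration of a graph.\<close>
  define D where "D g = (\<lambda>i. if \<exists>e. (i, e) \<in> g ` Field k then SOME e. (i, e) \<in> g ` Field k else \<zero>\<^bsub>E\<^esub>)"
    for g :: "'k \<Rightarrow> 'i \<times> 'e"
  have "carrier (supported_module (small_subsets k X) E) \<subseteq>
    insert (\<lambda>i. \<zero>\<^bsub>E\<^esub>) (D ` Func (Field k) (X \<times> carrier E))"
  proof
    fix v assume v: "v \<in> carrier (supported_module (small_subsets k X) E)"
    show "v \<in> insert (\<lambda>i. \<zero>\<^bsub>E\<^esub>) (D ` Func (Field k) (X \<times> carrier E))"
    proof (cases "supp E v = {}")
      case True
      then have "v = (\<lambda>i. \<zero>\<^bsub>E\<^esub>)" by (auto simp: supp_def fun_eq_iff)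
      then show ?thesis by simp
    next
      case False
      let ?G = "(\<lambda>i. (i, v i)) ` supp E v"
      have s: "supp E v \<subseteq> X" "|supp E v| \<le>o k" "\<And>i. v i \<in> carrier E"
        using v by (auto simp: supported_module_carrier small_subsets_def)
      have "|?G| \<le>o |Field k|"
        unfolding le_Field_iff[OF conjunct2[OF k]] by (rule card_of_image_le[OF s(2)])
      then obtain g where g: "g ` Field k = ?G"
        using card_of_ordLeq2[of ?G "Field k"] False by blast
      define g' where "g' x = (if x \<in> Field k then g x else undefined)" for x
      have g': "g' ` Field k = ?G" using g by (auto simp: g'_def)
      have "g' \<in> Func (Field k) (X \<times> carrier E)"
      proof -
        have "g x \<in> X \<times> carrier E" if "x \<in> Field k" for x
        proof -
          have "g x \<in> ?G" using that unfolding g[symmetric] by blast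
          then show ?thesis using s by auto
        qed
        then show ?thesis by (auto simp: Func_def g'_def)
      qed
      moreover have "D g' = v"
        unfolding D_def g' by (rule ext) (auto simp: supp_def image_iff)
      ultimately show ?thesis by blast
    qed
  qed
  moreover have "|insert (\<lambda>i. \<zero>\<^bsub>E\<^esub>) (D ` Func (Field k) (X \<times> carrier E))| \<le>o ?m"
    by (subst insert_is_Un)
 (intro Un_Cinfinite_bound finite_Cinfinite_bound m card_of_image_le card_Func_cardSuc k
        Times_Cinfinite_bound X E, simp)
  ultimately show ?thesis by (rule card_of_subset_le)
qed

text \<open>A left ideal has at most \<open>k\<close> elements, so the supports of the values of a homomorphism on it
  have a union of size at most \<open>k\<close>.\<close>

lemma baer_small_support_power:
  assumes k: "Cinfinite k" "|carrier R| \<le>o k" and E: "baer R E"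
  shows "baer R (supported_module (small_subsets k X) E)"
proof (rule baer_supported[OF E set_ideal_small_subsets[OF k(1)]])
  interpret E: left_module R E using E by (rule baer_left_module)
  fix I f assume I: "left_ideal I R"
    and f: "f \<in> lmod_hom R (ideal_module R I) (supported_module (small_subsets k X) E)"
  have "I \<subseteq> carrier R" using I left_ideal_iff[OF E.R.ring_axioms, of I] by simp
  then have Ik: "|I| \<le>o k" using k(2) by (rule card_of_subset_le)
  have s: "supp E (f a) \<subseteq> X" "|supp E (f a)| \<le>o k" if "a \<in> I" for a
    using lmod_hom_closed[OF f, of a] that by (auto simp: supported_module_carrier small_subsets_def)
  have "|\<Union>a\<in>I. supp E (f a)| \<le>o k"
    by (rule UNION_Cinfinite_bound[OF Ik ballI[OF s(2)] k(1)])
  moreover have "(\<Union>a\<in>I. supp E (f a)) \<subseteq> X" using s(1) by (rule UN_least)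
  ultimately have "(\<Union>a\<in>I. supp E (f a)) \<in> small_subsets k X" by (simp add: small_subsets_def)
  then show "\<exists>S\<in>small_subsets k X. \<forall>a\<in>I. supp E (f a) \<subseteq> S"
    by (rule bexI[rotated]) (intro ballI UN_upper)
qed

text \<open>Close a nonzero element under the operations and under a choice of solutions, in the whole
  module, of all solvable finite systems of equations \<open>a y = s\<close>. Over a noetherian ring such a
  closed set satisfies Baer's criterion, so it is a direct summand.\<close>

lemma card_indecomposable_baer:
  assumes noeth: "left_noetherian R" and E: "baer R E" "indecomposable_module R E"
    and k: "Cinfinite k" "|carrier R| \<le>o k"
  shows "|carrier E| \<le>o k"
proof -
  interpret E: lmodule R E using E by (intro lmoduleI baer_left_module)
  obtain x where x: "x \<in> carrier E" "x \<noteq> \<zero>\<^bsub>E\<^esub>"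
    using E(2) E.M.zero_closed unfolding indecomposable_module_def by blast
  define P where "P l y \<longleftrightarrow> y \<in> carrier E \<and> (\<forall>(a, s)\<in>set l. a \<odot>\<^bsub>E\<^esub> y = s)" for l y
  define sol where "sol l = (if \<exists>y. P l y then SOME y. P l y else \<zero>\<^bsub>E\<^esub>)" for l
  have sol: "P l (sol l)" if "P l y" for l y
    using someI[of "P l", OF that] that by (auto simp: sol_def)
  have solc: "sol l \<in> carrier E" for l
    using sol[of l] by (cases "\<exists>y. P l y") (auto simp: P_def sol_def)
  \<comment> \<open>One closure step. The lists encode finite systems of equations.\<close>
  define st where "st S = S \<union> (\<lambda>(s, t). s \<oplus>\<^bsub>E\<^esub> t) ` (S \<times> S) \<union>
    (\<lambda>(a, s). a \<odot>\<^bsub>E\<^esub> s) ` (carrier R \<times> S) \<union> sol ` lists (carrier R \<times> S)" for S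
  define \<Phi> where "\<Phi> n = (st ^^ n) {x}" for n
  define U where "U = (\<Union>n. \<Phi> n)"
  have \<Phi>: "\<Phi> 0 = {x}" "\<And>n. \<Phi> (Suc n) = st (\<Phi> n)" by (simp_all add: \<Phi>_def)
  have mono: "\<Phi> m \<subseteq> \<Phi> n" if "m \<le> n" for m n
    using that by (rule lift_Suc_mono_le[rotated]) (auto simp: \<Phi> st_def)
  have card: "|\<Phi> n| \<le>o k" for n
  proof (induction n)
    case 0
    show ?case unfolding \<Phi> by (rule finite_Cinfinite_bound[OF _ k(1)]) simp
  next
    case (Suc n)
    show ?case unfolding \<Phi> st_def
      by (intro Un_Cinfinite_bound card_of_image_le Times_Cinfinite_bound lists_Cinfinite_bound Suc k)
  qed
  have \<Phi>c: "\<Phi> n \<subseteq> carrier E" for n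
  proof (induction n)
    case (Suc n)
    then show ?case unfolding \<Phi> st_def using solc by auto
  qed (use x \<Phi> in auto)
  have U2: "\<exists>n. s \<in> \<Phi> n \<and> t \<in> \<Phi> n" if "s \<in> U" "t \<in> U" for s t
  proof -
    obtain m n where "s \<in> \<Phi> m" "t \<in> \<Phi> n" using \<open>s \<in> U\<close> \<open>t \<in> U\<close> by (auto simp: U_def)
    then show ?thesis using mono[of m "max m n"] mono[of n "max m n"] by auto
  qed
  have st_U: "st (\<Phi> n) \<subseteq> U" for n unfolding \<Phi>(2)[symmetric] U_def by blast
  have xU: "x \<in> U" using \<Phi>(1) by (auto simp: U_def)
  have Uadd: "s \<oplus>\<^bsub>E\<^esub> t \<in> U" if "s \<in> U" "t \<in> U" for s t
    using U2[OF that] st_U by (force simp: st_def)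
  have Usm: "a \<odot>\<^bsub>E\<^esub> s \<in> U" if "a \<in> carrier R" "s \<in> U" for a s
    using U2[OF that(2,2)] that(1) st_U by (force simp: st_def)
  have U: "submodule U R E"
    unfolding E.submodule_iff
  proof (intro conjI ballI Uadd Usm)
    show "U \<subseteq> carrier E" using \<Phi>c by (auto simp: U_def)
    show "\<zero>\<^bsub>E\<^esub> \<in> U" using Usm[OF E.R.zero_closed xU] x(1) by simp
  qed
  have "baer R (E\<lparr>carrier := U\<rparr>)"
    unfolding baer_def
  proof (intro conjI allI impI; (elim conjE)?)
    show lU: "left_module R (E\<lparr>carrier := U\<rparr>)" by (rule E.submodule_left_module[OF U])
    fix I f assume I: "left_ideal I R" and f: "f \<in> lmod_hom R (ideal_module R I) (E\<lparr>carrier := U\<rparr>)"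
    have I': "I \<subseteq> carrier R" "\<zero>\<^bsub>R\<^esub> \<in> I" "\<And>a b. a \<in> I \<Longrightarrow> b \<in> I \<Longrightarrow> a \<oplus>\<^bsub>R\<^esub> b \<in> I"
      "\<And>r a. r \<in> carrier R \<Longrightarrow> a \<in> I \<Longrightarrow> r \<otimes>\<^bsub>R\<^esub> a \<in> I"
      using I unfolding left_ideal_iff[OF E.R.ring_axioms] by auto
    have fU: "f a \<in> U" if "a \<in> I" for a using lmod_hom_closed[OF f] that by simp
    have fE: "f \<in> lmod_hom R (ideal_module R I) E"
      using lmod_hom_add[OF f] lmod_hom_smult[OF f] fU E.submodule_carrier[OF U]
      by (intro lmod_homI) auto
    then obtain y where y: "y \<in> carrier E" "\<And>a. a \<in> I \<Longrightarrow> f a = a \<odot>\<^bsub>E\<^esub> y"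
      using baerD[OF E(1) I] by metis
    obtain A where A: "finite A" "A \<subseteq> I" "\<And>J. left_ideal J R \<Longrightarrow> A \<subseteq> J \<Longrightarrow> I \<subseteq> J"
      using left_noetherian_finitely_generated[OF E.R.ring_axioms noeth I] by metis
    have "\<exists>n. f ` A \<subseteq> \<Phi> n"
    proof -
      have "\<exists>n. f a \<in> \<Phi> n" if "a \<in> A" for a using fU A(2) that by (auto simp: U_def)
      then obtain n where n: "\<And>a. a \<in> A \<Longrightarrow> f a \<in> \<Phi> (n a)" by metis
      have "f a \<in> \<Phi> (Max (n ` A))" if "a \<in> A" for a
        using n[OF that] mono[of "n a" "Max (n ` A)"] A(1) that by auto
      then show ?thesis by blast
    qed
    then obtain n where n: "f ` A \<subseteq> \<Phi> n" ..
    obtain l where l: "set l = (\<lambda>a. (a, f a)) ` A" using A(1) finite_list by (metis finite_imageI)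
    have "l \<in> lists (carrier R \<times> \<Phi> n)" using l n A(2) I'(1) by (auto simp: lists_eq_set)
    then have sU: "sol l \<in> U" using st_U[of n] by (auto simp: st_def)
    have "P l y" using l y A(2) by (auto simp: P_def)
    then have s: "f a = a \<odot>\<^bsub>E\<^esub> sol l" if "a \<in> A" for a
      using sol[of l y] l that by (auto simp: P_def)
    have "left_ideal {a \<in> I. f a = a \<odot>\<^bsub>E\<^esub> sol l} R"
      unfolding left_ideal_iff[OF E.R.ring_axioms]
    proof (intro conjI ballI)
      show "{a \<in> I. f a = a \<odot>\<^bsub>E\<^esub> sol l} \<subseteq> carrier R" using I' by auto
      show "\<zero>\<^bsub>R\<^esub> \<in> {a \<in> I. f a = a \<odot>\<^bsub>E\<^esub> sol l}" using I'(2) y solc by simp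
    next
      fix a b assume "a \<in> {a \<in> I. f a = a \<odot>\<^bsub>E\<^esub> sol l}" "b \<in> {a \<in> I. f a = a \<odot>\<^bsub>E\<^esub> sol l}"
      then show "a \<oplus>\<^bsub>R\<^esub> b \<in> {a \<in> I. f a = a \<odot>\<^bsub>E\<^esub> sol l}"
        using subsetD[OF I'(1), of a] subsetD[OF I'(1), of b] I'(3)[of a b]
          lmod_hom_add[OF fE, of a b] solc by (auto simp: E.smult_l_distr)
    next
      fix r a assume "r \<in> carrier R" "a \<in> {a \<in> I. f a = a \<odot>\<^bsub>E\<^esub> sol l}"
      then show "r \<otimes>\<^bsub>R\<^esub> a \<in> {a \<in> I. f a = a \<odot>\<^bsub>E\<^esub> sol l}"
        using subsetD[OF I'(1), of a] I'(4)[of r a] lmod_hom_smult[OF fE, of r a] solc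
        by (auto simp: E.smult_assoc1)
    qed
    then have "I \<subseteq> {a \<in> I. f a = a \<odot>\<^bsub>E\<^esub> sol l}" by (rule A(3)) (use A(2) s in auto)
    then show "\<exists>y\<in>carrier (E\<lparr>carrier := U\<rparr>). \<forall>a\<in>I. f a = a \<odot>\<^bsub>E\<lparr>carrier := U\<rparr>\<^esub> y"
      using sU by (intro bexI[of _ "sol l"]) auto
  qed
  then have "U = carrier E"
    using E.indecomposable_baer_submodule_eq[OF E(2) U] xU x(2) by blast
  moreover have "|U| \<le>o k"
    unfolding U_def by (intro UNION_Cinfinite_bound countable_Cinfinite_bound ballI card k) simp
  ultimately show ?thesis by simp
qed

section \<open>Categoricity\<close>

text \<open>A chain that does not become stationary has a strictly increasing subsequence.\<close>

lemma not_left_noetherian_chain: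
  assumes "\<not> left_noetherian R"
  obtains J :: "nat \<Rightarrow> 'r set" where "\<And>n. left_ideal (J n) R" "\<And>n. J n \<subset> J (Suc n)"
proof -
  obtain I :: "nat \<Rightarrow> 'r set" where I: "\<forall>n. left_ideal (I n) R" "\<forall>n. I n \<subseteq> I (Suc n)"
    and ne: "\<not> (\<exists>n. \<forall>m\<ge>n. I m = I n)"
    using assms unfolding left_noetherian_def not_all not_imp by (elim exE conjE)
  have "\<exists>m. I n \<subset> I m" for n
  proof -
    have "\<exists>m\<ge>n. I m \<noteq> I n" using ne by simp
    then obtain m where m: "n \<le> m" "I m \<noteq> I n" by (elim exE conjE)
    have "I n \<subseteq> I m" by (rule lift_Suc_mono_le[OF _ m(1)]) (rule I(2)[rule_format])
    then show ?thesis using m(2) by (intro exI[of _ m] psubsetI) auto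
  qed
  then have "\<forall>n. \<exists>m. I n \<subset> I m" ..
  then obtain g where g: "\<forall>n. I n \<subset> I (g n)" by (rule choice[THEN exE])
  show ?thesis
    by (rule that[of "\<lambda>n. I ((g ^^ n) 0)"]) (use I(1) g in auto)
qed

text \<open>Suppose that the left ideals \<open>J n\<close> increase strictly. The character module \<open>C\<close> has elements
  \<open>e n\<close> that are killed by \<open>J n\<close> but not by some \<open>a n\<close> in \<open>J (n + 1)\<close>. Put copies of them at different
  places \<open>j n\<close> of the power with small supports, and let \<open>x\<close> be their formal sum: it has countable
  support, and \<open>a p\<close> sees only the first \<open>p + 1\<close> terms of it. As there are more places than a finite
  direct power has elements, the \<open>j n\<close> can be chosen such that \<open>h\<close> maps the multiple by \<open>a n\<close> of the
  \<open>n\<close>-th term outside the finite set of coordinates used by the earlier terms. Then \<open>h x\<close> has a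
  nonzero coordinate in infinitely many places.\<close>

lemma embedding_imp_left_noetherian:
  fixes R :: "('r, 'x) ring_scheme" and X :: "'i set" and Y :: "'j set"
  assumes R: "ring R" and k: "Cinfinite k" "|carrier R| \<le>o k" and X: "ctwo ^c k <o |X|"
    and h: "h \<in> lmod_hom R (supported_module (small_subsets k X) (character_module R))
      (direct_power Y (character_module R))"
    and inj: "inj_on h (carrier (supported_module (small_subsets k X) (character_module R)))"
  shows "left_noetherian R"
proof (rule ccontr)
  assume "\<not> left_noetherian R"
  then obtain J :: "nat \<Rightarrow> 'r set" where J: "\<And>n. left_ideal (J n) R" "\<And>n. J n \<subset> J (Suc n)"
    using not_left_noetherian_chain by blast
  let ?C = "character_module R"
  let ?N = "supported_module (small_subsets k X) ?C" and ?A = "direct_power Y ?C"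
  interpret R: ring R by fact
  interpret C: lmodule R ?C by (rule lmoduleI[OF left_module_character_module[OF R]])
  have lN: "left_module R ?N" by (rule C.left_module_supported[OF set_ideal_small_subsets[OF k(1)]])
  have lA: "left_module R ?A" by (rule C.left_module_supported[OF set_ideal_Fpow])
  interpret N: left_module R ?N by fact
  interpret A: left_module R ?A by fact
  interpret h: lmodule_hom R ?N ?A h by (rule lmodule_homI[OF lN lA h])
  let ?z = "\<zero>\<^bsub>?C\<^esub>"
  have t: "Cinfinite (ctwo ^c k)" by (rule Cinfinite_ctwo_cexp[OF k(1)])
  have Jmono: "J m \<subseteq> J n" if "m \<le> n" for m n
    using that by (rule lift_Suc_mono_le[rotated]) (use J(2) in blast)
  have "\<forall>n. \<exists>a. a \<in> J (Suc n) \<and> a \<notin> J n" using J(2) by blast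
  then obtain a where a: "\<And>n. a n \<in> J (Suc n)" "\<And>n. a n \<notin> J n" by metis
  have aR: "a n \<in> carrier R" for n
    using a(1)[of n] J(1)[of "Suc n"] left_ideal_iff[OF R, of "J (Suc n)"] by auto
  have "\<exists>e. e \<in> carrier ?C \<and> (\<forall>r\<in>J n. r \<odot>\<^bsub>?C\<^esub> e = ?z) \<and> a n \<odot>\<^bsub>?C\<^esub> e \<noteq> ?z" for n
    using character_separates[OF R J(1) aR a(2)] by metis
  then obtain e where e: "\<And>n. e n \<in> carrier ?C" "\<And>n r. r \<in> J n \<Longrightarrow> r \<odot>\<^bsub>?C\<^esub> e n = ?z"
    "\<And>n. a n \<odot>\<^bsub>?C\<^esub> e n \<noteq> ?z" by metis
  define s where "s j n = (\<lambda>i. if i = j then e n else ?z)" for j :: 'i and n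
  have sN: "s j n \<in> carrier ?N" if "j \<in> X" for j n
  proof -
    have "supp ?C (s j n) \<subseteq> {j}" by (auto simp: supp_def s_def)
    then have "supp ?C (s j n) \<in> small_subsets k X"
      using that finite_Cinfinite_bound[OF _ k(1)] finite_subset
      unfolding small_subsets_def by blast
    then show ?thesis using e(1) unfolding supported_module_carrier by (simp add: s_def)
  qed
  have hA: "finite (supp ?C (h x))" if "x \<in> carrier ?N" for x
    using h.closed[OF that] by (simp add: direct_power_carrier)
  have many: "\<exists>j\<in>X - P. \<not> supp ?C (h (a n \<odot>\<^bsub>?N\<^esub> s j n)) \<subseteq> F"
    if "finite P" "finite F" for P F n
  proof (rule ccontr)
    assume none: "\<not> ?thesis"
    let ?f = "\<lambda>j. h (a n \<odot>\<^bsub>?N\<^esub> s j n)"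
    have c: "a n \<odot>\<^bsub>?N\<^esub> s j n \<in> carrier ?N" if "j \<in> X" for j
      by (rule N.smult_closed[OF aR sN[OF that]])
    have "inj_on ?f (X - P)"
    proof (rule inj_onI)
      fix i j assume ij: "i \<in> X - P" "j \<in> X - P" "?f i = ?f j"
      then have "a n \<odot>\<^bsub>?N\<^esub> s i n = a n \<odot>\<^bsub>?N\<^esub> s j n"
        using inj_onD[OF inj] c by auto
      from fun_cong[OF this, of i] show "i = j"
        using e(3)[of n] C.r_null[OF aR[of n]]
        by (simp add: s_def split: if_splits)
    qed
    moreover have "?f ` (X - P) \<subseteq> carrier (direct_power F ?C)"
    proof (rule image_subsetI)
      fix j assume j: "j \<in> X - P"
      then have "?f j \<in> carrier ?A" using h.closed[OF c] by blast
      moreover have "supp ?C (?f j) \<subseteq> F" using none j by blast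
      ultimately show "?f j \<in> carrier (direct_power F ?C)" by (simp add: direct_power_carrier)
    qed
    moreover have "|carrier (direct_power F ?C)| \<le>o ctwo ^c k"
      by (rule card_direct_power_le[OF finite_Cinfinite_bound[OF that(2) t] card_character_module[OF k(2,1)] t])
    ultimately have "|X - P| \<le>o ctwo ^c k" by (rule card_of_inj_le)
    then have "|(X - P) \<union> P| \<le>o ctwo ^c k"
      by (rule Un_Cinfinite_bound[OF _ finite_Cinfinite_bound[OF that(1) t] t])
    then have "|X| \<le>o ctwo ^c k" by (rule card_of_subset_le[rotated]) blast
    then show False using X not_ordLess_ordLeq by blast
  qed
  have "\<exists>j :: nat \<Rightarrow> 'i. \<forall>n. j n \<in> X - j ` {..<n} \<and>
    \<not> supp ?C (h (a n \<odot>\<^bsub>?N\<^esub> s (j n) n)) \<subseteq> (\<Union>m<n. supp ?C (h (s (j m) m)))"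
  proof (rule dependent_wellorder_choice)
    fix r :: 'i and f g :: "nat \<Rightarrow> 'i" and n :: nat
    assume "\<And>m. m < n \<Longrightarrow> f m = g m"
    then have "f ` {..<n} = g ` {..<n}"
      "(\<Union>m<n. supp ?C (h (s (f m) m))) = (\<Union>m<n. supp ?C (h (s (g m) m)))" by auto
    then show "(r \<in> X - f ` {..<n} \<and>
        \<not> supp ?C (h (a n \<odot>\<^bsub>?N\<^esub> s r n)) \<subseteq> (\<Union>m<n. supp ?C (h (s (f m) m)))) \<longleftrightarrow>
      (r \<in> X - g ` {..<n} \<and>
        \<not> supp ?C (h (a n \<odot>\<^bsub>?N\<^esub> s r n)) \<subseteq> (\<Union>m<n. supp ?C (h (s (g m) m))))" by simp
  next
    fix n :: nat and f :: "nat \<Rightarrow> 'i"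
    assume "\<And>m. m < n \<Longrightarrow> f m \<in> X - f ` {..<m} \<and>
      \<not> supp ?C (h (a m \<odot>\<^bsub>?N\<^esub> s (f m) m)) \<subseteq> (\<Union>i<m. supp ?C (h (s (f i) i)))"
    then have "finite (\<Union>m<n. supp ?C (h (s (f m) m)))" using hA sN by blast
    then show "\<exists>r. r \<in> X - f ` {..<n} \<and>
      \<not> supp ?C (h (a n \<odot>\<^bsub>?N\<^esub> s r n)) \<subseteq> (\<Union>m<n. supp ?C (h (s (f m) m)))"
      using many[of "f ` {..<n}"] by blast
  qed
  then obtain j :: "nat \<Rightarrow> 'i" where j': "\<forall>n. j n \<in> X - j ` {..<n} \<and>
    \<not> supp ?C (h (a n \<odot>\<^bsub>?N\<^esub> s (j n) n)) \<subseteq> (\<Union>m<n. supp ?C (h (s (j m) m)))" by (elim exE)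
  have j: "j n \<in> X" "j n \<notin> j ` {..<n}"
    "\<not> supp ?C (h (a n \<odot>\<^bsub>?N\<^esub> s (j n) n)) \<subseteq> (\<Union>m<n. supp ?C (h (s (j m) m)))" for n
    using j'[rule_format, of n] by blast+
  have jinj: "j m = j n \<longleftrightarrow> m = n" for m n
    using j(2)[of m] j(2)[of n] by (metis imageI lessThan_iff linorder_neqE_nat)
  define F where "F n = (\<Union>m<n. supp ?C (h (s (j m) m)))" for n
  \<comment> \<open>\<open>part n\<close> is the sum of the terms before the \<open>n\<close>-th one, \<open>x\<close> the sum of all terms.\<close>
  define part where "part n = (\<lambda>i. if \<exists>m<n. i = j m then e (THE m. i = j m) else ?z)" for n
  define x where "x = (\<lambda>i. if \<exists>m. i = j m then e (THE m. i = j m) else ?z)"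
  have the_j: "(THE m. j n = j m) = n" for n by (simp add: jinj)
  have part_Suc: "part (Suc n) = part n \<oplus>\<^bsub>?N\<^esub> s (j n) n" for n
  proof
    fix i
    have z: "?z \<in> carrier ?C" by (rule C.M.zero_closed)
    consider m where "i = j m" | "\<nexists>m. i = j m" by blast
    then show "part (Suc n) i = (part n \<oplus>\<^bsub>?N\<^esub> s (j n) n) i"
    proof cases
      case (1 m)
      have "part q i = (if m < q then e m else ?z)" for q
        unfolding part_def 1 the_j jinj by simp
      moreover have "s (j n) n i = (if m = n then e m else ?z)" by (simp add: s_def 1 jinj)
      ultimately show ?thesis
        unfolding supported_module_simps
        using C.M.l_zero[OF e(1)[of m]] C.M.r_zero[OF e(1)[of m]] C.M.l_zero[OF z]
        by (cases m n rule: linorder_cases) simp_all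
    next
      case 2
      then have "part q i = ?z" "s (j n) n i = ?z" for q by (auto simp: part_def s_def)
      then show ?thesis unfolding supported_module_simps using C.M.l_zero[OF z] by metis
    qed
  qed
  have part: "part n \<in> carrier ?N \<and> supp ?C (h (part n)) \<subseteq> F n" for n
  proof (induction n)
    case 0
    have "part 0 = \<zero>\<^bsub>?N\<^esub>" by (simp add: part_def)
    then show ?case using N.M.zero_closed h.zero by (simp add: supp_def)
  next
    case (Suc n)
    have "h (part (Suc n)) = h (part n) \<oplus>\<^bsub>?A\<^esub> h (s (j n) n)"
      unfolding part_Suc using Suc sN[OF j(1)] by (intro h.add) auto
    then have "supp ?C (h (part (Suc n))) \<subseteq> supp ?C (h (part n)) \<union> supp ?C (h (s (j n) n))"
      using C.supp_add by simp
    also have "\<dots> \<subseteq> F n \<union> supp ?C (h (s (j n) n))" using Suc by blast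
    also have "\<dots> = F (Suc n)" by (auto simp: F_def lessThan_Suc)
    finally show ?case unfolding part_Suc using Suc sN[OF j(1)] by (simp del: supported_module_simps)
  qed
  have xN: "x \<in> carrier ?N"
  proof -
    have "supp ?C x \<subseteq> range j" by (auto simp: x_def supp_def)
    moreover have "|range j| \<le>o k" by (rule countable_Cinfinite_bound[OF _ k(1)]) simp
    ultimately have "supp ?C x \<in> small_subsets k X"
      using j(1) card_of_subset_le[of "supp ?C x" "range j" k] by (auto simp: small_subsets_def)
    then show ?thesis using e(1) C.M.zero_closed unfolding supported_module_carrier by (simp add: x_def)
  qed
  have ax: "a p \<odot>\<^bsub>?N\<^esub> x = a p \<odot>\<^bsub>?N\<^esub> part p \<oplus>\<^bsub>?N\<^esub> a p \<odot>\<^bsub>?N\<^esub> s (j p) p" for p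
  proof
    fix i
    have z: "?z \<in> carrier ?C" "a p \<odot>\<^bsub>?C\<^esub> ?z = ?z"
      by (rule C.M.zero_closed) (rule C.r_null[OF aR])
    consider m where "i = j m" | "\<nexists>m. i = j m" by blast
    then show "(a p \<odot>\<^bsub>?N\<^esub> x) i = (a p \<odot>\<^bsub>?N\<^esub> part p \<oplus>\<^bsub>?N\<^esub> a p \<odot>\<^bsub>?N\<^esub> s (j p) p) i"
    proof cases
      case (1 m)
      have c: "a p \<odot>\<^bsub>?C\<^esub> e m \<in> carrier ?C" by (rule C.smult_closed[OF aR e(1)])
      have gt: "a p \<odot>\<^bsub>?C\<^esub> e m = ?z" if "p < m"
        by (rule e(2)) (use a(1)[of p] Jmono[of "Suc p" m] that in auto)
      have "x i = e m" unfolding x_def 1 the_j jinj by simp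
      moreover have "part p i = (if m < p then e m else ?z)"
        unfolding part_def 1 the_j jinj by simp
      moreover have "s (j p) p i = (if m = p then e m else ?z)" by (simp add: s_def 1 jinj)
      ultimately show ?thesis
        unfolding supported_module_simps
        using C.M.l_zero[OF c] C.M.r_zero[OF c] C.M.l_zero[OF z(1)] z(2) gt
        by (cases m p rule: linorder_cases) simp_all
    next
      case 2
      then have "x i = ?z" "part p i = ?z" "s (j p) p i = ?z" by (auto simp: x_def part_def s_def)
      then show ?thesis unfolding supported_module_simps using C.M.l_zero[OF z(1)] z(2) by metis
    qed
  qed
  have "\<exists>i. i \<in> supp ?C (h (a n \<odot>\<^bsub>?N\<^esub> s (j n) n)) \<and> i \<notin> F n" for n
    using j(3)[of n] unfolding F_def by blast
  then obtain i where i: "\<And>n. i n \<in> supp ?C (h (a n \<odot>\<^bsub>?N\<^esub> s (j n) n))" "\<And>n. i n \<notin> F n" by metis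
  have hA_app: "h y u \<in> carrier ?C" if "y \<in> carrier ?N" for y u
    using h.closed[OF that] by (simp add: direct_power_carrier)
  have hs: "h (a n \<odot>\<^bsub>?N\<^esub> y) u = a n \<odot>\<^bsub>?C\<^esub> h y u" if "y \<in> carrier ?N" for n y u
    using fun_cong[OF h.smult[OF aR[of n] that], of u] by simp
  have "i n \<in> supp ?C (h x)" for n
  proof -
    have "h (part n) (i n) = ?z" using part[of n] i(2)[of n] by (auto simp: supp_def)
    then have "h (a n \<odot>\<^bsub>?N\<^esub> part n) (i n) = ?z"
      using hs[of "part n" n "i n"] part[of n] C.r_null[OF aR[of n]] by (simp del: supported_module_simps)
    moreover have "h (a n \<odot>\<^bsub>?N\<^esub> x) = h (a n \<odot>\<^bsub>?N\<^esub> part n) \<oplus>\<^bsub>?A\<^esub> h (a n \<odot>\<^bsub>?N\<^esub> s (j n) n)"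
      unfolding ax by (intro h.add N.smult_closed aR sN j(1) conjunct1[OF part])
    moreover have "h (a n \<odot>\<^bsub>?N\<^esub> s (j n) n) (i n) \<noteq> ?z" using i(1)[of n] by (simp add: supp_def)
    moreover have "h (a n \<odot>\<^bsub>?N\<^esub> s (j n) n) (i n) \<in> carrier ?C"
      by (intro hA_app N.smult_closed aR sN j(1))
    ultimately have "h (a n \<odot>\<^bsub>?N\<^esub> x) (i n) \<noteq> ?z"
      using C.M.l_zero by simp
    then show ?thesis
      using hs[OF xN, of n "i n"] C.r_null[OF aR[of n]] by (auto simp: supp_def simp del: supported_module_simps)
  qed
  then have "range i \<subseteq> supp ?C (h x)" by blast
  then have "finite (range i)" using hA[OF xN] finite_subset by blast
  moreover have "inj i"
  proof (rule linorder_injI)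
    fix q p :: nat assume "q < p"
    have "h (s (j q) q) (i q) \<noteq> ?z"
      using i(1)[of q] hs[of "s (j q) q" q "i q", OF sN[OF j(1)]] C.r_null[OF aR[of q]]
      by (auto simp: supp_def simp del: supported_module_simps)
    then have "i q \<in> F p" using \<open>q < p\<close> by (auto simp: F_def supp_def)
    then show "i q \<noteq> i p" using i(2)[of p] by metis
  qed
  ultimately show False using finite_imageD by blast
qed

text \<open>Categoricity on the type \<open>'b\<close> identifies modules on other types as well.\<close>

lemma locally_baer_copy_iso:
  fixes R :: "('r, 'x) ring_scheme" and l :: "'b rel"
    and M :: "('r, 'm) module" and N :: "('r, 'n) module"
  assumes R: "ring R" "|carrier R| \<le>o |UNIV :: 'b set|" and l: "Card_order l"
    and cat: "categorical_in R l {M :: ('r, 'b) module. locally_injective R M}"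
    and M: "locally_baer R M" "|carrier M| =o l" and N: "locally_baer R N" "|carrier N| =o l"
  shows "lmod_iso R M N"
proof -
  have lM: "left_module R M" and lN: "left_module R N"
    using M N by (simp_all add: locally_baer_def)
  have "l \<le>o |Field l|" by (rule ordIso_imp_ordLeq[OF ordIso_symmetric[OF card_of_Field_eq[OF l]]])
  also have "|Field l| \<le>o |UNIV :: 'b set|" by (rule card_of_mono1) simp
  finally have lU: "l \<le>o |UNIV :: 'b set|" .
  obtain M' :: "('r, 'b) module" where M': "left_module R M'" "lmod_iso R M M'"
    using lmod_iso_copy[OF lM ordIso_ordLeq_trans[OF M(2) lU]] by blast
  obtain N' :: "('r, 'b) module" where N': "left_module R N'" "lmod_iso R N N'"
    using lmod_iso_copy[OF lN ordIso_ordLeq_trans[OF N(2) lU]] by blast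
  have "locally_injective R M'" "locally_injective R N'"
    unfolding locally_injective_iff_locally_baer[OF R]
    using locally_baer_iso[OF M(1) M'] locally_baer_iso[OF N(1) N'] by auto
  moreover have "|carrier M'| =o l" "|carrier N'| =o l"
    using lmod_iso_card[OF M'(2)] lmod_iso_card[OF N'(2)] M(2) N(2)
    by (auto intro: ordIso_transitive[OF ordIso_symmetric])
  ultimately have "lmod_iso R M' N'" using cat unfolding categorical_in_def by blast
  then show ?thesis
    using lmod_iso_trans[OF lmod_iso_trans[OF M'(2)]] lmod_iso_sym[OF lN N'(2)] by blast
qed

lemma character_module_nontrivial:
  assumes R: "ring R" and one: "\<one>\<^bsub>R\<^esub> \<noteq> \<zero>\<^bsub>R\<^esub>"
  shows "carrier (character_module R) \<noteq> {\<zero>\<^bsub>character_module R\<^esub>}"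
proof -
  let ?C = "character_module R"
  interpret R: ring R by fact
  interpret C: left_module R ?C by (rule left_module_character_module[OF R])
  have I: "left_ideal {\<zero>\<^bsub>R\<^esub>} R" unfolding left_ideal_iff[OF R] by simp
  have "\<one>\<^bsub>R\<^esub> \<notin> {\<zero>\<^bsub>R\<^esub>}" using one by simp
  from character_separates[OF R I R.one_closed this]
  obtain \<chi> where \<chi>: "\<chi> \<in> carrier ?C" "\<one>\<^bsub>R\<^esub> \<odot>\<^bsub>?C\<^esub> \<chi> \<noteq> \<zero>\<^bsub>?C\<^esub>" by metis
  have "\<chi> \<noteq> \<zero>\<^bsub>?C\<^esub>" using \<chi>(2) C.smult_one[OF \<chi>(1)] by metis
  then show ?thesis using \<chi>(1) by (metis singletonD)
qed

lemma Cinfinite_csum_natLeq: "Cinfinite ( |A| +c natLeq)"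
  by (intro conjI cinfinite_csum Card_order_csum) (simp add: natLeq_cinfinite)

lemma card_of_le_csum_natLeq: "|A| \<le>o |A| +c natLeq"
  by (rule ordLeq_csum1[OF card_of_Card_order])

text \<open>Let \<open>C\<close> be the character module. The direct sum of \<open>l\<close> copies of \<open>C\<close> is locally injective of size
  \<open>l\<close>, and it remains so after adding the power \<open>N\<close> of \<open>C\<close> over the successor of \<open>2^k\<close> with supports
  of size at most \<open>k\<close>: this power is injective, and by Hausdorff's formula it is not larger than the
  successor of \<open>2^k\<close>, which is at most \<open>l\<close>. So categoricity embeds \<open>N\<close> into the direct sum.\<close>

lemma categorical_imp_left_noetherian:
  fixes R :: "('r, 'x) ring_scheme" and l :: "'b rel"
  assumes R: "ring R" "|carrier R| \<le>o |UNIV :: 'b set|" "\<one>\<^bsub>R\<^esub> \<noteq> \<zero>\<^bsub>R\<^esub>"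
    and k: "Cinfinite k" "|carrier R| \<le>o k"
    and l: "Card_order l" "ctwo ^c k <o l"
    and cat: "categorical_in R l {M :: ('r, 'b) module. locally_injective R M}"
  shows "left_noetherian R"
proof -
  let ?C = "character_module R" and ?m = "cardSuc (ctwo ^c k)"
  let ?N = "supported_module (small_subsets k (Field ?m)) ?C" and ?A = "direct_power (Field l) ?C"
  interpret R: ring R by fact
  have C: "baer R ?C" by (rule baer_character_module[OF R(1)])
  interpret C: lmodule R ?C by (rule lmoduleI[OF baer_left_module[OF C]])
  have Cn: "carrier ?C \<noteq> {\<zero>\<^bsub>?C\<^esub>}"
    by (rule character_module_nontrivial[OF R(1,3)])
  have t: "Cinfinite (ctwo ^c k)" by (rule Cinfinite_ctwo_cexp[OF k(1)])
  have ml: "?m \<le>o l" using cardSuc_least[OF conjunct2[OF t] l] .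
  have li: "Cinfinite l" using cinfinite_mono[OF ordLess_imp_ordLeq[OF l(2)]] t l(1) by blast
  have Ct: "|carrier ?C| \<le>o ctwo ^c k" by (rule card_character_module[OF k(2,1)])
  have N: "baer R ?N" by (rule baer_small_support_power[OF k C])
  interpret N: left_module R ?N using N by (rule baer_left_module)
  have A: "locally_baer R ?A" by (rule locally_baer_direct_power[OF C])
  interpret A: left_module R ?A using A by (simp add: locally_baer_def)
  have cA: "|carrier ?A| =o l"
    using card_direct_power[OF C.left_module_axioms Cn card_of_Field_eq[OF l(1)] _ li]
      ordLeq_transitive[OF Ct ordLess_imp_ordLeq[OF l(2)]] by blast
  have m: "Cinfinite ?m" by (rule Cinfinite_cardSuc[OF t])
  have "|carrier ?N| \<le>o ?m"
    by (rule card_small_support_power[OF k(1)])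
      (rule ordIso_imp_ordLeq[OF card_of_Field_eq[OF conjunct2[OF m]]],
       rule ordLeq_transitive[OF Ct cardSuc_ordLeq[OF conjunct2[OF t]]])
  then have cN: "|carrier ?N| \<le>o l" using ml by (rule ordLeq_transitive)
  have cP: "|carrier (prod_module ?N ?A)| =o l"
  proof -
    have "|carrier ?N \<times> carrier ?A| \<le>o l"
      by (rule Times_Cinfinite_bound[OF cN ordIso_imp_ordLeq[OF cA] li])
    moreover have "|carrier ?A| \<le>o |carrier ?N \<times> carrier ?A|"
      using N.M.zero_closed by (intro card_of_Times2) blast
    then have "l \<le>o |carrier ?N \<times> carrier ?A|"
      by (rule ordIso_ordLeq_trans[OF ordIso_symmetric[OF cA]])
    ultimately show ?thesis unfolding prod_module_simps by (simp add: ordIso_iff_ordLeq)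
  qed
  have "lmod_iso R (prod_module ?N ?A) ?A"
    by (rule locally_baer_copy_iso[OF R(1,2) l(1) cat locally_baer_prod[OF N A] cP A cA])
  then obtain \<phi> where \<phi>: "\<phi> \<in> lmod_hom R (prod_module ?N ?A) ?A"
    "bij_betw \<phi> (carrier (prod_module ?N ?A)) (carrier ?A)" by (rule lmod_isoE)
  have incl: "(\<lambda>x. (x, \<zero>\<^bsub>?A\<^esub>)) \<in> lmod_hom R ?N (prod_module ?N ?A)"
    using A.M.zero_closed A.r_null A.M.l_zero[OF A.M.zero_closed]
    unfolding prod_module_simps
    by (intro lmod_homI) (auto simp del: supported_module_simps)
  show ?thesis
  proof (rule embedding_imp_left_noetherian[OF R(1) k])
    show "ctwo ^c k <o |Field ?m|"
      by (rule ordLess_ordIso_trans[OF cardSuc_greater[OF conjunct2[OF t]]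
          ordIso_symmetric[OF card_of_Field_eq[OF conjunct2[OF m]]]])
    show "(\<lambda>x. \<phi> (x, \<zero>\<^bsub>?A\<^esub>)) \<in> lmod_hom R ?N ?A" by (rule lmod_hom_comp[OF incl \<phi>(1)])
    show "inj_on (\<lambda>x. \<phi> (x, \<zero>\<^bsub>?A\<^esub>)) (carrier ?N)"
    proof (rule inj_onI)
      fix x y assume "x \<in> carrier ?N" "y \<in> carrier ?N" "\<phi> (x, \<zero>\<^bsub>?A\<^esub>) = \<phi> (y, \<zero>\<^bsub>?A\<^esub>)"
      then have "(x, \<zero>\<^bsub>?A\<^esub>) = (y, \<zero>\<^bsub>?A\<^esub>)"
        using bij_betw_imp_inj_on[OF \<phi>(2), THEN inj_onD] A.M.zero_closed
        unfolding prod_module_simps by blast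
      then show "x = y" by simp
    qed
  qed
qed

text \<open>The direct sums of \<open>l\<close> copies of two indecomposable injective modules are isomorphic, so
  each of the two embeds into a direct sum of copies of the other. Existence follows from the fact
  that the character module is a nonzero injective module.\<close>

lemma categorical_imp_unique_indecomposable:
  fixes R :: "('r, 'x) ring_scheme" and l :: "'b rel"
  assumes R: "ring R" "|carrier R| \<le>o |UNIV :: 'b set|"
    and k: "Cinfinite k" "|carrier R| \<le>o k"
    and kc: "k \<le>o |UNIV :: 'c set|"
    and l: "Card_order l" "ctwo ^c k <o l"
    and cat: "categorical_in R l {M :: ('r, 'b) module. locally_injective R M}"
  shows "left_noetherian R \<and>
    (\<exists>E :: ('r, 'c) module. injective_module R E \<and> indecomposable_module R E \<and>
      (\<forall>E' :: ('r, 'c) module.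
        injective_module R E' \<and> indecomposable_module R E' \<longrightarrow> lmod_iso R E' E))"
proof -
  let ?C = "character_module R"
  interpret R: ring R by fact
  have kl: "k <o l" by (rule ordLess_transitive[OF ordLess_ctwo_cexp[OF conjunct2[OF k(1)]] l(2)])
  have li: "Cinfinite l" using cinfinite_mono[OF ordLess_imp_ordLeq[OF kl]] k(1) l(1) by blast
  have Rc: "|carrier R| \<le>o |UNIV :: 'c set|" by (rule ordLeq_transitive[OF k(2) kc])
  have one: "\<one>\<^bsub>R\<^esub> \<noteq> \<zero>\<^bsub>R\<^esub>"
  proof
    assume eq: "\<one>\<^bsub>R\<^esub> = \<zero>\<^bsub>R\<^esub>"
    \<comment> \<open>All modules over the zero ring are zero, so none has size \<open>l\<close>.\<close>
    obtain M :: "('r, 'b) module" where M: "locally_injective R M" "|carrier M| =o l"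
      using cat unfolding categorical_in_def by blast
    interpret M: left_module R M using M(1) by (simp add: locally_injective_def)
    have "x = \<zero>\<^bsub>M\<^esub>" if "x \<in> carrier M" for x
      using M.smult_one[OF that] M.l_null[OF that] eq by simp
    then have "carrier M \<subseteq> {\<zero>\<^bsub>M\<^esub>}" by blast
    then have "finite (carrier M)" using finite_subset by blast
    then have "|carrier M| <o k" using Cfinite_ordLess_Cinfinite[of "|carrier M|", OF _ k(1)]
      by (simp add: cfinite_def Field_card_of card_of_Card_order)
    then have "l <o k" by (rule ordIso_ordLess_trans[OF ordIso_symmetric[OF M(2)]])
    then show False using kl ordLess_transitive ordLess_irreflexive by blast
  qed
  have noeth: "left_noetherian R"
    by (rule categorical_imp_left_noetherian[OF R one k l cat])
  have C: "baer R ?C" by (rule baer_character_module[OF R(1)])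
  interpret C: lmodule R ?C by (rule lmoduleI[OF baer_left_module[OF C]])
  have Cn: "carrier ?C \<noteq> {\<zero>\<^bsub>?C\<^esub>}"
    by (rule character_module_nontrivial[OF R(1) one])
  obtain T where T: "C.uniform_submodule T"
    using C.exists_uniform_submodule[OF noeth C.submodule_UNIV Cn] by blast
  obtain B where B: "baer R (?C\<lparr>carrier := B\<rparr>)" "indecomposable_module R (?C\<lparr>carrier := B\<rparr>)"
    using C.uniform_hull_indecomposable[OF C T] by metis
  have lB: "left_module R (?C\<lparr>carrier := B\<rparr>)" by (rule baer_left_module[OF B(1)])
  obtain E :: "('r, 'c) module" where E: "left_module R E" "lmod_iso R (?C\<lparr>carrier := B\<rparr>) E"
    using lmod_iso_copy[OF lB ordLeq_transitive[OF card_indecomposable_baer[OF noeth B k] kc]]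
    by blast
  have Eb: "baer R E" by (rule baer_iso[OF B(1) E])
  have Ei: "indecomposable_module R E"
    by (rule indecomposable_iso[OF B(2) E(1) lmod_iso_sym[OF lB E(2)]])
  have power: "locally_baer R (direct_power (Field l) E')" "|carrier (direct_power (Field l) E')| =o l"
    if E': "baer R E'" "indecomposable_module R E'" for E' :: "('r, 'c) module"
  proof -
    show "locally_baer R (direct_power (Field l) E')" by (rule locally_baer_direct_power[OF E'(1)])
    have "carrier E' \<noteq> {\<zero>\<^bsub>E'\<^esub>}" using E'(2) by (simp add: indecomposable_module_def)
    then show "|carrier (direct_power (Field l) E')| =o l"
      by (rule card_direct_power[OF baer_left_module[OF E'(1)] _ card_of_Field_eq[OF l(1)]
        ordLeq_transitive[OF card_indecomposable_baer[OF noeth E' k] ordLess_imp_ordLeq[OF kl]] li])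
  qed
  have "lmod_iso R E' E" if E': "injective_module R E'" "indecomposable_module R E'"
    for E' :: "('r, 'c) module"
  proof -
    have E'b: "baer R E'" using E'(1) unfolding injective_module_iff_baer[OF R(1) Rc] .
    interpret E': lmodule R E' by (rule lmoduleI[OF baer_left_module[OF E'b]])
    have "lmod_iso R (direct_power (Field l) E') (direct_power (Field l) E)"
      by (rule locally_baer_copy_iso[OF R l(1) cat power[OF E'b E'(2)] power[OF Eb Ei]])
    then obtain \<phi> where \<phi>: "\<phi> \<in> lmod_hom R (direct_power (Field l) E') (direct_power (Field l) E)"
      "bij_betw \<phi> (carrier (direct_power (Field l) E')) (carrier (direct_power (Field l) E))"
      by (rule lmod_isoE)
    have "Field l \<noteq> {}" using li by (auto simp: cinfinite_def)
    then obtain i where i: "i \<in> Field l" by blast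
    let ?s = "\<lambda>e j. if j = i then e else \<zero>\<^bsub>E'\<^esub>"
    have sc: "?s e \<in> carrier (direct_power (Field l) E')" if "e \<in> carrier E'" for e
      by (rule E'.single_direct_power[OF that i])
    have s: "?s \<in> lmod_hom R E' (direct_power (Field l) E')"
      by (rule lmod_homI[OF sc]) (auto simp: fun_eq_iff)
    show ?thesis
    proof (rule indecomposable_baer_embed_power_iso[OF E'b E'(2) Eb Ei])
      show "(\<lambda>e. \<phi> (?s e)) \<in> lmod_hom R E' (direct_power (Field l) E)"
        by (rule lmod_hom_comp[OF s \<phi>(1)])
      show "inj_on (\<lambda>e. \<phi> (?s e)) (carrier E')"
      proof (rule inj_onI)
        fix e e' assume "e \<in> carrier E'" "e' \<in> carrier E'" "\<phi> (?s e) = \<phi> (?s e')"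
        then have "?s e = ?s e'"
          using inj_onD[OF bij_betw_imp_inj_on[OF \<phi>(2)], OF _ sc sc] by simp
        from fun_cong[OF this, of i] show "e = e'" by simp
      qed
    qed
  qed
  moreover have "injective_module R E" using Eb unfolding injective_module_iff_baer[OF R(1) Rc] .
  ultimately show ?thesis using noeth Ei by blast
qed

text \<open>A locally injective module is injective, hence a direct sum of copies of \<open>E\<close>. As \<open>E\<close> has at
  most \<open>k\<close> elements, the number of copies is the size \<open>l\<close> of the module.\<close>

lemma unique_indecomposable_imp_categorical:
  fixes R :: "('r, 'x) ring_scheme" and E :: "('r, 'c) module" and l :: "'a rel"
  assumes R: "ring R" "|carrier R| \<le>o |UNIV :: 'a set|"
    and k: "Cinfinite k" "|carrier R| \<le>o k"
    and kc: "k \<le>o |UNIV :: 'c set|"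
    and l: "Card_order l" "k <o l"
    and noeth: "left_noetherian R"
    and E: "injective_module R E" "indecomposable_module R E"
    and uniq: "\<And>E' :: ('r, 'c) module. injective_module R E' \<Longrightarrow> indecomposable_module R E' \<Longrightarrow>
      lmod_iso R E' E"
  shows "categorical_in R l {M :: ('r, 'a) module. locally_injective R M}"
proof -
  have Rc: "|carrier R| \<le>o |UNIV :: 'c set|" by (rule ordLeq_transitive[OF k(2) kc])
  have Eb: "baer R E" using E(1) unfolding injective_module_iff_baer[OF R(1) Rc] .
  have lE: "left_module R E" by (rule baer_left_module[OF Eb])
  have En: "carrier E \<noteq> {\<zero>\<^bsub>E\<^esub>}" using E(2) by (simp add: indecomposable_module_def)
  have Ek: "|carrier E| \<le>o k" by (rule card_indecomposable_baer[OF noeth Eb E(2) k])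
  have li: "Cinfinite l" using cinfinite_mono[OF ordLess_imp_ordLeq[OF l(2)]] k(1) l(1) by blast
  let ?D = "direct_power (Field l) E"
  have D: "locally_baer R ?D" by (rule locally_baer_direct_power[OF Eb])
  then have lD: "left_module R ?D" by (simp add: locally_baer_def)
  have cD: "|carrier ?D| =o l"
    by (rule card_direct_power[OF lE En card_of_Field_eq[OF l(1)]
      ordLeq_transitive[OF Ek ordLess_imp_ordLeq[OF l(2)]] li])
  have "l \<le>o |Field l|" by (rule ordIso_imp_ordLeq[OF ordIso_symmetric[OF card_of_Field_eq[OF l(1)]]])
  also have "|Field l| \<le>o |UNIV :: 'a set|" by (rule card_of_mono1) simp
  finally have lU: "l \<le>o |UNIV :: 'a set|" .
  obtain D' :: "('r, 'a) module" where D': "left_module R D'" "lmod_iso R ?D D'"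
    using lmod_iso_copy[OF lD ordIso_ordLeq_trans[OF cD lU]] by blast
  have "locally_injective R D'"
    unfolding locally_injective_iff_locally_baer[OF R] by (rule locally_baer_iso[OF D D'])
  moreover have "|carrier D'| =o l"
    by (rule ordIso_transitive[OF ordIso_symmetric[OF lmod_iso_card[OF D'(2)]] cD])
  moreover have iso: "lmod_iso R M ?D" if M: "locally_injective R M" "|carrier M| =o l"
    for M :: "('r, 'a) module"
  proof -
    have Mb: "baer R M"
      using M(1) unfolding locally_injective_iff_locally_baer[OF R] by (rule locally_baer_imp_baer[OF noeth])
    have "lmod_iso R (M\<lparr>carrier := B\<rparr>) E"
      if B: "baer R (M\<lparr>carrier := B\<rparr>)" "indecomposable_module R (M\<lparr>carrier := B\<rparr>)" for B
    proof -
      have lB: "left_module R (M\<lparr>carrier := B\<rparr>)" by (rule baer_left_module[OF B(1)])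
      obtain B' :: "('r, 'c) module" where B': "left_module R B'" "lmod_iso R (M\<lparr>carrier := B\<rparr>) B'"
        using lmod_iso_copy[OF lB ordLeq_transitive[OF card_indecomposable_baer[OF noeth B k] kc]]
        by blast
      have "injective_module R B'"
        unfolding injective_module_iff_baer[OF R(1) Rc] by (rule baer_iso[OF B(1) B'])
      moreover have "indecomposable_module R B'"
        by (rule indecomposable_iso[OF B(2) B'(1) lmod_iso_sym[OF lB B'(2)]])
      ultimately show ?thesis using uniq lmod_iso_trans[OF B'(2)] by blast
    qed
    then obtain X :: "('c \<Rightarrow> 'a) set" where X: "lmod_iso R (direct_power X E) M"
      using baer_iso_direct_power[OF noeth Mb Eb E(2)] by blast
    have lX: "left_module R (direct_power X E)"
      by (rule lmodule.left_module_supported[OF lmoduleI[OF lE] set_ideal_Fpow])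
    have "|X| =o l"
      by (rule card_index_of_direct_power[OF lE En Ek k(1) ordIso_transitive[OF lmod_iso_card[OF X] M(2)]
        l(2,1)])
    then have "|X| =o |Field l|"
      by (rule ordIso_transitive[OF _ ordIso_symmetric[OF card_of_Field_eq[OF l(1)]]])
    then obtain f where "bij_betw f X (Field l)" unfolding card_of_ordIso[symmetric] by blast
    then have "lmod_iso R (direct_power X E) ?D" by (rule direct_power_reindex[OF lE])
    then show ?thesis by (rule lmod_iso_trans[OF lmod_iso_sym[OF lX X]])
  qed
  moreover have "lmod_iso R M N"
    if "locally_injective R M" "locally_injective R N" "|carrier M| =o l" "|carrier N| =o l"
    for M N :: "('r, 'a) module"
  proof -
    have "left_module R N" using that(2) by (simp add: locally_injective_def)
    then show ?thesis
      by (rule lmod_iso_trans[OF iso[OF that(1,3)] lmod_iso_sym[OF _ iso[OF that(2,4)]]])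
  qed
  ultimately show ?thesis unfolding categorical_in_def by blast
qed

theorem theorem3p19:
  fixes R :: "('r, 'x) ring_scheme"
  assumes "ring R"
    and "ctwo ^c ( |carrier R| +c natLeq) <o |UNIV :: 'a set|"
    and "ctwo ^c ( |carrier R| +c natLeq) <o |UNIV :: 'b set|"
    and "ctwo ^c ( |carrier R| +c natLeq) <o |UNIV :: 'c set|"
  shows "((\<forall>l :: 'a rel. Card_order l \<and> |carrier R| +c natLeq <o l \<longrightarrow>
            categorical_in R l {M :: ('r, 'a) module. locally_injective R M})
      \<longleftrightarrow>
         (\<exists>l :: 'b rel. Card_order l \<and> ctwo ^c ( |carrier R| +c natLeq) <o l \<and>
            categorical_in R l {M :: ('r, 'b) module. locally_injective R M}))
    \<and>
        ((\<exists>l :: 'b rel. Card_order l \<and> ctwo ^c ( |carrier R| +c natLeq) <o l \<and>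
            categorical_in R l {M :: ('r, 'b) module. locally_injective R M})
      \<longleftrightarrow>
         (left_noetherian R \<and>
          (\<exists>E :: ('r, 'c) module. injective_module R E \<and> indecomposable_module R E \<and>
            (\<forall>E' :: ('r, 'c) module.
              injective_module R E' \<and> indecomposable_module R E' \<longrightarrow> lmod_iso R E' E))))"
    (is "(?all \<longleftrightarrow> ?some) \<and> (_ \<longleftrightarrow> ?unique)")
proof -
  let ?k = "|carrier R| +c natLeq"
  note R = assms(1)
  have k: "Cinfinite ?k" "|carrier R| \<le>o ?k" by (rule Cinfinite_csum_natLeq, rule card_of_le_csum_natLeq)
  have k2: "?k <o ctwo ^c ?k" by (rule ordLess_ctwo_cexp[OF conjunct2[OF k(1)]])
  have kU: "?k <o |UNIV :: 'a set|" "?k <o |UNIV :: 'b set|" "?k <o |UNIV :: 'c set|"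
    by (rule ordLess_transitive[OF k2 assms(2)], rule ordLess_transitive[OF k2 assms(3)],
      rule ordLess_transitive[OF k2 assms(4)])
  have kc: "?k \<le>o |UNIV :: 'c set|" by (rule ordLess_imp_ordLeq[OF kU(3)])
  have Ra: "|carrier R| \<le>o |UNIV :: 'a set|"
    by (rule ordLeq_transitive[OF k(2) ordLess_imp_ordLeq[OF kU(1)]])
  have Rb: "|carrier R| \<le>o |UNIV :: 'b set|"
    by (rule ordLeq_transitive[OF k(2) ordLess_imp_ordLeq[OF kU(2)]])
  have "?unique" if ?all
  proof -
    \<comment> \<open>The size of the type exceeds \<open>2^k\<close>, so it serves as the one cardinal.\<close>
    have "categorical_in R |UNIV :: 'a set| {M :: ('r, 'a) module. locally_injective R M}"
      using that card_of_Card_order kU(1) by blast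
    then show ?thesis
      by (rule categorical_imp_unique_indecomposable[OF R Ra k kc card_of_Card_order assms(2)])
  qed
  moreover have "?unique" if some: ?some
  proof -
    obtain l :: "'b rel" where l: "Card_order l" "ctwo ^c ?k <o l"
      "categorical_in R l {M :: ('r, 'b) module. locally_injective R M}"
      using some by (elim exE conjE)
    show ?thesis by (rule categorical_imp_unique_indecomposable[OF R Rb k kc l])
  qed
  moreover have "?all" "?some" if unique: ?unique
  proof -
    obtain E :: "('r, 'c) module" where noeth: "left_noetherian R"
      and E: "injective_module R E" "indecomposable_module R E"
      and uniq: "\<forall>E' :: ('r, 'c) module.
        injective_module R E' \<and> indecomposable_module R E' \<longrightarrow> lmod_iso R E' E"
      using unique by (elim exE conjE)
    have uniq': "lmod_iso R E' E" if "injective_module R E'" "indecomposable_module R E'"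
      for E' :: "('r, 'c) module" using uniq that by simp
    show ?all
      using unique_indecomposable_imp_categorical[OF R Ra k kc _ _ noeth E uniq'] by blast
    have "categorical_in R |UNIV :: 'b set| {M :: ('r, 'b) module. locally_injective R M}"
      by (rule unique_indecomposable_imp_categorical[OF R Rb k kc card_of_Card_order kU(2) noeth E uniq'])
    then show ?some using card_of_Card_order assms(3) by blast
  qed
  ultimately show ?thesis by argo
qed

end
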